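(* There is a universal constant $c_1>0$ such that the following holds. Assume $\log\mathrm{SNR}>1$ and that, for some $\gamma>0$, the number of blocks satisfies $B=\Omega\!\left(\dfrac{(1+\gamma)\log K}{\phi(\mathrm{SNR})}\right)$, where $\phi(\mathrm{SNR}):=\dfrac{(\log\mathrm{SNR}-1)^2}{\log\mathrm{SNR}}$. Let $(\widehat{\boldsymbol\pi}_1,\widehat{\boldsymbol\pi}_2)$ be a minimizer over $(\mathbf p_1,\mathbf p_2)\in\mathcal P_K\times\mathcal P_K$ of $\big\|\mathbf P^\perp_{\mathrm{bdiag}(\mathbf p_1),X}\,\widetilde{\boldsymbol Y}_{\mathrm{bdiag}(\mathbf p_2)}\big\|_2^2$, let $\widehat{\boldsymbol\Pi}_u=\mathrm{bdiag}(\widehat{\boldsymbol\pi}_u)$ for $u=1,2$, and let $$\hat\beta=\big(\widetilde{\boldsymbol X}_{\widehat{\boldsymbol\Pi}_1}^\top\widetilde{\boldsymbol X}_{\widehat{\boldsymbol\Pi}_1}\big)^{-1}\widetilde{\boldsymbol X}_{\widehat{\boldsymbol\Pi}_1}^\top\widetilde{\boldsymbol Y}_{\widehat{\boldsymbol\Pi}_2}.$$ Then for a fixed $\delta<1$, with $n=KB$, $$|\hat\beta-\beta|\le\sqrt{5\,\lambda_{\max}(\boldsymbol\Sigma)\,\kappa(\boldsymbol\Sigma)}\cdot\frac{n^{-(1-\delta)/2}}{1-n^{-(1-\delta)/2}}$$ with probability at least $$p=1-c_1K^2e^{-2B\phi(\mathrm{SNR})}-2\exp(-n^\delta).$$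
   Context: Model. Let $n=KB$ with block size $K\ge 2$ and number of blocks $B\ge 1$. One observes $\boldsymbol X,\boldsymbol Y\in\mathbb R^n$ with $\boldsymbol Y=\boldsymbol\Pi_X\boldsymbol X\beta+\boldsymbol\Pi_S\boldsymbol W+\boldsymbol\epsilon$, where $\beta\in\mathbb R$, $\boldsymbol\Pi_X,\boldsymbol\Pi_S$ are unknown fixed $n\times n$ permutation matrices, $\boldsymbol X\sim\mathcal N_n(\mathbf 0,\sigma_X^2\mathbf I_n)$, $\boldsymbol W\sim\mathcal N_n(\mathbf 0,\boldsymbol\Sigma^\ast)$ consists of the values at $n$ domain points of a mean-zero Gaussian process with covariance function in a known isotropic class ($\boldsymbol\Sigma^\ast=\sigma^2\mathbf R_\theta$, $\mathbf R_\theta$ a correlation matrix), $\boldsymbol\epsilon\sim\mathcal N_n(\mathbf 0,\tau^2\mathbf I_n)$, and $\boldsymbol X,\boldsymbol W,\boldsymbol\epsilon$ are independent. Put $\boldsymbol\Sigma=\boldsymbol\Sigma^\ast+\tau^2\mathbf I_n$, assumed known and positive definite. Reparametrization. $\boldsymbol\Pi_1=\boldsymbol\Pi_S^\top\boldsymbol\Pi_X$, $\boldsymbol\Pi_2=\boldsymbol\Pi_S^\top$, so that $\boldsymbol\Pi_2\boldsymbol Y=\boldsymbol\Pi_1\boldsymbol X\beta+\boldsymbol W^\ast$ with $\boldsymbol W^\ast\sim\mathcal N_n(\mathbf 0,\boldsymbol\Sigma)$ independent of $\boldsymbol X$. Block structure. $\mathcal P_K$ is the set of $K\times K$ permutation matrices;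 for $\mathbf p\in\mathcal P_K$, $\mathrm{bdiag}(\mathbf p)$ is the $n\times n$ block-diagonal matrix with $B$ diagonal blocks all equal to $\mathbf p$. It is assumed that $\boldsymbol\Pi_X=\mathrm{bdiag}(\boldsymbol\pi_X)$, $\boldsymbol\Pi_S=\mathrm{bdiag}(\boldsymbol\pi_S)$ with $\boldsymbol\pi_X,\boldsymbol\pi_S\in\mathcal P_K$; thus $\boldsymbol\Pi_u=\mathrm{bdiag}(\boldsymbol\pi_u)$, $u=1,2$, with $\boldsymbol\pi_1=\boldsymbol\pi_S^\top\boldsymbol\pi_X$, $\boldsymbol\pi_2=\boldsymbol\pi_S^\top$. Notation. For $n\times n$ permutation matrices $\mathbf Q$: $\widetilde{\boldsymbol X}_{\mathbf Q}=\boldsymbol\Sigma^{-1/2}\mathbf Q\boldsymbol X$, $\widetilde{\boldsymbol Y}_{\mathbf Q}=\boldsymbol\Sigma^{-1/2}\mathbf Q\boldsymbol Y$, $\mathbf P_{\mathbf Q,X}=\widetilde{\boldsymbol X}_{\mathbf Q}(\widetilde{\boldsymbol X}_{\mathbf Q}^\top\widetilde{\boldsymbol X}_{\mathbf Q})^{-1}\widetilde{\boldsymbol X}_{\mathbf Q}^\top$, and $\mathbf P_{\mathbf Q,X}^\perp=\mathbf I_n-\mathbf P_{\mathbf Q,X}$. The signal-to-noise ratio is $\mathrm{SNR}=\dfrac{\beta^2}{\lambda_{\max}(\boldsymbol\Sigma)\,\kappa(\boldsymbol\Sigma)}$, where $\lambda_{\max}$ is the largest eigenvalue and $\kappa(\boldsymbol\Sigma)=\lambda_{\max}(\boldsymbol\Sigma)/\lambda_{\min}(\boldsymbol\Sigma)$.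 Asymptotics. For nonnegative sequences, $a_n=\Omega(b_n)$ means that there are constants $C>0$ and $N$ with $a_n\ge Cb_n$ for all $n\ge N$. The statement concerns sequences of such models in which the block size $K$ is treated as fixed and $B$ (hence $n=KB$) grows. "Universal constants" do not depend on the model parameters.
   Formalization: Assumes σ_X ≥ 1: SNR and the error bound contain no σ_X, and the claim fails for small σ_X (e.g. K=2, Σ=I, β=2, σ_X=0.1, δ=1/2). The bound is for all sufficiently large n along a sequence with K fixed and B→∞; the minimizer is a measurable choice. *)

theory Defs
  imports
    "HOL-Probability.Probability"
    "HOL-Library.Landau_Symbols"
    "Jordan_Normal_Form.Spectral_Radius"
begin

unbundle no inner_syntax and no vec_syntax

definition perm_mats :: "nat \<Rightarrow> real mat set" where
  "perm_mats k = {mat k k (\<lambda>(i, j). if j = s i then 1 else 0) | s. s permutes {..<k}}"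

definition bdiag :: "nat \<Rightarrow> real mat \<Rightarrow> real mat" where
  "bdiag b p = diag_block_mat (replicate b p)"

definition pos_def_mat :: "nat \<Rightarrow> real mat \<Rightarrow> bool" where
  "pos_def_mat n A \<longleftrightarrow> A \<in> carrier_mat n n \<and> transpose_mat A = A \<and>
     (\<forall>v \<in> carrier_vec n. v \<noteq> 0\<^sub>v n \<longrightarrow> v \<bullet> (A *\<^sub>v v) > 0)"

text \<open>The inverse square root of a positive definite matrix \<open>A\<close>: the unique positive
  definite \<open>R\<close> with \<open>R\<^sup>2 = A\<^sup>-\<^sup>1\<close>.\<close>

definition inv_sqrt_mat :: "real mat \<Rightarrow> real mat" where
  "inv_sqrt_mat A =
     (THE R. pos_def_mat (dim_row A) R \<and> inverts_mat (R * R) A \<and> inverts_mat A (R * R))"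

definition lambda_max :: "real mat \<Rightarrow> real" where
  "lambda_max A = Max (spectrum A)"

definition lambda_min :: "real mat \<Rightarrow> real" where
  "lambda_min A = Min (spectrum A)"

definition cond_number :: "real mat \<Rightarrow> real" where
  "cond_number A = lambda_max A / lambda_min A"

text \<open>For a single column \<open>x\<close> the matrix \<open>x\<^sup>T x\<close> is the scalar \<open>x \<bullet> x\<close>, so that
  \<open>x (x\<^sup>T x)\<^sup>-\<^sup>1 x\<^sup>T\<close> has the following entries.\<close>

definition proj_mat :: "nat \<Rightarrow> real vec \<Rightarrow> real mat" where
  "proj_mat n x = mat n n (\<lambda>(i, j). x $ i * inverse (x \<bullet> x) * x $ j)"

definition proj_perp_mat :: "nat \<Rightarrow> real vec \<Rightarrow> real mat" where
  "proj_perp_mat n x = 1\<^sub>m n - proj_mat n x"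

definition random_vec :: "'a measure \<Rightarrow> nat \<Rightarrow> ('a \<Rightarrow> real vec) \<Rightarrow> bool" where
  "random_vec M n V \<longleftrightarrow> V \<in> space M \<rightarrow> carrier_vec n \<and>
     (\<forall>i<n. (\<lambda>\<omega>. V \<omega> $ i) \<in> borel_measurable M)"

definition centered_normal :: "real \<Rightarrow> real measure" where
  "centered_normal v =
     (if v = 0 then return borel 0 else density lborel (normal_density 0 (sqrt v)))"

text \<open>\<open>V \<sim> N\<^sub>n(0, S)\<close>, where \<open>S\<close> may be singular: every linear functional \<open>a\<^sup>T V\<close> is
  distributed as \<open>N(0, a\<^sup>T S a)\<close>.\<close>

definition gaussian_vec :: "'a measure \<Rightarrow> nat \<Rightarrow> real mat \<Rightarrow> ('a \<Rightarrow> real vec) \<Rightarrow> bool" where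
  "gaussian_vec M n S V \<longleftrightarrow> random_vec M n V \<and>
     (\<forall>a \<in> carrier_vec n.
        distr M borel (\<lambda>\<omega>. a \<bullet> V \<omega>) = centered_normal (a \<bullet> (S *\<^sub>v a)))"

definition indep_vecs :: "'a measure \<Rightarrow> nat \<Rightarrow> ('a \<Rightarrow> real vec) list \<Rightarrow> bool" where
  "indep_vecs M n Vs \<longleftrightarrow> prob_space.indep_vars M (\<lambda>_. PiM {..<n} (\<lambda>_. borel))
     (\<lambda>l \<omega>. \<lambda>i\<in>{..<n}. (Vs ! l) \<omega> $ i) {..<length Vs}"

definition eucl_dist :: "real vec \<Rightarrow> real vec \<Rightarrow> real" where
  "eucl_dist s t = sqrt ((s - t) \<bullet> (s - t))"

definition isotropic_correlation :: "nat \<Rightarrow> (real \<Rightarrow> real) \<Rightarrow> bool" where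
  "isotropic_correlation d \<rho> \<longleftrightarrow> \<rho> 0 = 1 \<and>
     (\<forall>S c. finite S \<and> S \<subseteq> carrier_vec d \<longrightarrow>
        (\<Sum>s\<in>S. \<Sum>t\<in>S. c s * c t * \<rho> (eucl_dist s t)) \<ge> 0)"

text \<open>One model: \<open>Pr\<close> is the underlying probability space, \<open>sdX\<close>, \<open>sdW\<close>, \<open>sdE\<close> are
  \<open>\<sigma>\<^sub>X\<close>, \<open>\<sigma>\<close>, \<open>\<tau>\<close>, the correlation function \<open>corr\<close> lives on \<open>dom_dim\<close>-dimensional
  Euclidean space, and \<open>permX\<close>, \<open>permS\<close> are the \<open>K \<times> K\<close> matrices \<open>\<pi>\<^sub>X\<close>, \<open>\<pi>\<^sub>S\<close>.\<close>

record 'a block_model =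
  Pr :: "'a measure"
  bsize :: nat
  nblocks :: nat
  slope :: real
  sdX :: real
  sdW :: real
  sdE :: real
  dom_dim :: nat
  site :: "nat \<Rightarrow> real vec"
  corr :: "real \<Rightarrow> real"
  permX :: "real mat"
  permS :: "real mat"
  covariate :: "'a \<Rightarrow> real vec"
  process :: "'a \<Rightarrow> real vec"
  noise :: "'a \<Rightarrow> real vec"

definition nobs :: "'a block_model \<Rightarrow> nat" where
  "nobs m = bsize m * nblocks m"

definition Sigma_star :: "'a block_model \<Rightarrow> real mat" where
  "Sigma_star m = (sdW m)\<^sup>2 \<cdot>\<^sub>m
     mat (nobs m) (nobs m) (\<lambda>(i, j). corr m (eucl_dist (site m i) (site m j)))"

definition Sigma_mat :: "'a block_model \<Rightarrow> real mat" where
  "Sigma_mat m = Sigma_star m + (sdE m)\<^sup>2 \<cdot>\<^sub>m 1\<^sub>m (nobs m)"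

definition block_regression_model :: "'a block_model \<Rightarrow> bool" where
  "block_regression_model m \<longleftrightarrow>
     prob_space (Pr m) \<and> bsize m \<ge> 2 \<and> nblocks m \<ge> 1 \<and>
     sdX m > 0 \<and> sdW m \<ge> 0 \<and> sdE m \<ge> 0 \<and>
     (\<forall>i < nobs m. site m i \<in> carrier_vec (dom_dim m)) \<and>
     isotropic_correlation (dom_dim m) (corr m) \<and>
     pos_def_mat (nobs m) (Sigma_mat m) \<and>
     permX m \<in> perm_mats (bsize m) \<and> permS m \<in> perm_mats (bsize m) \<and>
     gaussian_vec (Pr m) (nobs m) ((sdX m)\<^sup>2 \<cdot>\<^sub>m 1\<^sub>m (nobs m)) (covariate m) \<and>
     gaussian_vec (Pr m) (nobs m) (Sigma_star m) (process m) \<and>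
     gaussian_vec (Pr m) (nobs m) ((sdE m)\<^sup>2 \<cdot>\<^sub>m 1\<^sub>m (nobs m)) (noise m) \<and>
     indep_vecs (Pr m) (nobs m) [covariate m, process m, noise m]"

definition response :: "'a block_model \<Rightarrow> 'a \<Rightarrow> real vec" where
  "response m \<omega> =
     slope m \<cdot>\<^sub>v (bdiag (nblocks m) (permX m) *\<^sub>v covariate m \<omega>)
       + bdiag (nblocks m) (permS m) *\<^sub>v process m \<omega> + noise m \<omega>"

text \<open>The definition contains no \<open>\<sigma>\<^sub>X\<close>, so it measures the strength of the signal \<open>X \<beta>\<close> only
  when the covariate is on unit scale; for \<open>\<sigma>\<^sub>X \<ge> 1\<close> it is a lower bound for the strength
  \<open>\<sigma>\<^sub>X\<^sup>2 \<beta>\<^sup>2 / (\<lambda>\<^sub>m\<^sub>a\<^sub>x \<kappa>)\<close>.\<close>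

definition SNR :: "'a block_model \<Rightarrow> real" where
  "SNR m = (slope m)\<^sup>2 / (lambda_max (Sigma_mat m) * cond_number (Sigma_mat m))"

definition phi :: "real \<Rightarrow> real" where
  "phi s = (ln s - 1)\<^sup>2 / ln s"

definition X_tilde :: "'a block_model \<Rightarrow> real mat \<Rightarrow> 'a \<Rightarrow> real vec" where
  "X_tilde m Q \<omega> = inv_sqrt_mat (Sigma_mat m) *\<^sub>v (Q *\<^sub>v covariate m \<omega>)"

definition Y_tilde :: "'a block_model \<Rightarrow> real mat \<Rightarrow> 'a \<Rightarrow> real vec" where
  "Y_tilde m Q \<omega> = inv_sqrt_mat (Sigma_mat m) *\<^sub>v (Q *\<^sub>v response m \<omega>)"

definition objective :: "'a block_model \<Rightarrow> real mat \<Rightarrow> real mat \<Rightarrow> 'a \<Rightarrow> real" where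
  "objective m p1 p2 \<omega> =
     (let r = proj_perp_mat (nobs m) (X_tilde m (bdiag (nblocks m) p1) \<omega>)
                *\<^sub>v Y_tilde m (bdiag (nblocks m) p2) \<omega>
      in r \<bullet> r)"

text \<open>Minimizers need not be unique; any measurable choice of one is an estimator.\<close>

definition is_estimator ::
  "'a block_model \<Rightarrow> ('a \<Rightarrow> real mat) \<Rightarrow> ('a \<Rightarrow> real mat) \<Rightarrow> bool" where
  "is_estimator m pi1 pi2 \<longleftrightarrow>
     pi1 \<in> Pr m \<rightarrow>\<^sub>M count_space (perm_mats (bsize m)) \<and>
     pi2 \<in> Pr m \<rightarrow>\<^sub>M count_space (perm_mats (bsize m)) \<and>
     (\<forall>\<omega> \<in> space (Pr m). \<forall>p1 \<in> perm_mats (bsize m). \<forall>p2 \<in> perm_mats (bsize m).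
        objective m (pi1 \<omega>) (pi2 \<omega>) \<omega> \<le> objective m p1 p2 \<omega>)"

definition beta_hat ::
  "'a block_model \<Rightarrow> ('a \<Rightarrow> real mat) \<Rightarrow> ('a \<Rightarrow> real mat) \<Rightarrow> 'a \<Rightarrow> real" where
  "beta_hat m pi1 pi2 \<omega> =
     (let x = X_tilde m (bdiag (nblocks m) (pi1 \<omega>)) \<omega>;
          y = Y_tilde m (bdiag (nblocks m) (pi2 \<omega>)) \<omega>
      in inverse (x \<bullet> x) * (x \<bullet> y))"

end

theory Submission
  imports Defs "HOL-Real_Asymp.Real_Asymp"
begin

text \<open>Write \<open>W\<close> for the noise seen through the unknown process permutation and \<open>U\<close> for the covariate
  permuted by the true relative permutation. A candidate pair amounts to a common permutation \<open>Q\<close> of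
  the observations and a permuted covariate \<open>V\<close>, and its criterion is
  \<open>min\<^sub>b |\<Sigma>\<^sup>-\<^sup>1\<^sup>/\<^sup>2 Q (W + \<beta> U - b V)|\<^sup>2\<close>; a selected candidate does at least as well as
  \<open>|\<Sigma>\<^sup>-\<^sup>1\<^sup>/\<^sup>2 W|\<^sup>2\<close>. Conjugating \<open>\<Sigma>\<^sup>-\<^sup>1\<close> by \<open>Q\<close> keeps the determinant, so the exponential moment at
  \<open>1/4\<close> of the difference of the two quadratic forms is at most
  \<open>exp (- |\<beta> U - b V|\<^sup>2 / (8 \<lambda>\<^sub>m\<^sub>a\<^sub>x))\<close>, whatever \<open>Q\<close> is.

  If \<open>V \<noteq> U\<close> as permutations, then \<open>\<beta> U - b V\<close> has squared length of order \<open>\<beta>\<^sup>2 B\<close> uniformly in \<open>b\<close>, so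
  such a candidate is selected with probability exponentially small in \<open>B\<close>, which is dominated by
  \<open>exp (- n\<^sup>\<delta>)\<close> because \<open>K\<close> is fixed and \<open>\<delta> < 1\<close>. If \<open>V = U\<close>, the candidate slope is a weighted least
  squares estimator, and a Gaussian tail bound gives \<open>2 exp (- 15 n\<^sup>\<delta> / 8)\<close> per candidate.

  For \<open>\<delta> = 0\<close> the union over the candidates is too costly. There the eigenvalues of the conjugated
  precision matrix relative to the original one decide: if they are far from \<open>1\<close>, a candidate is unlikely
  to be selected and wrong at the same time; if they are close to \<open>1\<close>, its error is close to that of the
  true candidate, so that one Gaussian tail suffices for all of them. For \<open>\<delta> < 0\<close> the asserted
  probability is eventually negative.\<close>

text \<open>The parameter 1/4 is the symmetric one. The eigenvalues \<open>m j\<close> of the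
  conjugated precision matrix relative to the original one multiply to 1, so for fixed b the
  exponential moment is exactly the Hellinger affinity of two normal laws; its factor
  \<open>\<Prod>j<n. sqrt (2 / (1 + m j))\<close> comes from the covariances alone, the rest from
  the shift. Passing from fixed b to the minimizing b costs \<open>2 * sqrt \<kappa>\<close>, where
  \<kappa> is the condition number of \<Sigma>. Nothing bounds \<kappa> along the sequence, so
  exponents proportional to \<kappa> must pay for this factor. For V \<noteq> U they come from SNR >
  e, which gives \<open>\<beta>\<^sup>2 \<ge> 2 * lmax * \<kappa>\<close>; for V = U, where the
  profile bound enters only at \<delta> = 0, from the squared radius
  \<open>5 * lmax * \<kappa> / n\<close>. At \<delta> = 0 the admissible failure probability is the
  constant 2/e. A single tail \<open>2 * exp (- (735 / 512))\<close> fits below it with room to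
  spare, (K!)^2 tails of this kind do not. Whether the eigenvalues are far from 1 is decided by
  comparing the product of the \<open>(1 + m j) / 2\<close> with a threshold that depends on K only:
  a large product makes the affinity small, a small one bounds the sum of all
  \<open>(m j - 1)\<^sup>2\<close> independently of n.\<close>

subsection \<open>Spectral theorem for real symmetric matrices\<close>

lemma scalar_prod_self_nonneg: "0 \<le> x \<bullet> (x :: real vec)"
  by (auto simp: scalar_prod_def intro!: sum_nonneg)

lemma scalar_prod_self_pos:
  fixes x :: "real vec"
  assumes "x \<in> carrier_vec n" "x \<noteq> 0\<^sub>v n"
  shows "0 < x \<bullet> x"
proof -
  from assms obtain i where i: "i < n" "x $ i \<noteq> 0" by (auto simp: vec_eq_iff)
  have "0 < x $ i * x $ i" using i(2) by (metis not_square_less_zero linorder_neqE_linordered_idom mult_eq_0_iff)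
  also have "\<dots> \<le> (\<Sum>j = 0..<n. x $ j * x $ j)"
    by (rule member_le_sum) (use i in auto)
  finally show ?thesis using assms by (simp add: scalar_prod_def)
qed

lemma symmetric_mat_swap:
  fixes A :: "real mat"
  assumes A: "A \<in> carrier_mat n n" and sym: "transpose_mat A = A"
    and x: "x \<in> carrier_vec n" and y: "y \<in> carrier_vec n"
  shows "x \<bullet> (A *\<^sub>v y) = (A *\<^sub>v x) \<bullet> y"
  using transpose_vec_mult_scalar[OF A y x] sym by simp

text \<open>A complex eigenvector x + iy always exists. Moving A across the scalar product of y and
  A x forces the imaginary part of the eigenvalue to vanish, and then whichever of x, y is nonzero
  is a real eigenvector.\<close>

lemma symmetric_real_eigenvalue:
  fixes A :: "real mat"
  assumes A: "A \<in> carrier_mat n n" and sym: "transpose_mat A = A" and n: "0 < n"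
  shows "\<exists>a v. v \<in> carrier_vec n \<and> v \<noteq> 0\<^sub>v n \<and> A *\<^sub>v v = a \<cdot>\<^sub>v v"
proof -
  define C where "C = map_mat complex_of_real A"
  have C: "C \<in> carrier_mat n n" using A by (auto simp: C_def)
  from spectrum_non_empty[OF C n] obtain k where "eigenvalue C k"
    by (auto simp: spectrum_def)
  then obtain z where z: "z \<in> carrier_vec n" "z \<noteq> 0\<^sub>v n" and Cz: "C *\<^sub>v z = k \<cdot>\<^sub>v z"
    using C by (auto simp: eigenvalue_def eigenvector_def)
  define x where "x = vec n (\<lambda>i. Re (z $ i))"
  define y where "y = vec n (\<lambda>i. Im (z $ i))"
  have xy: "x \<in> carrier_vec n" "y \<in> carrier_vec n" by (auto simp: x_def y_def)
  have comp: "(\<Sum>j = 0..<n. complex_of_real (A $$ (i, j)) * z $ j) = k * z $ i" if "i < n" for i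
    using arg_cong[OF Cz, of "\<lambda>v. v $ i"] that A z
    by (auto simp: C_def scalar_prod_def row_def)
  have Ax: "A *\<^sub>v x = Re k \<cdot>\<^sub>v x - Im k \<cdot>\<^sub>v y"
  proof (rule eq_vecI)
    fix i assume "i < dim_vec (Re k \<cdot>\<^sub>v x - Im k \<cdot>\<^sub>v y)"
    then have i: "i < n" by (simp add: y_def)
    show "(A *\<^sub>v x) $ i = (Re k \<cdot>\<^sub>v x - Im k \<cdot>\<^sub>v y) $ i"
      using arg_cong[OF comp[OF i], of Re] i A
      by (auto simp: scalar_prod_def row_def x_def y_def)
  qed (use A in \<open>auto simp: y_def\<close>)
  have Ay: "A *\<^sub>v y = Im k \<cdot>\<^sub>v x + Re k \<cdot>\<^sub>v y"
  proof (rule eq_vecI)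
    fix i assume "i < dim_vec (Im k \<cdot>\<^sub>v x + Re k \<cdot>\<^sub>v y)"
    then have i: "i < n" by (simp add: y_def)
    show "(A *\<^sub>v y) $ i = (Im k \<cdot>\<^sub>v x + Re k \<cdot>\<^sub>v y) $ i"
      using arg_cong[OF comp[OF i], of Im] i A
      by (auto simp: scalar_prod_def row_def x_def y_def)
  qed (use A in \<open>auto simp: y_def\<close>)
  have "y \<bullet> (A *\<^sub>v x) = (A *\<^sub>v y) \<bullet> x" by (rule symmetric_mat_swap[OF A sym xy(2,1)])
  then have "Re k * (y \<bullet> x) - Im k * (y \<bullet> y) = Im k * (x \<bullet> x) + Re k * (y \<bullet> x)"
    using xy by (simp add: Ax Ay scalar_prod_minus_distrib[of _ n] add_scalar_prod_distrib[of _ n])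
  then have "Im k * (x \<bullet> x + y \<bullet> y) = 0" by (simp add: algebra_simps)
  moreover have ne: "x \<noteq> 0\<^sub>v n \<or> y \<noteq> 0\<^sub>v n"
  proof (rule ccontr)
    assume "\<not> ?thesis"
    then have x0: "x = 0\<^sub>v n" and y0: "y = 0\<^sub>v n" by auto
    have "z = 0\<^sub>v n"
    proof (rule eq_vecI)
      fix i assume "i < dim_vec (0\<^sub>v n :: complex vec)"
      then have i: "i < n" by simp
      from arg_cong[OF x0, of "\<lambda>v. v $ i"] arg_cong[OF y0, of "\<lambda>v. v $ i"] i
      show "z $ i = 0\<^sub>v n $ i" by (simp add: x_def y_def complex_eq_iff)
    qed (use z in auto)
    with z show False by simp
  qed
  moreover have "x \<bullet> x + y \<bullet> y > 0"
    using ne scalar_prod_self_pos[OF xy(1)] scalar_prod_self_pos[OF xy(2)]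
      scalar_prod_self_nonneg[of x] scalar_prod_self_nonneg[of y] by linarith
  ultimately have "Im k = 0" by simp
  then have "A *\<^sub>v x = Re k \<cdot>\<^sub>v x" "A *\<^sub>v y = Re k \<cdot>\<^sub>v y"
    using Ax Ay xy by auto
  then show ?thesis using ne xy by blast
qed

text \<open>Gram-Schmidt keeps the first vector of its input, so when it starts at a basis
  completion of v, normalization only rescales column 0.\<close>

lemma orthonormal_completion:
  fixes v :: "real vec"
  assumes v: "v \<in> carrier_vec n" and v0: "v \<noteq> 0\<^sub>v n"
  shows "\<exists>W c. W \<in> carrier_mat n n \<and> transpose_mat W * W = 1\<^sub>m n \<and> W * transpose_mat W = 1\<^sub>m n
    \<and> col W 0 = c \<cdot>\<^sub>v v"
proof -
  interpret cof_vec_space n "TYPE(real)" .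
  define b where "b = basis_completion v"
  define ws where "ws = gram_schmidt n b"
  define us where "us = map (\<lambda>w. (1 / sqrt (w \<bullet> w)) \<cdot>\<^sub>v w) ws"
  define W where "W = mat_of_cols n us"
  have n: "n \<noteq> 0" using v v0 by (auto simp: vec_eq_iff)
  from basis_completion[OF v v0, folded b_def]
  have dist_b: "distinct b" and indep: "\<not> lin_dep (set b)" and b: "set b \<subseteq> carrier_vec n"
    and hdb: "hd b = v" and len_b: "length b = n" by auto
  from hdb len_b n obtain vs where bv: "b = v # vs" by (cases b) auto
  from gram_schmidt_result[OF b dist_b indep refl, folded ws_def]
  have ws: "set ws \<subseteq> carrier_vec n" "corthogonal ws" "length ws = n" by (auto simp: len_b)
  from gram_schmidt_hd[OF v, of vs, folded bv] have hdws: "hd ws = v" unfolding ws_def .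
  have lus: "length us = n" by (simp add: us_def ws)
  have W: "W \<in> carrier_mat n n" using lus mat_of_cols_carrier(1)[of n us] by (simp add: W_def)
  have wsc: "ws ! i \<in> carrier_vec n" if "i < n" for i using ws that by auto
  have usi: "us ! i = (1 / sqrt (ws ! i \<bullet> ws ! i)) \<cdot>\<^sub>v ws ! i" if "i < n" for i
    using that ws by (simp add: us_def)
  have cW: "col W i = us ! i" if "i < n" for i
    using that lus wsc[OF that] by (simp add: W_def usi)
  have orth: "us ! i \<bullet> us ! j = (if i = j then 1 else 0)" if i: "i < n" and j: "j < n" for i j
  proof -
    have o: "(ws ! i \<bullet> ws ! j = 0) = (i \<noteq> j)"
      using ws i j unfolding corthogonal_def by simp
    have nz: "ws ! i \<bullet> ws ! i \<noteq> 0" using ws i unfolding corthogonal_def by simp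
    then have pos: "ws ! i \<bullet> ws ! i > 0" using scalar_prod_self_nonneg[of "ws ! i"] by simp
    show ?thesis using o i j wsc[OF i] wsc[OF j] pos
      by (cases "i = j") (simp_all add: usi field_simps)
  qed
  have WW: "transpose_mat W * W = 1\<^sub>m n"
    by (rule eq_matI) (use W cW orth in auto)
  then have "W * transpose_mat W = 1\<^sub>m n"
    using mat_mult_left_right_inverse[of "transpose_mat W" n W] W by auto
  moreover have "col W 0 = (1 / sqrt (v \<bullet> v)) \<cdot>\<^sub>v v"
    using cW[of 0] usi[of 0] n hdws ws by (cases ws) auto
  ultimately show ?thesis using W WW by blast
qed

text \<open>Deflation: in an orthonormal basis that starts with an eigenvector the first column
  vanishes below the diagonal, by symmetry so does the first row beyond it, and the induction
  hypothesis diagonalizes the remaining block.\<close>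

theorem symmetric_spectral:
  fixes A :: "real mat"
  assumes "A \<in> carrier_mat n n" and "transpose_mat A = A"
  shows "\<exists>U d. U \<in> carrier_mat n n \<and> transpose_mat U * U = 1\<^sub>m n \<and> A * U = U * mat_diag n d"
  using assms
proof (induction n arbitrary: A)
  case 0
  then show ?case by (intro exI[of _ "1\<^sub>m 0"] exI[of _ "\<lambda>_. 0"]) (auto intro!: eq_matI simp: mat_diag_def)
next
  case (Suc n)
  note A = Suc.prems(1) and sym = Suc.prems(2)
  obtain a v where v: "v \<in> carrier_vec (Suc n)" "v \<noteq> 0\<^sub>v (Suc n)" and Av: "A *\<^sub>v v = a \<cdot>\<^sub>v v"
    using symmetric_real_eigenvalue[OF A sym] by auto
  obtain W c where W: "W \<in> carrier_mat (Suc n) (Suc n)" and WtW: "transpose_mat W * W = 1\<^sub>m (Suc n)"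
    and WWt: "W * transpose_mat W = 1\<^sub>m (Suc n)" and W0: "col W 0 = c \<cdot>\<^sub>v v"
    using orthonormal_completion[OF v] by blast
  define w where "w = col W 0"
  have w: "w \<in> carrier_vec (Suc n)" unfolding w_def using W by (metis col_carrier_vec zero_less_Suc)
  have Aw: "A *\<^sub>v w = a \<cdot>\<^sub>v w"
    using A v(1) by (simp add: w_def W0 mult_mat_vec[of A "Suc n"] Av smult_smult_assoc mult.commute)
  have orth: "col W i \<bullet> col W j = (if i = j then 1 else 0)" if "i < Suc n" "j < Suc n" for i j
  proof -
    have "(transpose_mat W * W) $$ (i, j) = col W i \<bullet> col W j" using that W by simp
    then show ?thesis using WtW that by simp
  qed
  define A' where "A' = transpose_mat W * (A * W)"
  have A': "A' \<in> carrier_mat (Suc n) (Suc n)" using A W by (simp add: A'_def)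
  have A'ij: "A' $$ (i, j) = col W i \<bullet> (A *\<^sub>v col W j)" if "i < Suc n" "j < Suc n" for i j
  proof -
    have "A' $$ (i, j) = col W i \<bullet> col (A * W) j" using that A W by (simp add: A'_def)
    then show ?thesis by (simp only: col_mult2[OF A W that(2)])
  qed
  have A'sym: "A' $$ (i, j) = A' $$ (j, i)" if "i < Suc n" "j < Suc n" for i j
    using that A W symmetric_mat_swap[OF A sym, of "col W i" "col W j"]
      comm_scalar_prod[of "A *\<^sub>v col W i" "Suc n" "col W j"]
    by (simp add: A'ij)
  have A'0: "A' $$ (i, 0) = (if i = 0 then a else 0)" if "i < Suc n" for i
    using that w W orth[OF that, of 0] by (simp add: A'ij w_def[symmetric] Aw)
  define B where "B = mat n n (\<lambda>(i, j). A' $$ (Suc i, Suc j))"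
  have B: "B \<in> carrier_mat n n" by (simp add: B_def)
  have Bsym: "transpose_mat B = B"
    by (rule eq_matI) (auto simp: B_def A'sym)
  obtain V d where V: "V \<in> carrier_mat n n" and VtV: "transpose_mat V * V = 1\<^sub>m n"
    and BV: "B * V = V * mat_diag n d"
    using Suc.IH[OF B Bsym] by blast
  define V' where "V' = four_block_mat (1\<^sub>m 1) (0\<^sub>m 1 n) (0\<^sub>m n 1) V"
  have V': "V' \<in> carrier_mat (Suc n) (Suc n)" by (rule carrier_matI) (use V in \<open>simp_all add: V'_def\<close>)
  have A'block: "A' = four_block_mat (a \<cdot>\<^sub>m 1\<^sub>m 1) (0\<^sub>m 1 n) (0\<^sub>m n 1) B"
    using A' B A'0 A'sym[of 0]
    by (intro eq_matI) (auto simp: B_def less_Suc_eq_0_disj)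
  define d' where "d' = case_nat a d"
  have diag: "mat_diag (Suc n) d' = four_block_mat (a \<cdot>\<^sub>m 1\<^sub>m 1) (0\<^sub>m 1 n) (0\<^sub>m n 1) (mat_diag n d)"
    by (intro eq_matI) (auto simp: mat_diag_def d'_def less_Suc_eq_0_disj)
  have "A' * V' = V' * mat_diag (Suc n) d'"
    unfolding A'block V'_def diag
    using BV V B
    by (subst mult_four_block_mat[of _ 1 1 _ n _ n _ _ 1 _ n],
        (simp; fail)+, subst mult_four_block_mat[of _ 1 1 _ n _ n _ _ 1 _ n], (simp; fail)+,
        simp add: left_mult_zero_mat[OF mat_diag_dim])
  then have "W * (A' * V') = (W * V') * mat_diag (Suc n) d'"
    using W V' by (simp add: assoc_mult_mat[of _ "Suc n" "Suc n" _ "Suc n" _ "Suc n"])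
  moreover have "W * (A' * V') = A * (W * V')"
  proof -
    have "W * (A' * V') = (W * transpose_mat W) * (A * (W * V'))"
      using W V' A by (simp add: A'_def assoc_mult_mat[of _ "Suc n" "Suc n" _ "Suc n" _ "Suc n"])
    then show ?thesis using WWt A W V' by simp
  qed
  moreover have "transpose_mat (W * V') * (W * V') = 1\<^sub>m (Suc n)"
  proof -
    have V'V': "transpose_mat V' * V' = 1\<^sub>m (Suc n)"
      unfolding V'_def
      using VtV V
      by (subst transpose_four_block_mat[of _ 1 1 _ n _ n], (simp; fail)+,
          subst mult_four_block_mat[of _ 1 1 _ n _ n _ _ 1 _ n], (simp; fail)+)
    have "transpose_mat (W * V') * (W * V') = transpose_mat V' * ((transpose_mat W * W) * V')"
      using W V' by (simp add: transpose_mult[of _ "Suc n" "Suc n"] assoc_mult_mat[of _ "Suc n" "Suc n" _ "Suc n" _ "Suc n"])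
    then show ?thesis using WtW V'V' V' by simp
  qed
  ultimately show ?case using W V' by (intro exI[of _ "W * V'"] exI[of _ d']) auto
qed

section \<open>Orthonormal eigenbases and quadratic forms\<close>

lemma orthogonal_mat_right:
  fixes U :: "real mat"
  assumes "U \<in> carrier_mat n n" and "transpose_mat U * U = 1\<^sub>m n"
  shows "U * transpose_mat U = 1\<^sub>m n"
  using mat_mult_left_right_inverse[of "transpose_mat U" n U] assms by auto

lemma orthogonal_mat_parseval:
  fixes U :: "real mat"
  assumes U: "U \<in> carrier_mat n n" and UtU: "transpose_mat U * U = 1\<^sub>m n"
    and v: "v \<in> carrier_vec n" and w: "w \<in> carrier_vec n"
  shows "v \<bullet> w = (\<Sum>j<n. (col U j \<bullet> v) * (col U j \<bullet> w))"
proof -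
  have "v \<bullet> w = v \<bullet> ((U * transpose_mat U) *\<^sub>v w)"
    using orthogonal_mat_right[OF U UtU] w by simp
  also have "\<dots> = v \<bullet> (U *\<^sub>v (transpose_mat U *\<^sub>v w))"
    using U w by (subst assoc_mult_mat_vec[of _ n n _ n]) auto
  also have "\<dots> = (transpose_mat U *\<^sub>v v) \<bullet> (transpose_mat U *\<^sub>v w)"
    using transpose_vec_mult_scalar[OF U _ v, of "transpose_mat U *\<^sub>v w"] U w by simp
  also have "\<dots> = (\<Sum>j<n. (col U j \<bullet> v) * (col U j \<bullet> w))"
    using U by (simp add: scalar_prod_def[of "transpose_mat U *\<^sub>v v"] lessThan_atLeast0)
  finally show ?thesis .
qed

lemma symmetric_spectral_basis:
  fixes A :: "real mat"
  assumes A: "A \<in> carrier_mat n n" and sym: "transpose_mat A = A"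
  obtains e d where "\<And>j. j < n \<Longrightarrow> e j \<in> carrier_vec n"
    and "\<And>i j. i < n \<Longrightarrow> j < n \<Longrightarrow> e i \<bullet> e j = (if i = j then 1 else 0)"
    and "\<And>j. j < n \<Longrightarrow> A *\<^sub>v e j = d j \<cdot>\<^sub>v e j"
    and "\<And>v w. v \<in> carrier_vec n \<Longrightarrow> w \<in> carrier_vec n \<Longrightarrow> v \<bullet> w = (\<Sum>j<n. (e j \<bullet> v) * (e j \<bullet> w))"
    and "det A = (\<Prod>j<n. d j)"
proof -
  obtain U d where U: "U \<in> carrier_mat n n" and UtU: "transpose_mat U * U = 1\<^sub>m n"
    and AU: "A * U = U * mat_diag n d"
    using symmetric_spectral[OF A sym] by blast
  have "col U i \<bullet> col U j = (if i = j then 1 else 0)" if "i < n" "j < n" for i j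
  proof -
    have "(transpose_mat U * U) $$ (i, j) = col U i \<bullet> col U j" using that U by simp
    then show ?thesis using UtU that by simp
  qed
  moreover have "A *\<^sub>v col U j = d j \<cdot>\<^sub>v col U j" if "j < n" for j
  proof -
    have "A *\<^sub>v col U j = col (U * mat_diag n d) j"
      using col_mult2[OF A U that] AU by simp
    also have "\<dots> = d j \<cdot>\<^sub>v col U j"
      using U that by (intro eq_vecI) (auto simp: mat_diag_mult_right[OF U] mult.commute)
    finally show ?thesis .
  qed
  moreover have "det A = (\<Prod>j<n. d j)"
  proof -
    have Ut: "transpose_mat U \<in> carrier_mat n n" using U by simp
    have "det (transpose_mat U) * det U = det (1\<^sub>m n :: real mat)"
      unfolding det_mult[OF Ut U, symmetric] UtU ..
    then have U0: "det U \<noteq> 0" by auto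
    have "det U * det A = det U * det (mat_diag n d)"
      using det_mult[OF A U] det_mult[OF U mat_diag_dim[of n d]] unfolding AU by (simp only: mult.commute)
    then have "det A = det (mat_diag n d)" by (simp only: mult_left_cancel[OF U0])
    also have "\<dots> = prod_list (diag_mat (mat_diag n d))"
      by (rule det_upper_triangular[OF _ mat_diag_dim]) (auto simp: mat_diag_def)
    also have "\<dots> = (\<Prod>j<n. d j)"
      by (simp add: prod_list_diag_prod lessThan_atLeast0 mat_diag_def)
    finally show ?thesis .
  qed
  moreover have "col U j \<in> carrier_vec n" if "j < n" for j
    using U that by (metis col_carrier_vec)
  ultimately show ?thesis
    using orthogonal_mat_parseval[OF U UtU] that[of "col U" d] by blast
qed

lemma spectral_quadratic_form:
  fixes A :: "real mat"
  assumes A: "A \<in> carrier_mat n n" and sym: "transpose_mat A = A"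
    and e: "\<And>j. j < n \<Longrightarrow> e j \<in> carrier_vec n"
    and ev: "\<And>j. j < n \<Longrightarrow> A *\<^sub>v e j = d j \<cdot>\<^sub>v e j"
    and parseval: "\<And>v w. v \<in> carrier_vec n \<Longrightarrow> w \<in> carrier_vec n \<Longrightarrow> v \<bullet> w = (\<Sum>j<n. (e j \<bullet> v) * (e j \<bullet> w))"
    and v: "v \<in> carrier_vec n" and w: "w \<in> carrier_vec n"
  shows "v \<bullet> (A *\<^sub>v w) = (\<Sum>j<n. d j * ((e j \<bullet> v) * (e j \<bullet> w)))"
proof -
  have "e j \<bullet> (A *\<^sub>v w) = d j * (e j \<bullet> w)" if "j < n" for j
    using symmetric_mat_swap[OF A sym e[OF that] w] ev[OF that] e[OF that] w by simp
  then show ?thesis using parseval[OF v, of "A *\<^sub>v w"] A w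
    by (simp add: mult.left_commute)
qed

text \<open>Let e be a unit eigenvector of R - S with eigenvalue d. Since R^2 = S^2, the vectors Re
  = Se + de and Se have equal length, so d (2q + d) = 0 with q = e . Se. Positivity of q and of q +
  d = e . Re leaves d = 0, and R - S vanishes on an eigenbasis.\<close>

lemma pos_def_mat_sqrt_unique:
  assumes R: "pos_def_mat n R" and S: "pos_def_mat n S" and RS: "R * R = S * S"
  shows "R = S"
proof -
  have Rc: "R \<in> carrier_mat n n" "transpose_mat R = R" and Sc: "S \<in> carrier_mat n n" "transpose_mat S = S"
    using R S by (auto simp: pos_def_mat_def)
  have D: "R - S \<in> carrier_mat n n" "transpose_mat (R - S) = R - S"
    using Rc Sc by (auto simp: transpose_minus)
  obtain U d where U: "U \<in> carrier_mat n n" and UtU: "transpose_mat U * U = 1\<^sub>m n"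
    and DU: "(R - S) * U = U * mat_diag n d"
    using symmetric_spectral[OF D] by blast
  have RU: "R *\<^sub>v col U j = S *\<^sub>v col U j" if j: "j < n" for j
  proof -
    define e where "e = col U j"
    have e: "e \<in> carrier_vec n" unfolding e_def using U j by (metis col_carrier_vec)
    have "(transpose_mat U * U) $$ (j, j) = e \<bullet> e" using j U by (simp add: e_def)
    then have ee: "e \<bullet> e = 1" using UtU j by simp
    then have e0: "e \<noteq> 0\<^sub>v n" using e by auto
    have "(R - S) *\<^sub>v e = col (U * mat_diag n d) j"
      using col_mult2[OF D(1) U j] DU by (simp add: e_def)
    also have "\<dots> = d j \<cdot>\<^sub>v e"
      using U j by (intro eq_vecI) (auto simp: mat_diag_mult_right[OF U] mult.commute e_def)
    finally have "R *\<^sub>v e - S *\<^sub>v e = d j \<cdot>\<^sub>v e"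
      using Rc Sc e by (simp add: minus_mult_distrib_mat_vec[of _ n n])
    then have Re: "R *\<^sub>v e = S *\<^sub>v e + d j \<cdot>\<^sub>v e"
      using Rc(1) Sc(1) e by (auto simp: vec_eq_iff algebra_simps)
    have "(R *\<^sub>v e) \<bullet> (R *\<^sub>v e) = e \<bullet> ((R * R) *\<^sub>v e)"
      using symmetric_mat_swap[OF Rc e, of "R *\<^sub>v e"] Rc e by simp
    also have "\<dots> = (S *\<^sub>v e) \<bullet> (S *\<^sub>v e)"
      using symmetric_mat_swap[OF Sc e, of "S *\<^sub>v e"] Sc e by (simp add: RS)
    finally have sq: "(R *\<^sub>v e) \<bullet> (R *\<^sub>v e) = (S *\<^sub>v e) \<bullet> (S *\<^sub>v e)" .
    have Se: "S *\<^sub>v e \<in> carrier_vec n" using Sc e by simp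
    define q where "q = e \<bullet> (S *\<^sub>v e)"
    have "(S *\<^sub>v e + d j \<cdot>\<^sub>v e) \<bullet> (S *\<^sub>v e + d j \<cdot>\<^sub>v e)
        = (S *\<^sub>v e) \<bullet> (S *\<^sub>v e) + d j * (2 * q + d j)"
      using Se e ee comm_scalar_prod[OF Se e]
      by (simp add: q_def add_scalar_prod_distrib[of _ n] scalar_prod_add_distrib[of _ n] algebra_simps)
    with sq Re have "d j * (2 * q + d j) = 0" by simp
    moreover have "q > 0" using S e e0 by (simp add: q_def pos_def_mat_def)
    moreover have "q + d j > 0"
    proof -
      have "0 < e \<bullet> (R *\<^sub>v e)" using R e e0 by (simp add: pos_def_mat_def)
      also have "\<dots> = q + d j" using Se e ee by (simp add: Re q_def scalar_prod_add_distrib[of _ n])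
      finally show ?thesis .
    qed
    ultimately have "d j = 0" by (smt (verit) mult_eq_0_iff)
    then have "d j \<cdot>\<^sub>v e = 0\<^sub>v n" using e by (intro eq_vecI) auto
    then have "R *\<^sub>v e = S *\<^sub>v e" using Re right_zero_vec[OF Se] by simp
    then show ?thesis by (simp add: e_def)
  qed
  have "R * U = S * U"
  proof (rule mat_col_eqI)
    fix j assume "j < dim_col (S * U)"
    then have j: "j < n" using U by simp
    show "col (R * U) j = col (S * U) j"
      using col_mult2[OF Rc(1) U j] col_mult2[OF Sc(1) U j] RU[OF j] by simp
  qed (use Rc Sc in auto)
  then have "R * (U * transpose_mat U) = S * (U * transpose_mat U)"
    using assoc_mult_mat[OF Rc(1) U, of "transpose_mat U" n] assoc_mult_mat[OF Sc(1) U, of "transpose_mat U" n] U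
    by simp
  then show ?thesis using orthogonal_mat_right[OF U UtU] Rc Sc by simp
qed

section \<open>Functional calculus in an orthonormal eigenbasis and the inverse square root\<close>

definition diag_conj :: "nat \<Rightarrow> real mat \<Rightarrow> (nat \<Rightarrow> real) \<Rightarrow> real mat" where
  "diag_conj n U f = U * (mat_diag n f * transpose_mat U)"

lemma diag_conj_carrier:
  assumes U: "U \<in> carrier_mat n n"
  shows "diag_conj n U f \<in> carrier_mat n n"
proof -
  have "mat_diag n f * transpose_mat U \<in> carrier_mat n n"
    by (rule mult_carrier_mat[OF mat_diag_dim]) (use U in simp)
  then show ?thesis unfolding diag_conj_def by (rule mult_carrier_mat[OF U])
qed

lemma diag_conj_mult:
  assumes U: "U \<in> carrier_mat n n" and UtU: "transpose_mat U * U = 1\<^sub>m n"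
  shows "diag_conj n U f * diag_conj n U g = diag_conj n U (\<lambda>j. f j * g j)"
proof -
  have Ut: "transpose_mat U \<in> carrier_mat n n" using U by simp
  note D = mat_diag_dim[of n]
  have DU: "mat_diag n h * transpose_mat U \<in> carrier_mat n n" for h
    by (rule mult_carrier_mat[OF D Ut])
  have "diag_conj n U f * diag_conj n U g = U * ((mat_diag n f * transpose_mat U) * (U * (mat_diag n g * transpose_mat U)))"
    unfolding diag_conj_def by (rule assoc_mult_mat[OF U DU mult_carrier_mat[OF U DU]])
  also have "(mat_diag n f * transpose_mat U) * (U * (mat_diag n g * transpose_mat U))
      = mat_diag n f * (transpose_mat U * (U * (mat_diag n g * transpose_mat U)))"
    by (rule assoc_mult_mat[OF D Ut mult_carrier_mat[OF U DU]])
  also have "transpose_mat U * (U * (mat_diag n g * transpose_mat U)) = mat_diag n g * transpose_mat U"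
    using assoc_mult_mat[OF Ut U DU, of g] UtU left_mult_one_mat[OF DU] by simp
  also have "mat_diag n f * (mat_diag n g * transpose_mat U) = mat_diag n (\<lambda>j. f j * g j) * transpose_mat U"
    using assoc_mult_mat[OF D D Ut, of f g] by simp
  finally show ?thesis by (simp add: diag_conj_def)
qed

lemma diag_conj_transpose:
  assumes U: "U \<in> carrier_mat n n"
  shows "transpose_mat (diag_conj n U f) = diag_conj n U f"
proof -
  have Ut: "transpose_mat U \<in> carrier_mat n n" using U by simp
  note D = mat_diag_dim[of n]
  have Dt: "transpose_mat (mat_diag n f) = mat_diag n f"
    by (rule eq_matI) (auto simp: mat_diag_def)
  have "transpose_mat (diag_conj n U f) = (U * mat_diag n f) * transpose_mat U"
    unfolding diag_conj_def
    using transpose_mult[OF U mult_carrier_mat[OF D Ut]] transpose_mult[OF D Ut] Dt by simp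
  then show ?thesis unfolding diag_conj_def using assoc_mult_mat[OF U D Ut] by simp
qed

lemma diag_conj_one:
  assumes U: "U \<in> carrier_mat n n" and UtU: "transpose_mat U * U = 1\<^sub>m n"
  shows "diag_conj n U (\<lambda>j. 1) = 1\<^sub>m n"
  using orthogonal_mat_right[OF U UtU] U by (simp add: diag_conj_def)

lemma diag_conj_quadratic_form:
  assumes U: "U \<in> carrier_mat n n" and v: "v \<in> carrier_vec n"
  shows "v \<bullet> (diag_conj n U f *\<^sub>v v) = (\<Sum>j<n. f j * (col U j \<bullet> v)\<^sup>2)"
proof -
  have Ut: "transpose_mat U \<in> carrier_mat n n" using U by simp
  note D = mat_diag_dim[of n f]
  have w: "transpose_mat U *\<^sub>v v \<in> carrier_vec n" using Ut v by simp
  have "diag_conj n U f *\<^sub>v v = U *\<^sub>v (mat_diag n f *\<^sub>v (transpose_mat U *\<^sub>v v))"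
    unfolding diag_conj_def
    using assoc_mult_mat_vec[OF U mult_carrier_mat[OF D Ut] v] assoc_mult_mat_vec[OF D Ut v] by simp
  then have "v \<bullet> (diag_conj n U f *\<^sub>v v)
      = (transpose_mat U *\<^sub>v v) \<bullet> (mat_diag n f *\<^sub>v (transpose_mat U *\<^sub>v v))"
    using transpose_vec_mult_scalar[OF U mult_mat_vec_carrier[OF D w] v] by simp
  also have "mat_diag n f *\<^sub>v (transpose_mat U *\<^sub>v v) = vec n (\<lambda>j. f j * (col U j \<bullet> v))"
  proof (rule eq_vecI)
    fix i assume "i < dim_vec (vec n (\<lambda>j. f j * (col U j \<bullet> v)))"
    then have i: "i < n" by simp
    have "(mat_diag n f *\<^sub>v (transpose_mat U *\<^sub>v v)) $ i
        = (\<Sum>j = 0..<n. (if i = j then f j else 0) * (col U j \<bullet> v))"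
      using i U by (simp add: mat_diag_def scalar_prod_def[of _ "transpose_mat U *\<^sub>v v"])
    also have "\<dots> = (\<Sum>j = 0..<n. if j = i then f j * (col U j \<bullet> v) else 0)"
      by (rule sum.cong) auto
    also have "\<dots> = f i * (col U i \<bullet> v)" using i by simp
    finally show "(mat_diag n f *\<^sub>v (transpose_mat U *\<^sub>v v)) $ i = vec n (\<lambda>j. f j * (col U j \<bullet> v)) $ i"
      using i by simp
  qed (simp add: mat_diag_def)
  also have "(transpose_mat U *\<^sub>v v) \<bullet> vec n (\<lambda>j. f j * (col U j \<bullet> v)) = (\<Sum>j<n. f j * (col U j \<bullet> v)\<^sup>2)"
    using U by (auto simp: scalar_prod_def[of "transpose_mat U *\<^sub>v v"] lessThan_atLeast0 power2_eq_square
        intro!: sum.cong)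
  finally show ?thesis .
qed

lemma diag_conj_pos_def:
  assumes U: "U \<in> carrier_mat n n" and UtU: "transpose_mat U * U = 1\<^sub>m n"
    and f: "\<And>j. j < n \<Longrightarrow> 0 < f j"
  shows "pos_def_mat n (diag_conj n U f)"
  unfolding pos_def_mat_def
proof (intro conjI ballI impI)
  fix v :: "real vec" assume v: "v \<in> carrier_vec n" "v \<noteq> 0\<^sub>v n"
  have "0 < v \<bullet> v" by (rule scalar_prod_self_pos[OF v])
  then have "(\<Sum>j<n. (col U j \<bullet> v)\<^sup>2) \<noteq> 0"
    using orthogonal_mat_parseval[OF U UtU v(1) v(1)] by (simp add: power2_eq_square)
  then obtain i where i: "i < n" "(col U i \<bullet> v)\<^sup>2 \<noteq> 0"
    by (meson lessThan_iff sum.neutral)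
  have "0 < f i * (col U i \<bullet> v)\<^sup>2" using i f by simp
  also have "\<dots> \<le> (\<Sum>j<n. f j * (col U j \<bullet> v)\<^sup>2)"
    by (rule member_le_sum) (use i f in \<open>auto intro!: mult_nonneg_nonneg simp: less_imp_le\<close>)
  finally show "0 < v \<bullet> (diag_conj n U f *\<^sub>v v)"
    by (simp add: diag_conj_quadratic_form[OF U v(1)])
qed (use diag_conj_carrier[OF U] diag_conj_transpose[OF U] in auto)

text \<open>Reciprocal square roots of the eigenvalues give existence and
  \<open>pos_def_mat_sqrt_unique\<close> gives uniqueness; together they resolve the definite
  description in \<open>inv_sqrt_mat\<close>.\<close>

theorem inv_sqrt_mat_pos_def:
  assumes A: "pos_def_mat n A"
  shows "pos_def_mat n (inv_sqrt_mat A)"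
    and "inv_sqrt_mat A * inv_sqrt_mat A * A = 1\<^sub>m n"
    and "A * (inv_sqrt_mat A * inv_sqrt_mat A) = 1\<^sub>m n"
proof -
  have Ac: "A \<in> carrier_mat n n" "transpose_mat A = A" using A by (auto simp: pos_def_mat_def)
  obtain U d where U: "U \<in> carrier_mat n n" and UtU: "transpose_mat U * U = 1\<^sub>m n"
    and AU: "A * U = U * mat_diag n d"
    using symmetric_spectral[OF Ac] by blast
  have A_eq: "A = diag_conj n U d"
  proof -
    have Ut: "transpose_mat U \<in> carrier_mat n n" using U by simp
    have "A = A * (U * transpose_mat U)" using orthogonal_mat_right[OF U UtU] Ac by simp
    also have "\<dots> = (U * mat_diag n d) * transpose_mat U"
      using assoc_mult_mat[OF Ac(1) U Ut] AU by simp
    also have "\<dots> = diag_conj n U d"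
      unfolding diag_conj_def by (rule assoc_mult_mat[OF U mat_diag_dim Ut])
    finally show ?thesis .
  qed
  have d: "0 < d j" if j: "j < n" for j
  proof -
    have c: "col U j \<in> carrier_vec n" using U j by (metis col_carrier_vec)
    have o: "col U i \<bullet> col U j = (if i = j then 1 else 0)" if "i < n" for i
    proof -
      have "(transpose_mat U * U) $$ (i, j) = col U i \<bullet> col U j" using that j U by simp
      then show ?thesis using UtU that j by simp
    qed
    have "col U j \<bullet> (A *\<^sub>v col U j) = (\<Sum>i<n. d i * (col U i \<bullet> col U j)\<^sup>2)"
      by (simp add: A_eq diag_conj_quadratic_form[OF U c])
    also have "\<dots> = (\<Sum>i<n. if i = j then d j else 0)"
      by (rule sum.cong) (auto simp: o)
    also have "\<dots> = d j" using j by simp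
    finally have "col U j \<bullet> (A *\<^sub>v col U j) = d j" .
    moreover have "col U j \<noteq> 0\<^sub>v n" using o[OF j] c by auto
    ultimately show ?thesis using A c by (auto simp: pos_def_mat_def)
  qed
  define R where "R = diag_conj n U (\<lambda>j. 1 / sqrt (d j))"
  have R: "pos_def_mat n R"
    unfolding R_def by (rule diag_conj_pos_def[OF U UtU]) (simp add: d)
  have "mat_diag n (\<lambda>j. (1 / sqrt (d j)) * (1 / sqrt (d j)) * d j) = mat_diag n (\<lambda>j. 1)"
    by (rule eq_matI) (use d in \<open>auto simp: mat_diag_def abs_of_pos order_less_imp_not_eq2\<close>)
  then have RRA: "R * R * A = 1\<^sub>m n"
    using diag_conj_one[OF U UtU]
    by (simp add: R_def A_eq diag_conj_mult[OF U UtU]) (simp add: diag_conj_def)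
  have RR: "R * R \<in> carrier_mat n n" using R by (auto simp: pos_def_mat_def)
  have ARR: "A * (R * R) = 1\<^sub>m n"
    by (rule mat_mult_left_right_inverse[OF RR Ac(1) RRA])
  have dimA: "dim_row A = n" using Ac by simp
  have "inv_sqrt_mat A = R"
    unfolding inv_sqrt_mat_def dimA
  proof (rule the_equality)
    show "pos_def_mat n R \<and> inverts_mat (R * R) A \<and> inverts_mat A (R * R)"
      using R RRA ARR Ac carrier_matD(1)[of R n n] by (simp add: inverts_mat_def pos_def_mat_def)
  next
    fix S assume S: "pos_def_mat n S \<and> inverts_mat (S * S) A \<and> inverts_mat A (S * S)"
    then have Sc: "S * S \<in> carrier_mat n n" by (auto simp: pos_def_mat_def)
    have SSA: "S * S * A = 1\<^sub>m n" using S Sc by (auto simp: inverts_mat_def)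
    \<comment> \<open>Inverses of A are unique, so S and R have the same square.\<close>
    have "S * S = (S * S) * (A * (R * R))" using ARR right_mult_one_mat[OF Sc] by simp
    also have "\<dots> = (S * S * A) * (R * R)" by (rule assoc_mult_mat[OF Sc Ac(1) RR, symmetric])
    also have "\<dots> = R * R" using SSA left_mult_one_mat[OF RR] by simp
    finally show "S = R" by (rule pos_def_mat_sqrt_unique[OF conjunct1[OF S] R])
  qed
  then show "pos_def_mat n (inv_sqrt_mat A)" "inv_sqrt_mat A * inv_sqrt_mat A * A = 1\<^sub>m n"
    "A * (inv_sqrt_mat A * inv_sqrt_mat A) = 1\<^sub>m n"
    using R RRA ARR by simp_all
qed

text \<open>Both quadratic forms are expanded in an eigenbasis. The \<open>Min\<close> and
  \<open>Max\<close> behind \<open>lambda_min\<close> and \<open>lambda_max\<close> are attained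
  because the spectrum is finite, and nonempty since n > 0 leaves at least one eigenvector.\<close>

lemma pos_def_mat_spectrum_bounds:
  assumes A: "pos_def_mat n A" and n: "0 < n"
  shows "0 < lambda_min A" and "lambda_min A \<le> lambda_max A"
    and "v \<in> carrier_vec n \<Longrightarrow> lambda_min A * (v \<bullet> v) \<le> v \<bullet> (A *\<^sub>v v)"
    and "v \<in> carrier_vec n \<Longrightarrow> v \<bullet> (A *\<^sub>v v) \<le> lambda_max A * (v \<bullet> v)"
proof -
  have Ac: "A \<in> carrier_mat n n" "transpose_mat A = A" using A by (auto simp: pos_def_mat_def)
  obtain e d where e: "\<And>j. j < n \<Longrightarrow> e j \<in> carrier_vec n"
    and on: "\<And>i j. i < n \<Longrightarrow> j < n \<Longrightarrow> e i \<bullet> e j = (if i = j then 1 else 0)"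
    and ev: "\<And>j. j < n \<Longrightarrow> A *\<^sub>v e j = d j \<cdot>\<^sub>v e j"
    and pars: "\<And>v w. v \<in> carrier_vec n \<Longrightarrow> w \<in> carrier_vec n \<Longrightarrow> v \<bullet> w = (\<Sum>j<n. (e j \<bullet> v) * (e j \<bullet> w))"
    and "det A = (\<Prod>j<n. d j)"
    by (rule symmetric_spectral_basis[OF Ac]) blast
  have fin: "finite (spectrum A)" by (rule card_finite_spectrum(1)[OF Ac(1)])
  have d_spec: "d j \<in> spectrum A" if "j < n" for j
  proof -
    have "e j \<noteq> 0\<^sub>v n" using on[OF that that] e[OF that] by auto
    then have "eigenvector A (e j) (d j)"
      unfolding eigenvector_def using e[OF that] ev[OF that] carrier_matD(1)[OF Ac(1)] by (metis (full_types))
    then show ?thesis unfolding spectrum_def eigenvalue_def by blast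
  qed
  then have ne: "spectrum A \<noteq> {}" using n by blast
  show "lambda_min A \<le> lambda_max A"
    using fin ne by (simp add: lambda_min_def lambda_max_def)
  have "lambda_min A \<in> spectrum A" using fin ne by (simp add: lambda_min_def)
  then obtain z where z: "z \<in> carrier_vec n" "z \<noteq> 0\<^sub>v n" "A *\<^sub>v z = lambda_min A \<cdot>\<^sub>v z"
    using Ac by (auto simp: spectrum_def eigenvalue_def eigenvector_def)
  have "0 < z \<bullet> (A *\<^sub>v z)" using A z(1,2) unfolding pos_def_mat_def by blast
  then have "0 < lambda_min A * (z \<bullet> z)" using z(1) by (simp add: z(3))
  then show "0 < lambda_min A" using scalar_prod_self_nonneg[of z] by (simp add: zero_less_mult_iff)
  have q: "v \<bullet> (A *\<^sub>v v) = (\<Sum>j<n. d j * (e j \<bullet> v)\<^sup>2)" and vv: "v \<bullet> v = (\<Sum>j<n. (e j \<bullet> v)\<^sup>2)"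
    if v: "v \<in> carrier_vec n" for v
    using spectral_quadratic_form[OF Ac e ev pars v v] pars[OF v v]
    by (simp_all only: power2_eq_square)
  show "lambda_min A * (v \<bullet> v) \<le> v \<bullet> (A *\<^sub>v v)" if "v \<in> carrier_vec n"
    using fin d_spec unfolding q[OF that] vv[OF that] sum_distrib_left
    by (auto intro!: sum_mono mult_right_mono simp: lambda_min_def)
  show "v \<bullet> (A *\<^sub>v v) \<le> lambda_max A * (v \<bullet> v)" if "v \<in> carrier_vec n"
    using fin d_spec unfolding q[OF that] vv[OF that] sum_distrib_left
    by (auto intro!: sum_mono mult_right_mono simp: lambda_max_def)
qed

subsection \<open>Families of independent standard normal variables\<close>

text \<open>Unless c = 0, h / c is a probability density. Under the tilted measure X has the
  characteristic function of N, hence the law N, so uniqueness on the line identifies a weighted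
  law.\<close>

lemma (in prob_space) bounded_weight_char_nonneg:
  fixes X h :: "'a \<Rightarrow> real"
  assumes X[measurable]: "X \<in> borel_measurable M" and h[measurable]: "h \<in> borel_measurable M"
    and h0: "\<And>\<omega>. 0 \<le> h \<omega>" and hC: "\<And>\<omega>. h \<omega> \<le> C"
    and N: "real_distribution N"
    and char: "\<And>t. (CLINT \<omega>|M. h \<omega> *\<^sub>R iexp (t * X \<omega>)) = complex_of_real c * char N t"
    and A[measurable]: "A \<in> sets borel"
  shows "(LINT \<omega>|M. h \<omega> * indicator A (X \<omega>)) = c * measure N A"
proof -
  interpret N: real_distribution N by (rule N)
  have inth: "integrable M h"
    by (rule integrable_const_bound[where B = C]) (use h0 hC in auto)
  have "complex_of_real c = (CLINT \<omega>|M. complex_of_real (h \<omega>))"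
    using char[of 0] N.char_zero by (simp add: scaleR_conv_of_real)
  then have c: "c = (LINT \<omega>|M. h \<omega>)"
    by (simp only: integral_of_real[OF inth] of_real_eq_iff)
  have c0: "0 \<le> c" unfolding c using h0 by simp
  show ?thesis
  proof (cases "c = 0")
    case True
    then have "AE \<omega> in M. h \<omega> = 0"
      using integral_nonneg_eq_0_iff_AE[OF inth] h0 c by auto
    then have "(LINT \<omega>|M. h \<omega> * indicator A (X \<omega>)) = (LINT \<omega>|M. 0)"
      by (intro integral_cong_AE) auto
    with True show ?thesis by simp
  next
    case False
    with c0 have cpos: "0 < c" by simp
    define M' where "M' = density M (\<lambda>\<omega>. ennreal (h \<omega> / c))"
    have M': "prob_space M'"
    proof
      have "emeasure M' (space M') = (\<integral>\<^sup>+\<omega>. ennreal (h \<omega> / c) \<partial>M)"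
        by (simp add: M'_def emeasure_density cong: nn_integral_cong)
      also have "\<dots> = ennreal (LINT \<omega>|M. h \<omega> / c)"
        using inth h0 cpos by (intro nn_integral_eq_integral) auto
      also have "\<dots> = 1" using c cpos by simp
      finally show "emeasure M' (space M') = 1" .
    qed
    then interpret M': prob_space M' .
    have Xm: "X \<in> borel_measurable M'" by (simp add: M'_def)
    have rd: "real_distribution (distr M' borel X)" using Xm by (rule M'.real_distribution_distr)
    have "char (distr M' borel X) t = char N t" for t
    proof -
      have "char (distr M' borel X) t = (CLINT \<omega>|M'. iexp (t * X \<omega>))"
        unfolding char_def using Xm by (subst integral_distr) auto
      also have "\<dots> = (CLINT \<omega>|M. (h \<omega> / c) *\<^sub>R iexp (t * X \<omega>))"
        unfolding M'_def using h0 cpos by (subst integral_density) auto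
      also have "\<dots> = (CLINT \<omega>|M. (1 / c) *\<^sub>R (h \<omega> *\<^sub>R iexp (t * X \<omega>)))"
        by (rule Bochner_Integration.integral_cong) auto
      also have "\<dots> = (1 / c) *\<^sub>R (CLINT \<omega>|M. h \<omega> *\<^sub>R iexp (t * X \<omega>))"
        by (rule integral_scaleR_right) 
      also have "\<dots> = char N t" unfolding char using cpos by (simp add: scaleR_conv_of_real)
      finally show ?thesis .
    qed
    then have eq: "distr M' borel X = N"
      by (intro Levy_uniqueness rd N) (simp add: fun_eq_iff)
    have "measure N A = measure (distr M' borel X) A" by (simp add: eq)
    also have "\<dots> = (LINT x|distr M' borel X. indicator A x)" by simp
    also have "\<dots> = (LINT \<omega>|M'. indicator A (X \<omega>))"
      using Xm by (subst integral_distr) auto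
    also have "\<dots> = (LINT \<omega>|M. (h \<omega> / c) *\<^sub>R indicator A (X \<omega>))"
      unfolding M'_def using h0 cpos by (subst integral_density) auto
    also have "\<dots> = (LINT \<omega>|M. (h \<omega> * indicator A (X \<omega>)) / c)"
      by (rule Bochner_Integration.integral_cong) auto
    also have "\<dots> = (LINT \<omega>|M. h \<omega> * indicator A (X \<omega>)) / c" by simp
    finally show ?thesis using cpos by (simp add: field_simps)
  qed
qed

lemma char_uminus: "char N (- t) = cnj (char N t)"
proof -
  have "cnj (char N t) = (CLINT x|N. cnj (iexp (t * x)))"
    unfolding char_def by (rule Bochner_Integration.integral_cnj[symmetric])
  then show ?thesis by (simp add: char_def exp_cnj)
qed

text \<open>Shifting the real and imaginary parts of \<open>H\<close> by \<open>1\<close> makes them nonnegative densities,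
  to which the uniqueness theorem for characteristic functions on the line applies.\<close>

lemma (in prob_space) bounded_weight_char:
  fixes X :: "'a \<Rightarrow> real" and H :: "'a \<Rightarrow> complex"
  assumes X[measurable]: "X \<in> borel_measurable M" and H[measurable]: "H \<in> borel_measurable M"
    and H1: "\<And>\<omega>. norm (H \<omega>) \<le> 1"
    and N: "distr M borel X = N" and real: "\<And>t. Im (char N t) = 0"
    and char: "\<And>t. (CLINT \<omega>|M. H \<omega> * iexp (t * X \<omega>)) = complex_of_real c * char N t"
    and A[measurable]: "A \<in> sets borel"
  shows "(CLINT \<omega>|M. H \<omega> * indicator A (X \<omega>)) = complex_of_real (c * measure N A)"
proof -
  have rd: "real_distribution N" unfolding N[symmetric] by (rule real_distribution_distr[OF X])
  have cnj_char: "cnj (char N t) = char N t" for t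
    using real[of t] by (simp add: complex_eq_iff)
  have e1: "(CLINT \<omega>|M. iexp (t * X \<omega>)) = char N t" for t
    unfolding char_def N[symmetric] by (subst integral_distr) auto
  have bd: "integrable M f" if "f \<in> borel_measurable M" "\<And>\<omega>. norm (f \<omega>) \<le> 1" for f :: "'a \<Rightarrow> complex"
    by (rule integrable_const_bound[where B = 1]) (use that in auto)
  have Re_bd: "0 \<le> 1 + Re (H \<omega>)" "1 + Re (H \<omega>) \<le> 2" for \<omega>
    using abs_Re_le_cmod[of "H \<omega>"] H1[of \<omega>] by linarith+
  have Im_bd: "0 \<le> 1 + Im (H \<omega>)" "1 + Im (H \<omega>) \<le> 2" for \<omega>
    using abs_Im_le_cmod[of "H \<omega>"] H1[of \<omega>] by linarith+
  have iH: "integrable M (\<lambda>\<omega>. H \<omega> * iexp (t * X \<omega>))" for t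
    by (rule bd) (use H1 in \<open>auto simp: norm_mult\<close>)
  have "cnj \<in> borel_measurable borel"
    by (intro borel_measurable_continuous_onI continuous_intros)
  then have [measurable]: "(\<lambda>\<omega>. cnj (H \<omega>)) \<in> borel_measurable M"
    by (rule measurable_compose[OF H])
  have iH': "integrable M (\<lambda>\<omega>. cnj (H \<omega>) * iexp (t * X \<omega>))" for t
    by (rule bd) (use H1 in \<open>auto simp: norm_mult\<close>)
  have ie: "integrable M (\<lambda>\<omega>. iexp (t * X \<omega>))" for t
    by (rule bd) auto
  \<comment> \<open>Conjugating the weight replaces t by -t, and \<open>char N\<close> is even
    because it is real-valued.\<close>
  have char': "(CLINT \<omega>|M. cnj (H \<omega>) * iexp (t * X \<omega>)) = complex_of_real c * char N t" for t
  proof -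
    have "(CLINT \<omega>|M. cnj (H \<omega>) * iexp (t * X \<omega>)) = (CLINT \<omega>|M. cnj (H \<omega> * iexp ((- t) * X \<omega>)))"
      by (rule Bochner_Integration.integral_cong) (simp_all add: exp_cnj)
    also have "\<dots> = cnj (CLINT \<omega>|M. H \<omega> * iexp ((- t) * X \<omega>))"
      by (rule Bochner_Integration.integral_cnj)
    also have "\<dots> = complex_of_real c * char N t"
      by (subst char) (simp add: char_uminus)
    finally show ?thesis .
  qed
  have "(CLINT \<omega>|M. (1 + Re (H \<omega>)) *\<^sub>R iexp (t * X \<omega>)) = complex_of_real (1 + c) * char N t" for t
  proof -
    have "(CLINT \<omega>|M. (1 + Re (H \<omega>)) *\<^sub>R iexp (t * X \<omega>))
        = (CLINT \<omega>|M. iexp (t * X \<omega>) + (H \<omega> * iexp (t * X \<omega>) + cnj (H \<omega>) * iexp (t * X \<omega>)) / 2)"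
      by (rule Bochner_Integration.integral_cong)
        (auto simp: complex_eq_iff field_simps)
    also have "\<dots> = complex_of_real (1 + c) * char N t"
      using iH iH' ie by (simp add: e1 char char' algebra_simps del: of_real_mult)
    finally show ?thesis .
  qed
  from bounded_weight_char_nonneg[OF X _ _ _ rd this A, where C = 2]
  have re: "(LINT \<omega>|M. (1 + Re (H \<omega>)) * indicator A (X \<omega>)) = (1 + c) * measure N A"
    using Re_bd by simp
  have "(CLINT \<omega>|M. (1 + Im (H \<omega>)) *\<^sub>R iexp (t * X \<omega>)) = complex_of_real 1 * char N t" for t
  proof -
    have "(CLINT \<omega>|M. (1 + Im (H \<omega>)) *\<^sub>R iexp (t * X \<omega>))
        = (CLINT \<omega>|M. iexp (t * X \<omega>) + (H \<omega> * iexp (t * X \<omega>) - cnj (H \<omega>) * iexp (t * X \<omega>)) / (2 * \<i>))"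
      by (rule Bochner_Integration.integral_cong)
        (auto simp: complex_eq_iff Re_divide Im_divide field_simps)
    also have "\<dots> = complex_of_real 1 * char N t"
      using iH iH' ie by (simp add: e1 char char' algebra_simps del: of_real_mult)
    finally show ?thesis .
  qed
  from bounded_weight_char_nonneg[OF X _ _ _ rd this A, where C = 2]
  have im: "(LINT \<omega>|M. (1 + Im (H \<omega>)) * indicator A (X \<omega>)) = 1 * measure N A"
    using Im_bd by simp
  have one: "(LINT \<omega>|M. indicator A (X \<omega>)) = measure N A"
  proof -
    have "measure N A = (LINT x|distr M borel X. indicator A x)"
      using real_distribution.space_eq_univ[OF rd] by (simp add: N)
    also have "\<dots> = (LINT \<omega>|M. indicator A (X \<omega>))" by (subst integral_distr) auto
    finally show ?thesis ..
  qed
  have ii: "integrable M (\<lambda>\<omega>. indicator A (X \<omega>) :: real)"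
    by (rule integrable_const_bound[where B = 1]) (auto simp: indicator_def)
  have iHA: "integrable M (\<lambda>\<omega>. H \<omega> * indicator A (X \<omega>))"
    by (rule bd) (use H1 in \<open>auto simp: norm_mult indicator_def\<close>)
  have iR: "integrable M (\<lambda>\<omega>. Re (H \<omega>) * indicator A (X \<omega>))"
  proof -
    have "(\<lambda>\<omega>. Re (H \<omega> * indicator A (X \<omega>))) = (\<lambda>\<omega>. Re (H \<omega>) * indicator A (X \<omega>))"
      by (auto simp: fun_eq_iff indicator_def)
    then show ?thesis using integrable_Re[OF iHA] by simp
  qed
  have iI: "integrable M (\<lambda>\<omega>. Im (H \<omega>) * indicator A (X \<omega>))"
  proof -
    have "(\<lambda>\<omega>. Im (H \<omega> * indicator A (X \<omega>))) = (\<lambda>\<omega>. Im (H \<omega>) * indicator A (X \<omega>))"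
      by (auto simp: fun_eq_iff indicator_def)
    then show ?thesis using integrable_Im[OF iHA] by simp
  qed
  have "(LINT \<omega>|M. Re (H \<omega>) * indicator A (X \<omega>)) = c * measure N A"
    using re one ii iR by (simp add: distrib_right)
  moreover have "(LINT \<omega>|M. Im (H \<omega>) * indicator A (X \<omega>)) = 0"
    using im one ii iI by (simp add: distrib_right)
  moreover have "Re (CLINT \<omega>|M. H \<omega> * indicator A (X \<omega>)) = (LINT \<omega>|M. Re (H \<omega>) * indicator A (X \<omega>))"
    unfolding integral_Re[OF iHA, symmetric]
    by (rule Bochner_Integration.integral_cong) (auto simp: indicator_def)
  moreover have "Im (CLINT \<omega>|M. H \<omega> * indicator A (X \<omega>)) = (LINT \<omega>|M. Im (H \<omega>) * indicator A (X \<omega>))"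
    unfolding integral_Im[OF iHA, symmetric]
    by (rule Bochner_Integration.integral_cong) (auto simp: indicator_def)
  ultimately show ?thesis by (simp add: complex_eq_iff)
qed

section \<open>Gaussian integrals, centered normal laws and standard normal families\<close>

lemma nn_integral_gaussian:
  assumes a: "0 < (a::real)"
  shows "(\<integral>\<^sup>+x. ennreal (exp (- a * x\<^sup>2 + b * x)) \<partial>lborel) = ennreal (sqrt (pi / a) * exp (b\<^sup>2 / (4 * a)))"
proof -
  define \<mu> where "\<mu> = b / (2 * a)"
  define \<sigma> where "\<sigma> = sqrt (1 / (2 * a))"
  have \<sigma>: "0 < \<sigma>" "\<sigma>\<^sup>2 = 1 / (2 * a)" using a by (simp_all add: \<sigma>_def)
  define C where "C = sqrt (pi / a) * exp (b\<^sup>2 / (4 * a))"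
  have C0: "0 \<le> C" using a by (simp add: C_def)
  have "exp (- a * x\<^sup>2 + b * x) = C * normal_density \<mu> \<sigma> x" for x
  proof -
    have s2: "2 * \<sigma>\<^sup>2 = 1 / a" by (simp add: \<sigma>(2))
    have "- a * x\<^sup>2 + b * x = b\<^sup>2 / (4 * a) + - (x - \<mu>)\<^sup>2 / (2 * \<sigma>\<^sup>2)"
      unfolding s2 using a by (simp add: \<mu>_def field_simps power2_eq_square)
    then have "exp (- a * x\<^sup>2 + b * x) = exp (b\<^sup>2 / (4 * a)) * exp (- (x - \<mu>)\<^sup>2 / (2 * \<sigma>\<^sup>2))"
      by (simp only: exp_add)
    moreover have "sqrt (2 * pi * \<sigma>\<^sup>2) = sqrt (pi / a)" using a by (simp add: \<sigma>)
    moreover have "sqrt (pi / a) \<noteq> 0" using a by simp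
    ultimately show ?thesis unfolding normal_density_def C_def by simp
  qed
  then have "(\<integral>\<^sup>+x. ennreal (exp (- a * x\<^sup>2 + b * x)) \<partial>lborel)
      = (\<integral>\<^sup>+x. ennreal C * ennreal (normal_density \<mu> \<sigma> x) \<partial>lborel)"
    using C0 by (simp add: ennreal_mult')
  also have "\<dots> = ennreal C * (\<integral>\<^sup>+x. ennreal (normal_density \<mu> \<sigma> x) \<partial>lborel)"
    by (rule nn_integral_cmult) simp
  also have "(\<integral>\<^sup>+x. ennreal (normal_density \<mu> \<sigma> x) \<partial>lborel) = 1"
    using \<sigma> by (simp add: nn_integral_eq_integral normal_density_nonneg)
  finally show ?thesis by (simp add: C_def)
qed

lemma real_distribution_centered_normal:
  assumes "0 \<le> v"
  shows "real_distribution (centered_normal v)"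
proof (cases "v = 0")
  case True
  then show ?thesis
    by (auto simp: centered_normal_def real_distribution_def real_distribution_axioms_def
        intro!: prob_space_return)
next
  case False
  then show ?thesis using assms
    by (auto simp: centered_normal_def real_distribution_def real_distribution_axioms_def
        intro!: prob_space_normal_density)
qed

lemma char_centered_normal:
  assumes v: "0 \<le> v"
  shows "char (centered_normal v) t = complex_of_real (exp (- v * t\<^sup>2 / 2))"
proof (cases "v = 0")
  case True
  then show ?thesis by (simp add: centered_normal_def char_def integral_return)
next
  case False
  with v have v: "0 < v" by simp
  interpret N: prob_space std_normal_distribution by (rule prob_space_normal_density) simp
  have "distributed std_normal_distribution lborel (\<lambda>x. x) (normal_density 0 1)"
    by (auto simp: distributed_def distr_id2)
  from N.normal_density_affine[OF this, of "sqrt v" 0]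
  have d: "distributed std_normal_distribution lborel (\<lambda>x. sqrt v * x) (normal_density 0 (sqrt v))"
    using v by simp
  have "centered_normal v = distr std_normal_distribution lborel (\<lambda>x. sqrt v * x)"
    using distributed_distr_eq_density[OF d] v by (simp add: centered_normal_def)
  then have "char (centered_normal v) t = (CLINT x|std_normal_distribution. iexp (t * (sqrt v * x)))"
    unfolding char_def by (simp add: integral_distr)
  also have "\<dots> = char std_normal_distribution (t * sqrt v)"
    by (simp add: char_def mult.assoc)
  also have "\<dots> = complex_of_real (exp (- v * t\<^sup>2 / 2))"
    unfolding char_std_normal_distribution using v by (simp add: power_mult_distrib mult.commute)
  finally show ?thesis .
qed

lemma centered_normal_one: "centered_normal 1 = std_normal_distribution"
  by (simp add: centered_normal_def)

text \<open>Joint normality with identity covariance, stated as in \<open>gaussian_vec\<close> through linear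
  functionals.\<close>

definition std_gaussian_family :: "'a measure \<Rightarrow> nat \<Rightarrow> (nat \<Rightarrow> 'a \<Rightarrow> real) \<Rightarrow> bool" where
  "std_gaussian_family M n \<xi> \<longleftrightarrow> (\<forall>j<n. \<xi> j \<in> borel_measurable M) \<and>
     (\<forall>a. distr M borel (\<lambda>\<omega>. \<Sum>j<n. a j * \<xi> j \<omega>) = centered_normal (\<Sum>j<n. (a j)\<^sup>2))"

lemma std_gaussian_family_cong:
  assumes g: "std_gaussian_family M n \<xi>" and eq: "\<And>j \<omega>. j < n \<Longrightarrow> \<xi> j \<omega> = \<eta> j \<omega>"
  shows "std_gaussian_family M n \<eta>"
proof -
  have "(\<Sum>j<n. a j * \<xi> j \<omega>) = (\<Sum>j<n. a j * \<eta> j \<omega>)" for a \<omega>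
    by (rule sum.cong) (simp_all add: eq)
  moreover have "\<xi> j = \<eta> j" if "j < n" for j using eq[OF that] by (simp add: fun_eq_iff)
  ultimately show ?thesis using g unfolding std_gaussian_family_def by simp
qed

lemma std_gaussian_family_measurable:
  "std_gaussian_family M n \<xi> \<Longrightarrow> j < n \<Longrightarrow> \<xi> j \<in> borel_measurable M"
  by (simp add: std_gaussian_family_def)

lemma std_gaussian_family_coordinate:
  assumes "std_gaussian_family M n \<xi>" and k: "k < n"
  shows "distr M borel (\<xi> k) = std_normal_distribution"
proof -
  have "distr M borel (\<lambda>\<omega>. \<Sum>j<n. (if j = k then 1 else 0) * \<xi> j \<omega>)
      = centered_normal (\<Sum>j<n. ((if j = k then 1 else 0) :: real)\<^sup>2)"
    by (rule spec[OF conjunct2[OF assms(1)[unfolded std_gaussian_family_def]]])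
  moreover have "(\<Sum>j<n. (if j = k then 1 else 0) * \<xi> j \<omega>) = \<xi> k \<omega>" for \<omega>
  proof -
    have "(\<Sum>j<n. (if j = k then 1 else 0) * \<xi> j \<omega>) = (\<Sum>j<n. if j = k then \<xi> j \<omega> else 0)"
      by (rule sum.cong) auto
    then show ?thesis using k by simp
  qed
  moreover have "(\<Sum>j<n. ((if j = k then 1 else 0) :: real)\<^sup>2) = 1"
  proof -
    have "(\<Sum>j<n. ((if j = k then 1 else 0) :: real)\<^sup>2) = (\<Sum>j<n. if j = k then 1 else 0)"
      by (rule sum.cong) auto
    then show ?thesis using k by simp
  qed
  ultimately show ?thesis by (simp add: centered_normal_one)
qed

text \<open>The coefficients c of the combined functional have the same squared sum as a, because
  the rows of u are orthonormal. Serves for rotations as well as for extracting fewer independent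
  combinations.\<close>

lemma std_gaussian_family_orthonormal:
  assumes g: "std_gaussian_family M n \<xi>"
    and o: "\<And>k l. k < m \<Longrightarrow> l < m \<Longrightarrow> (\<Sum>j<n. u k j * u l j) = (if k = l then 1 else 0)"
  shows "std_gaussian_family M m (\<lambda>k \<omega>. \<Sum>j<n. u k j * \<xi> j \<omega>)"
  unfolding std_gaussian_family_def
proof (intro conjI allI impI)
  fix k assume "k < m"
  have [measurable]: "j < n \<Longrightarrow> \<xi> j \<in> borel_measurable M" for j
    using std_gaussian_family_measurable[OF g] .
  show "(\<lambda>\<omega>. \<Sum>j<n. u k j * \<xi> j \<omega>) \<in> borel_measurable M" by measurable
next
  fix a :: "nat \<Rightarrow> real"
  define c where "c j = (\<Sum>k<m. a k * u k j)" for j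
  have "(\<Sum>k<m. a k * (\<Sum>j<n. u k j * \<xi> j \<omega>)) = (\<Sum>j<n. c j * \<xi> j \<omega>)" for \<omega>
    unfolding c_def sum_distrib_left sum_distrib_right by (subst sum.swap) (simp add: mult.assoc)
  moreover have "(\<Sum>j<n. (c j)\<^sup>2) = (\<Sum>k<m. (a k)\<^sup>2)"
  proof -
    have "(\<Sum>j<n. (c j)\<^sup>2) = (\<Sum>j<n. \<Sum>k<m. \<Sum>l<m. a k * a l * (u k j * u l j))"
      unfolding c_def power2_eq_square sum_product by (simp add: algebra_simps)
    also have "\<dots> = (\<Sum>k<m. \<Sum>l<m. a k * a l * (\<Sum>j<n. u k j * u l j))"
      unfolding sum_distrib_left by (subst sum.swap) (rule sum.cong[OF refl sum.swap])
    also have "\<dots> = (\<Sum>k<m. \<Sum>l<m. if l = k then (a k)\<^sup>2 else 0)"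
      by (intro sum.cong refl) (auto simp: o power2_eq_square)
    finally show ?thesis by simp
  qed
  ultimately show "distr M borel (\<lambda>\<omega>. \<Sum>k<m. a k * (\<Sum>j<n. u k j * \<xi> j \<omega>)) = centered_normal (\<Sum>k<m. (a k)\<^sup>2)"
    using g unfolding std_gaussian_family_def by simp
qed

text \<open>The factors are converted one at a time from exponentials to indicators. Each conversion
  is \<open>bounded_weight_char\<close> with the product of all other factors as a complex weight of
  norm at most 1, so uniqueness on the line yields the joint law.\<close>

lemma (in prob_space) std_gaussian_family_mixed:
  assumes g: "std_gaussian_family M n \<xi>" and k: "k \<le> n" and A: "\<And>j. A j \<in> sets borel"
  shows "(CLINT \<omega>|M. (\<Prod>j<k. indicator (A j) (\<xi> j \<omega>)) * iexp (\<Sum>j\<in>{k..<n}. t j * \<xi> j \<omega>))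
    = complex_of_real ((\<Prod>j<k. measure std_normal_distribution (A j)) * exp (- (\<Sum>j\<in>{k..<n}. (t j)\<^sup>2) / 2))"
  using k
proof (induction k arbitrary: t)
  case 0
  have [measurable]: "j < n \<Longrightarrow> \<xi> j \<in> borel_measurable M" for j
    using std_gaussian_family_measurable[OF g] .
  have "(CLINT \<omega>|M. iexp (\<Sum>j<n. t j * \<xi> j \<omega>)) = char (distr M borel (\<lambda>\<omega>. \<Sum>j<n. t j * \<xi> j \<omega>)) 1"
    unfolding char_def by (subst integral_distr) auto
  also have "\<dots> = complex_of_real (exp (- (\<Sum>j<n. (t j)\<^sup>2) / 2))"
    using g char_centered_normal[of "\<Sum>j<n. (t j)\<^sup>2" 1]
    by (simp add: std_gaussian_family_def sum_nonneg)
  finally show ?case by (simp add: lessThan_atLeast0)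
next
  case (Suc k)
  have [measurable]: "j < n \<Longrightarrow> \<xi> j \<in> borel_measurable M" for j
    using std_gaussian_family_measurable[OF g] .
  have [measurable]: "A j \<in> sets borel" for j by (rule A)
  have k: "k < n" using Suc.prems by simp
  have split: "{k..<n} = insert k {Suc k..<n}" using k by auto
  define H where "H = (\<lambda>\<omega>. (\<Prod>j<k. indicator (A j) (\<xi> j \<omega>)) * iexp (\<Sum>j\<in>{Suc k..<n}. t j * \<xi> j \<omega>))"
  define c where "c = (\<Prod>j<k. measure std_normal_distribution (A j)) * exp (- (\<Sum>j\<in>{Suc k..<n}. (t j)\<^sup>2) / 2)"
  have [measurable]: "(\<lambda>\<omega>. \<Prod>j<k. indicator (A j) (\<xi> j \<omega>) :: complex) \<in> borel_measurable M"
    by (rule borel_measurable_prod) (use k in auto)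
  have [measurable]: "(\<lambda>\<omega>. \<Sum>j\<in>{Suc k..<n}. t j * \<xi> j \<omega>) \<in> borel_measurable M"
    by (rule borel_measurable_sum) auto
  have Hm: "H \<in> borel_measurable M" unfolding H_def by measurable
  have H1: "norm (H \<omega>) \<le> 1" for \<omega>
  proof -
    have "norm (\<Prod>j<k. indicator (A j) (\<xi> j \<omega>) :: complex) \<le> (\<Prod>j<k. 1)"
      unfolding prod_norm[symmetric] by (rule prod_mono) (auto simp: indicator_def)
    then show ?thesis by (simp add: H_def norm_mult)
  qed
  have char: "(CLINT \<omega>|M. H \<omega> * iexp (s * \<xi> k \<omega>)) = complex_of_real c * char std_normal_distribution s" for s
  proof -
    \<comment> \<open>The induction hypothesis covers all t; varying the coefficient of index k
      exhibits the transform as a function of s.\<close>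
    have "(\<Sum>j\<in>{k..<n}. (t(k := s)) j * \<xi> j \<omega>) = s * \<xi> k \<omega> + (\<Sum>j\<in>{Suc k..<n}. t j * \<xi> j \<omega>)" for \<omega>
      by (simp add: split)
    then have "(CLINT \<omega>|M. H \<omega> * iexp (s * \<xi> k \<omega>))
        = (CLINT \<omega>|M. (\<Prod>j<k. indicator (A j) (\<xi> j \<omega>)) * iexp (\<Sum>j\<in>{k..<n}. (t(k := s)) j * \<xi> j \<omega>))"
      unfolding H_def
      by (intro Bochner_Integration.integral_cong refl)
        (simp only: of_real_add distrib_left exp_add mult.assoc mult.commute mult.left_commute)
    also have "\<dots> = complex_of_real ((\<Prod>j<k. measure std_normal_distribution (A j)) *
        exp (- (\<Sum>j\<in>{k..<n}. ((t(k := s)) j)\<^sup>2) / 2))"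
      using Suc.IH[of "t(k := s)"] k by simp
    also have "(\<Sum>j\<in>{k..<n}. ((t(k := s)) j)\<^sup>2) = s\<^sup>2 + (\<Sum>j\<in>{Suc k..<n}. (t j)\<^sup>2)"
      by (simp add: split)
    also have "complex_of_real ((\<Prod>j<k. measure std_normal_distribution (A j)) *
        exp (- (s\<^sup>2 + (\<Sum>j\<in>{Suc k..<n}. (t j)\<^sup>2)) / 2)) = complex_of_real c * char std_normal_distribution s"
      by (simp add: c_def char_std_normal_distribution exp_add[symmetric] field_simps
          flip: of_real_mult)
    finally show ?thesis .
  qed
  have "(CLINT \<omega>|M. H \<omega> * indicator (A k) (\<xi> k \<omega>)) = complex_of_real (c * measure std_normal_distribution (A k))"
    by (rule bounded_weight_char[OF _ Hm H1 std_gaussian_family_coordinate[OF g k] _ char])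
      (use k in \<open>auto simp: char_std_normal_distribution\<close>)
  then show ?case
    by (simp add: H_def c_def mult_ac)
qed

text \<open>The mixed formula with all n factors converted is the product formula for the joint law;
  putting the whole line at the indices outside J gives it for every finite subfamily.\<close>

lemma (in prob_space) std_gaussian_family_indep:
  assumes g: "std_gaussian_family M n \<xi>"
  shows "indep_vars (\<lambda>_. borel) \<xi> {..<n}"
proof -
  note meas = std_gaussian_family_measurable[OF g]
  have [measurable]: "j < n \<Longrightarrow> \<xi> j \<in> borel_measurable M" for j by (rule meas)
  have joint: "prob {\<omega> \<in> space M. \<forall>j<n. \<xi> j \<omega> \<in> A j} = (\<Prod>j<n. measure std_normal_distribution (A j))"
    if A: "\<And>j. A j \<in> sets borel" for A
  proof -
    have [measurable]: "A j \<in> sets borel" for j by (rule A)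
    have "(\<Prod>j<n. indicator (A j) (\<xi> j \<omega>) :: complex)
        = complex_of_real (indicator {\<omega> \<in> space M. \<forall>j<n. \<xi> j \<omega> \<in> A j} \<omega>)" if "\<omega> \<in> space M" for \<omega>
      using that by (auto simp: indicator_def prod_zero_iff)
    then have "(CLINT \<omega>|M. (\<Prod>j<n. indicator (A j) (\<xi> j \<omega>)))
        = (CLINT \<omega>|M. complex_of_real (indicator {\<omega> \<in> space M. \<forall>j<n. \<xi> j \<omega> \<in> A j} \<omega>))"
      by (intro Bochner_Integration.integral_cong) auto
    also have "\<dots> = complex_of_real (prob {\<omega> \<in> space M. \<forall>j<n. \<xi> j \<omega> \<in> A j})"
      by (subst integral_of_real) (auto intro!: integrable_const_bound[where B = 1])
    finally show ?thesis
      using std_gaussian_family_mixed[where A = A and t = "\<lambda>_. 0", OF g order_refl A]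
      by (simp flip: of_real_prod)
  qed
  have single: "prob (\<xi> j -` B \<inter> space M) = measure std_normal_distribution B" if "j < n" "B \<in> sets borel" for j B
    using measure_distr[OF meas[OF that(1)] that(2)] std_gaussian_family_coordinate[OF g that(1)] by simp
  show ?thesis
    unfolding indep_vars_def2
  proof (intro conjI ballI indep_setsI)
    fix j assume "j \<in> {..<n}" then show "random_variable borel (\<xi> j)" by simp
  next
    fix i assume "i \<in> {..<n}"
    then show "{\<xi> i -` A \<inter> space M | A. A \<in> sets borel} \<subseteq> events" by auto
  next
    fix E J assume J: "J \<noteq> {}" "J \<subseteq> {..<n}" "finite J"
      and E: "\<forall>j\<in>J. E j \<in> {\<xi> j -` A \<inter> space M | A. A \<in> sets borel}"
    from E have "\<forall>j\<in>J. \<exists>A. E j = \<xi> j -` A \<inter> space M \<and> A \<in> sets borel" by blast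
    then obtain B where B: "\<And>j. j \<in> J \<Longrightarrow> E j = \<xi> j -` B j \<inter> space M" "\<And>j. j \<in> J \<Longrightarrow> B j \<in> sets borel"
      by metis
    define A where "A j = (if j \<in> J then B j else UNIV)" for j
    have A: "A j \<in> sets borel" for j using B by (simp add: A_def)
    have UNIV1: "measure std_normal_distribution UNIV = 1"
      using prob_space.prob_space[OF prob_space_normal_density[of 1 0]] by simp
    have "(\<Inter>j\<in>J. E j) = {\<omega> \<in> space M. \<forall>j<n. \<xi> j \<omega> \<in> A j}"
      using J B(1) by (auto simp: A_def)
    then have "prob (\<Inter>j\<in>J. E j) = (\<Prod>j<n. measure std_normal_distribution (A j))"
      using joint[OF A] by simp
    also have "\<dots> = (\<Prod>j\<in>J. measure std_normal_distribution (A j))"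
      by (rule prod.mono_neutral_right) (use J UNIV1 in \<open>auto simp: A_def\<close>)
    also have "\<dots> = (\<Prod>j\<in>J. prob (E j))"
      using J B single by (intro prod.cong) (auto simp: A_def)
    finally show "prob (\<Inter>j\<in>J. E j) = (\<Prod>j\<in>J. prob (E j))" .
  qed
qed

lemma (in prob_space) std_gaussian_family_nn_integral_prod:
  fixes f :: "nat \<Rightarrow> real \<Rightarrow> ennreal"
  assumes g: "std_gaussian_family M n \<xi>" and f: "\<And>j. f j \<in> borel_measurable borel"
  shows "(\<integral>\<^sup>+\<omega>. (\<Prod>j<n. f j (\<xi> j \<omega>)) \<partial>M) = (\<Prod>j<n. \<integral>\<^sup>+x. f j x * ennreal (std_normal_density x) \<partial>lborel)"
proof -
  have "indep_vars (\<lambda>_. borel) (\<lambda>j \<omega>. f j (\<xi> j \<omega>)) {..<n}"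
    by (rule indep_vars_compose2[OF std_gaussian_family_indep[OF g]]) (rule f)
  then have "(\<integral>\<^sup>+\<omega>. (\<Prod>j<n. f j (\<xi> j \<omega>)) \<partial>M) = (\<Prod>j<n. \<integral>\<^sup>+\<omega>. f j (\<xi> j \<omega>) \<partial>M)"
    by (intro indep_vars_nn_integral) auto
  also have "\<dots> = (\<Prod>j<n. \<integral>\<^sup>+x. f j x * ennreal (std_normal_density x) \<partial>lborel)"
  proof (rule prod.cong[OF refl])
    fix j assume "j \<in> {..<n}"
    then have j: "j < n" by simp
    have "(\<integral>\<^sup>+\<omega>. f j (\<xi> j \<omega>) \<partial>M) = (\<integral>\<^sup>+x. f j x \<partial>distr M borel (\<xi> j))"
      using f std_gaussian_family_measurable[OF g j] by (simp add: nn_integral_distr)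
    also have "\<dots> = (\<integral>\<^sup>+x. f j x * ennreal (std_normal_density x) \<partial>lborel)"
      unfolding std_gaussian_family_coordinate[OF g j] using f
      by (subst nn_integral_density) (auto simp: mult.commute)
    finally show "(\<integral>\<^sup>+\<omega>. f j (\<xi> j \<omega>) \<partial>M) = (\<integral>\<^sup>+x. f j x * ennreal (std_normal_density x) \<partial>lborel)" .
  qed
  finally show ?thesis .
qed

section \<open>Tail bounds by exponential moments\<close>

lemma (in prob_space) prob_le_of_nn_integral:
  fixes F :: "'a \<Rightarrow> ennreal"
  assumes A: "A \<in> events" and F: "\<And>\<omega>. \<omega> \<in> A \<Longrightarrow> 1 \<le> F \<omega>"
    and int: "(\<integral>\<^sup>+\<omega>. F \<omega> \<partial>M) \<le> ennreal r" and r: "0 \<le> r"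
  shows "prob A \<le> r"
proof -
  have "emeasure M A = (\<integral>\<^sup>+\<omega>. indicator A \<omega> \<partial>M)" using A by simp
  also have "\<dots> \<le> (\<integral>\<^sup>+\<omega>. F \<omega> \<partial>M)"
    by (rule nn_integral_mono) (auto simp: indicator_def F)
  also note int
  finally show ?thesis using r by (simp add: emeasure_eq_measure)
qed

text \<open>Chernoff bound for the lower chi-square tail. The parameter s = 1/6 minimizes exp (3s/4)
  / sqrt (1 + 2s), and 1/8 is 3/4 of it.\<close>

lemma (in prob_space) std_gaussian_family_sum_sq_lower_tail:
  assumes g: "std_gaussian_family M n \<xi>"
  shows "prob {\<omega> \<in> space M. (\<Sum>j<n. (\<xi> j \<omega>)\<^sup>2) < 3 / 4 * real n} \<le> (exp (1 / 8) * sqrt (3 / 4)) ^ n"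
proof -
  have [measurable]: "j < n \<Longrightarrow> \<xi> j \<in> borel_measurable M" for j
    using std_gaussian_family_measurable[OF g] .
  have one: "(\<integral>\<^sup>+x. ennreal (exp (1 / 8 - x\<^sup>2 / 6)) * ennreal (std_normal_density x) \<partial>lborel)
      = ennreal (exp (1 / 8) * sqrt (3 / 4))"
  proof -
    have "exp (1 / 8 - x\<^sup>2 / 6) * std_normal_density x
        = exp (1 / 8) / sqrt (2 * pi) * exp (- (2 / 3) * x\<^sup>2 + 0 * x)" for x :: real
      by (simp add: std_normal_density_def exp_add[symmetric] exp_diff field_simps flip: exp_add)
    then have "(\<integral>\<^sup>+x. ennreal (exp (1 / 8 - x\<^sup>2 / 6)) * ennreal (std_normal_density x) \<partial>lborel)
        = (\<integral>\<^sup>+x. ennreal (exp (1 / 8) / sqrt (2 * pi)) * ennreal (exp (- (2 / 3) * x\<^sup>2 + 0 * x)) \<partial>lborel)"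
      by (simp add: ennreal_mult'[symmetric])
    also have "\<dots> = ennreal (exp (1 / 8) / sqrt (2 * pi)) * ennreal (sqrt (pi / (2 / 3)) * exp (0\<^sup>2 / (4 * (2 / 3))))"
      by (subst nn_integral_cmult) (simp, subst nn_integral_gaussian, simp_all)
    also have "\<dots> = ennreal (exp (1 / 8) * sqrt (3 / 4))"
      by (simp add: ennreal_mult'[symmetric] real_sqrt_divide real_sqrt_mult field_simps)
    finally show ?thesis .
  qed
  show ?thesis
  proof (rule prob_le_of_nn_integral[where F = "\<lambda>\<omega>. \<Prod>j<n. ennreal (exp (1 / 8 - (\<xi> j \<omega>)\<^sup>2 / 6))"])
    fix \<omega> assume "\<omega> \<in> {\<omega> \<in> space M. (\<Sum>j<n. (\<xi> j \<omega>)\<^sup>2) < 3 / 4 * real n}"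
    then have "0 \<le> (\<Sum>j<n. 1 / 8 - (\<xi> j \<omega>)\<^sup>2 / 6)"
      by (simp add: sum_subtractf flip: sum_divide_distrib)
    then have "1 \<le> exp (\<Sum>j<n. 1 / 8 - (\<xi> j \<omega>)\<^sup>2 / 6)" by simp
    then show "1 \<le> (\<Prod>j<n. ennreal (exp (1 / 8 - (\<xi> j \<omega>)\<^sup>2 / 6)))"
      by (simp add: prod_ennreal exp_sum flip: ennreal_1)
  next
    show "(\<integral>\<^sup>+\<omega>. (\<Prod>j<n. ennreal (exp (1 / 8 - (\<xi> j \<omega>)\<^sup>2 / 6))) \<partial>M)
        \<le> ennreal ((exp (1 / 8) * sqrt (3 / 4)) ^ n)"
      by (subst std_gaussian_family_nn_integral_prod[OF g]) (simp_all add: one ennreal_power)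
  qed auto
qed

text \<open>Chernoff bound with the parameter z / u that is optimal for variance u; a smaller
  variance v only lowers the moment. The case v = 0 is separate because a point mass has no
  density.\<close>

lemma (in prob_space) centered_normal_tail:
  assumes X: "X \<in> borel_measurable M" and d: "distr M borel X = centered_normal v"
    and v: "0 \<le> v" and vu: "v \<le> u" and z: "0 \<le> z" and u: "0 < u"
  shows "prob {\<omega> \<in> space M. z < \<bar>X \<omega>\<bar>} \<le> 2 * exp (- z\<^sup>2 / (2 * u))"
proof (cases "v = 0")
  case True
  have "prob {\<omega> \<in> space M. z < \<bar>X \<omega>\<bar>} = measure (distr M borel X) {x. z < \<bar>x\<bar>}"
    using X by (subst measure_distr) (auto intro!: arg_cong[where f = prob])
  also have "\<dots> = 0" using True z by (simp add: d centered_normal_def measure_return)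
  finally show ?thesis by simp
next
  case False
  with v have v: "0 < v" by simp
  note [measurable] = X
  have mgf: "(\<integral>\<^sup>+\<omega>. ennreal (exp (s * X \<omega>)) \<partial>M) = ennreal (exp (s\<^sup>2 * v / 2))" for s
  proof -
    have "(\<integral>\<^sup>+\<omega>. ennreal (exp (s * X \<omega>)) \<partial>M) = (\<integral>\<^sup>+x. ennreal (exp (s * x)) \<partial>distr M borel X)"
      by (simp add: nn_integral_distr)
    also have "\<dots> = (\<integral>\<^sup>+x. ennreal (normal_density 0 (sqrt v) x) * ennreal (exp (s * x)) \<partial>lborel)"
      unfolding d centered_normal_def using v by (simp add: nn_integral_density)
    also have "\<dots> = (\<integral>\<^sup>+x. ennreal (1 / sqrt (2 * pi * v)) * ennreal (exp (- (1 / (2 * v)) * x\<^sup>2 + s * x)) \<partial>lborel)"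
      using v by (intro nn_integral_cong)
        (simp add: normal_density_def ennreal_mult'[symmetric] exp_add[symmetric] mult.assoc)
    also have "\<dots> = ennreal (1 / sqrt (2 * pi * v)) * ennreal (sqrt (pi / (1 / (2 * v))) * exp (s\<^sup>2 / (4 * (1 / (2 * v)))))"
      by (subst nn_integral_cmult) (simp, subst nn_integral_gaussian, use v in simp_all)
    also have "\<dots> = ennreal (exp (s\<^sup>2 * v / 2))"
      using v by (simp add: ennreal_mult'[symmetric] mult.commute mult.left_commute)
    finally show ?thesis .
  qed
  define s where "s = z / u"
  have s: "0 \<le> s" using z u by (simp add: s_def)
  have ez: "s\<^sup>2 * v / 2 - s * z \<le> - z\<^sup>2 / (2 * u)"
  proof -
    have "s\<^sup>2 * v / 2 \<le> s\<^sup>2 * u / 2" using vu by (simp add: mult_left_mono)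
    also have "\<dots> = s * z - z\<^sup>2 / (2 * u)" using u by (simp add: s_def field_simps power2_eq_square)
    finally show ?thesis by simp
  qed
  show ?thesis
  proof (rule prob_le_of_nn_integral[where F = "\<lambda>\<omega>. ennreal (exp (- (s * z))) * ennreal (exp (s * X \<omega>))
        + ennreal (exp (- (s * z))) * ennreal (exp ((- s) * X \<omega>))"])
    fix \<omega> assume "\<omega> \<in> {\<omega> \<in> space M. z < \<bar>X \<omega>\<bar>}"
    then have "s * z \<le> s * \<bar>X \<omega>\<bar>" using s by (auto intro: mult_left_mono)
    then have "0 \<le> - (s * z) + s * X \<omega> \<or> 0 \<le> - (s * z) + (- s) * X \<omega>"
      by (cases "0 \<le> X \<omega>") auto
    then have "1 \<le> exp (- (s * z) + s * X \<omega>) \<or> 1 \<le> exp (- (s * z) + (- s) * X \<omega>)" by simp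
    moreover have "0 < exp (- (s * z) + s * X \<omega>)" "0 < exp (- (s * z) + (- s) * X \<omega>)" by simp_all
    ultimately have "1 \<le> exp (- (s * z) + s * X \<omega>) + exp (- (s * z) + (- s) * X \<omega>)" by linarith
    then show "1 \<le> ennreal (exp (- (s * z))) * ennreal (exp (s * X \<omega>))
        + ennreal (exp (- (s * z))) * ennreal (exp ((- s) * X \<omega>))"
      by (simp add: ennreal_mult'[symmetric] ennreal_plus[symmetric] exp_add[symmetric]
          del: ennreal_plus flip: ennreal_1)
  next
    have "(\<integral>\<^sup>+\<omega>. ennreal (exp (- (s * z))) * ennreal (exp (s * X \<omega>))
        + ennreal (exp (- (s * z))) * ennreal (exp ((- s) * X \<omega>)) \<partial>M)
        = ennreal (exp (- (s * z))) * ennreal (exp (s\<^sup>2 * v / 2)) + ennreal (exp (- (s * z))) * ennreal (exp ((- s)\<^sup>2 * v / 2))"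
      by (subst nn_integral_add) (simp_all add: nn_integral_cmult mgf mgf[of "- s", simplified])
    also have "\<dots> = ennreal (2 * exp (s\<^sup>2 * v / 2 - s * z))"
      by (simp add: ennreal_mult'[symmetric] ennreal_plus[symmetric] exp_add[symmetric] del: ennreal_plus)
    also have "\<dots> \<le> ennreal (2 * exp (- z\<^sup>2 / (2 * u)))"
      using ez by (intro ennreal_leI) simp
    finally show "(\<integral>\<^sup>+\<omega>. ennreal (exp (- (s * z))) * ennreal (exp (s * X \<omega>))
        + ennreal (exp (- (s * z))) * ennreal (exp ((- s) * X \<omega>)) \<partial>M) \<le> ennreal (2 * exp (- z\<^sup>2 / (2 * u)))" .
  qed auto
qed

text \<open>The factor 1/4 leaves the leading exponent -(1 + m) x^2 / 4, integrable for every m > 0.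
  Up to the factor m^(1/4), which cancels when the \<open>m j\<close> multiply to 1, this is the
  integral of the geometric mean of the standard normal density and the normal density with mean -d
  and precision m.\<close>

lemma nn_integral_gaussian_tilt:
  assumes m: "0 < (m::real)"
  shows "(\<integral>\<^sup>+x. ennreal (exp (- (m * (x + d)\<^sup>2 - x\<^sup>2) / 4)) * ennreal (std_normal_density x) \<partial>lborel)
    = ennreal (sqrt (2 / (1 + m)) * exp (- (m / (1 + m) * d\<^sup>2) / 4))"
proof -
  define C where "C = exp (- (m * d\<^sup>2) / 4) / sqrt (2 * pi)"
  have C: "0 \<le> C" by (simp add: C_def)
  have "exp (- (m * (x + d)\<^sup>2 - x\<^sup>2) / 4) * std_normal_density x
      = C * exp (- ((1 + m) / 4) * x\<^sup>2 + (- (m * d / 2)) * x)" for x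
  proof -
    have "- (m * (x + d)\<^sup>2 - x\<^sup>2) / 4 + - x\<^sup>2 / 2
        = - (m * d\<^sup>2) / 4 + (- ((1 + m) / 4) * x\<^sup>2 + (- (m * d / 2)) * x)"
      by (simp add: field_simps power2_eq_square)
    then have "exp (- (m * (x + d)\<^sup>2 - x\<^sup>2) / 4) * exp (- x\<^sup>2 / 2)
        = exp (- (m * d\<^sup>2) / 4) * exp (- ((1 + m) / 4) * x\<^sup>2 + (- (m * d / 2)) * x)"
      unfolding exp_add[symmetric] by (rule arg_cong)
    then show ?thesis by (simp add: std_normal_density_def C_def)
  qed
  then have "(\<integral>\<^sup>+x. ennreal (exp (- (m * (x + d)\<^sup>2 - x\<^sup>2) / 4)) * ennreal (std_normal_density x) \<partial>lborel)
      = (\<integral>\<^sup>+x. ennreal C * ennreal (exp (- ((1 + m) / 4) * x\<^sup>2 + (- (m * d / 2)) * x)) \<partial>lborel)"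
    using C by (simp only: ennreal_mult'[symmetric] normal_density_nonneg exp_ge_zero)
  also have "\<dots> = ennreal C * ennreal (sqrt (pi / ((1 + m) / 4)) * exp ((- (m * d / 2))\<^sup>2 / (4 * ((1 + m) / 4))))"
    by (subst nn_integral_cmult) (simp, subst nn_integral_gaussian, use m in simp_all)
  also have "\<dots> = ennreal (C * (sqrt (pi / ((1 + m) / 4)) * exp ((- (m * d / 2))\<^sup>2 / (4 * ((1 + m) / 4)))))"
    using C by (rule ennreal_mult'[symmetric])
  also have "C * (sqrt (pi / ((1 + m) / 4)) * exp ((- (m * d / 2))\<^sup>2 / (4 * ((1 + m) / 4))))
      = sqrt (2 / (1 + m)) * exp (- (m / (1 + m) * d\<^sup>2) / 4)"
  proof -
    have "- (m * d\<^sup>2) / 4 + (- (m * d / 2))\<^sup>2 / (4 * ((1 + m) / 4)) = - (m / (1 + m) * d\<^sup>2) / 4"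
      using m by (simp add: divide_simps power2_eq_square) (simp add: algebra_simps)
    then have e: "exp (- (m * d\<^sup>2) / 4) * exp ((- (m * d / 2))\<^sup>2 / (4 * ((1 + m) / 4)))
        = exp (- (m / (1 + m) * d\<^sup>2) / 4)" unfolding exp_add[symmetric] by (rule arg_cong)
    have "sqrt (pi / ((1 + m) / 4)) = sqrt (2 * pi) * sqrt (2 / (1 + m))"
      unfolding real_sqrt_mult[symmetric] by (simp add: field_simps)
    then show ?thesis unfolding C_def e[symmetric] by simp
  qed
  finally show ?thesis .
qed

subsection \<open>Profile deviations of quadratic forms\<close>

text \<open>Bounds a value at the single slope h by an integral over all slopes. By convexity the
  quadratic weight lies above its tangent at h, whose slope is k, and a linear term can only
  increase a centered Gaussian integral, here by exp (k^2 / a).\<close>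

lemma gaussian_profile_le_integral:
  assumes a: "0 < (a::real)" and \<theta>: "0 \<le> \<theta>"
  shows "ennreal (sqrt (4 * pi / a) * exp (r + \<theta> * (h - b0)\<^sup>2))
    \<le> (\<integral>\<^sup>+b. ennreal (exp (r - a * (b - h)\<^sup>2 / 4 + \<theta> * (b - b0)\<^sup>2)) \<partial>lborel)"
proof -
  define k where "k = 2 * \<theta> * (h - b0)"
  define C where "C = exp (r + \<theta> * (h - b0)\<^sup>2)"
  have "ennreal (sqrt (4 * pi / a) * C) \<le> ennreal (C * (sqrt (pi / (a / 4)) * exp (k\<^sup>2 / (4 * (a / 4)))))"
  proof (rule ennreal_leI)
    have "1 \<le> exp (k\<^sup>2 / (4 * (a / 4)))" using a by simp
    then have "sqrt (4 * pi / a) * C * 1 \<le> sqrt (4 * pi / a) * C * exp (k\<^sup>2 / (4 * (a / 4)))"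
      by (intro mult_left_mono) (use a in \<open>auto simp: C_def\<close>)
    then show "sqrt (4 * pi / a) * C \<le> C * (sqrt (pi / (a / 4)) * exp (k\<^sup>2 / (4 * (a / 4))))"
      by (simp add: mult_ac)
  qed
  also have "\<dots> = (\<integral>\<^sup>+x. ennreal C * ennreal (exp (- (a / 4) * x\<^sup>2 + k * x)) \<partial>lborel)"
    by (subst nn_integral_cmult) (simp, subst nn_integral_gaussian, use a in \<open>simp_all add: C_def ennreal_mult'\<close>)
  also have "\<dots> \<le> (\<integral>\<^sup>+x. ennreal (exp (r - a * ((h + 1 * x) - h)\<^sup>2 / 4 + \<theta> * ((h + 1 * x) - b0)\<^sup>2)) \<partial>lborel)"
  proof (rule nn_integral_mono)
    fix x :: real
    have "r + \<theta> * (h - b0)\<^sup>2 + (- (a / 4) * x\<^sup>2 + k * x) \<le> r - a * ((h + 1 * x) - h)\<^sup>2 / 4 + \<theta> * ((h + 1 * x) - b0)\<^sup>2"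
      using \<theta> by (simp add: k_def power2_eq_square algebra_simps)
    then have "C * exp (- (a / 4) * x\<^sup>2 + k * x) \<le> exp (r - a * ((h + 1 * x) - h)\<^sup>2 / 4 + \<theta> * ((h + 1 * x) - b0)\<^sup>2)"
      unfolding C_def exp_add[symmetric] by (simp only: exp_le_cancel_iff)
    then show "ennreal C * ennreal (exp (- (a / 4) * x\<^sup>2 + k * x))
        \<le> ennreal (exp (r - a * ((h + 1 * x) - h)\<^sup>2 / 4 + \<theta> * ((h + 1 * x) - b0)\<^sup>2))"
      by (subst ennreal_mult'[symmetric]) (auto simp: C_def intro: ennreal_leI)
  qed
  also have "\<dots> = (\<integral>\<^sup>+b. ennreal (exp (r - a * (b - h)\<^sup>2 / 4 + \<theta> * (b - b0)\<^sup>2)) \<partial>lborel)"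
    by (subst nn_integral_real_affine[where c = 1 and t = h]) simp_all
  finally show ?thesis by (simp add: C_def)
qed

text \<open>The exponent that arises is m d^2 / (1 + m), which is the minimum over w of m (d + w)^2
  + w^2, attained at w = - m d / (1 + m). Stating the lower bound for every w keeps the eigenvalues
  out of it, so that it can be checked with vectors and norms.\<close>

lemma (in prob_space) gaussian_tilt_expectation:
  assumes g: "std_gaussian_family M n \<xi>" and m: "\<And>j. j < n \<Longrightarrow> 0 < m j"
    and low: "\<And>w. E \<le> (\<Sum>j<n. m j * (d j + w j)\<^sup>2 + (w j)\<^sup>2)"
  shows "(\<integral>\<^sup>+\<omega>. ennreal (exp (- ((\<Sum>j<n. m j * (\<xi> j \<omega> + d j)\<^sup>2) - (\<Sum>j<n. (\<xi> j \<omega>)\<^sup>2)) / 4)) \<partial>M)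
    \<le> ennreal ((\<Prod>j<n. sqrt (2 / (1 + m j))) * exp (- E / 4))"
proof -
  have "(\<Sum>j<n. m j / (1 + m j) * (d j)\<^sup>2) = (\<Sum>j<n. m j * (d j + - (m j / (1 + m j)) * d j)\<^sup>2 + (- (m j / (1 + m j)) * d j)\<^sup>2)"
  proof (rule sum.cong[OF refl])
    fix j assume "j \<in> {..<n}"
    then have "0 < 1 + m j" using m[of j] by simp
    then show "m j / (1 + m j) * (d j)\<^sup>2 = m j * (d j + - (m j / (1 + m j)) * d j)\<^sup>2 + (- (m j / (1 + m j)) * d j)\<^sup>2"
      by (simp add: divide_simps power2_eq_square) (simp add: algebra_simps)
  qed
  then have E: "E \<le> (\<Sum>j<n. m j / (1 + m j) * (d j)\<^sup>2)"
    using low[of "\<lambda>j. - (m j / (1 + m j)) * d j"] by simp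
  have "(\<integral>\<^sup>+\<omega>. ennreal (exp (- ((\<Sum>j<n. m j * (\<xi> j \<omega> + d j)\<^sup>2) - (\<Sum>j<n. (\<xi> j \<omega>)\<^sup>2)) / 4)) \<partial>M)
      = (\<integral>\<^sup>+\<omega>. (\<Prod>j<n. ennreal (exp (- (m j * (\<xi> j \<omega> + d j)\<^sup>2 - (\<xi> j \<omega>)\<^sup>2) / 4))) \<partial>M)"
  proof (rule nn_integral_cong)
    fix \<omega>
    have "- ((\<Sum>j<n. m j * (\<xi> j \<omega> + d j)\<^sup>2) - (\<Sum>j<n. (\<xi> j \<omega>)\<^sup>2)) / 4
        = (\<Sum>j<n. - (m j * (\<xi> j \<omega> + d j)\<^sup>2 - (\<xi> j \<omega>)\<^sup>2) / 4)"
      by (simp add: sum_subtractf sum_negf flip: sum_divide_distrib)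
    then show "ennreal (exp (- ((\<Sum>j<n. m j * (\<xi> j \<omega> + d j)\<^sup>2) - (\<Sum>j<n. (\<xi> j \<omega>)\<^sup>2)) / 4))
        = (\<Prod>j<n. ennreal (exp (- (m j * (\<xi> j \<omega> + d j)\<^sup>2 - (\<xi> j \<omega>)\<^sup>2) / 4)))"
      by (simp only: exp_sum prod_ennreal finite_lessThan exp_ge_zero)
  qed
  also have "\<dots> = (\<Prod>j<n. \<integral>\<^sup>+x. ennreal (exp (- (m j * (x + d j)\<^sup>2 - x\<^sup>2) / 4)) * ennreal (std_normal_density x) \<partial>lborel)"
    by (rule std_gaussian_family_nn_integral_prod[OF g]) measurable
  also have "\<dots> = (\<Prod>j<n. ennreal (sqrt (2 / (1 + m j)) * exp (- (m j / (1 + m j) * (d j)\<^sup>2) / 4)))"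
    by (rule prod.cong[OF refl], rule nn_integral_gaussian_tilt) (use m in auto)
  also have "\<dots> = ennreal (\<Prod>j<n. sqrt (2 / (1 + m j)) * exp (- (m j / (1 + m j) * (d j)\<^sup>2) / 4))"
    by (rule prod_ennreal) (use m in \<open>auto intro!: mult_nonneg_nonneg simp: less_imp_le add_nonneg_nonneg\<close>)
  also have "(\<Prod>j<n. sqrt (2 / (1 + m j)) * exp (- (m j / (1 + m j) * (d j)\<^sup>2) / 4))
      = (\<Prod>j<n. sqrt (2 / (1 + m j))) * exp (- (\<Sum>j<n. m j / (1 + m j) * (d j)\<^sup>2) / 4)"
  proof -
    have "(\<Prod>j<n. exp (- (m j / (1 + m j) * (d j)\<^sup>2) / 4)) = exp (- (\<Sum>j<n. m j / (1 + m j) * (d j)\<^sup>2) / 4)"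
      by (simp only: exp_sum[symmetric] finite_lessThan sum_divide_distrib[symmetric] sum_negf)
    then show ?thesis by (simp only: prod.distrib)
  qed
  also have "ennreal \<dots> \<le> ennreal ((\<Prod>j<n. sqrt (2 / (1 + m j))) * exp (- E / 4))"
    using E m by (intro ennreal_leI mult_left_mono prod_nonneg) (auto simp: less_imp_le add_nonneg_nonneg)
  finally show ?thesis .
qed

text \<open>The minimum over the slope is replaced by an integral over it, which costs only the
  factor \<open>sqrt (2 * a / e1)\<close>; weighting the integral by the convex function
  \<open>b \<mapsto> exp (e1 * (b - b0)\<^sup>2 / 8)\<close> additionally records how far the minimizer is from \<open>b0\<close>.\<close>

lemma (in prob_space) profile_deviation_tail:
  fixes \<xi> :: "nat \<Rightarrow> 'a \<Rightarrow> real" and c v m :: "nat \<Rightarrow> real"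
    and n :: nat
  defines "G \<equiv> \<lambda>\<omega> b. \<Sum>j<n. m j * (\<xi> j \<omega> + c j - b * v j)\<^sup>2"
    and "h \<equiv> \<lambda>\<omega>. (\<Sum>j<n. m j * v j * (\<xi> j \<omega> + c j)) / (\<Sum>j<n. m j * (v j)\<^sup>2)"
  assumes g: "std_gaussian_family M n \<xi>" and m: "\<And>j. j < n \<Longrightarrow> 0 < m j"
    and a: "0 < (\<Sum>j<n. m j * (v j)\<^sup>2)" "(\<Sum>j<n. m j * (v j)\<^sup>2) \<le> a" and e1: "0 < e1" and t: "0 \<le> t"
    and low: "\<And>b w. e0 + e1 * (b - b0)\<^sup>2 \<le> (\<Sum>j<n. m j * (c j - b * v j + w j)\<^sup>2 + (w j)\<^sup>2)"
  shows "prob {\<omega> \<in> space M. G \<omega> (h \<omega>) \<le> (\<Sum>j<n. (\<xi> j \<omega>)\<^sup>2) \<and> t \<le> \<bar>h \<omega> - b0\<bar>}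
    \<le> sqrt (2 * a / e1) * (\<Prod>j<n. sqrt (2 / (1 + m j))) * exp (- e0 / 4 - e1 * t\<^sup>2 / 8)"
proof -
  have [measurable]: "j < n \<Longrightarrow> \<xi> j \<in> borel_measurable M" for j
    using std_gaussian_family_measurable[OF g] .
  define a' where "a' = (\<Sum>j<n. m j * (v j)\<^sup>2)"
  have a': "0 < a'" "a' \<le> a" using a by (simp_all add: a'_def)
  define P where "P = (\<Prod>j<n. sqrt (2 / (1 + m j)))"
  have P: "0 \<le> P" unfolding P_def using m by (intro prod_nonneg) (auto simp: less_imp_le add_nonneg_nonneg)
  define Z where "Z \<omega> = (\<Sum>j<n. (\<xi> j \<omega>)\<^sup>2)" for \<omega>
  \<comment> \<open>The moment at 1/4 provides the decay e1 (b - b0)^2 / 4. Half of it pays for the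
    weight, the other half keeps the integral over b finite.\<close>
  define \<theta> where "\<theta> = e1 / 8"
  let ?F = "\<lambda>\<omega>. sqrt (4 * pi / a') * exp (- (G \<omega> (h \<omega>) - Z \<omega>) / 4 + \<theta> * (h \<omega> - b0)\<^sup>2)"
  let ?I = "\<lambda>\<omega> b. exp (- (G \<omega> b - Z \<omega>) / 4 + \<theta> * (b - b0)\<^sup>2)"
  let ?A = "{\<omega> \<in> space M. G \<omega> (h \<omega>) \<le> (\<Sum>j<n. (\<xi> j \<omega>)\<^sup>2) \<and> t \<le> \<bar>h \<omega> - b0\<bar>}"
  have [measurable]: "Z \<in> borel_measurable M" "h \<in> borel_measurable M" "(\<lambda>\<omega>. G \<omega> (h \<omega>)) \<in> borel_measurable M"
    unfolding Z_def h_def G_def by measurable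
  \<comment> \<open>As a function of the slope, G is a parabola with vertex h and curvature
    a'.\<close>
  have quad: "G \<omega> b = G \<omega> (h \<omega>) + a' * (b - h \<omega>)\<^sup>2" for \<omega> b
  proof -
    define p where "p = (\<Sum>j<n. m j * (\<xi> j \<omega> + c j)\<^sup>2)"
    define q where "q = (\<Sum>j<n. m j * v j * (\<xi> j \<omega> + c j))"
    have G: "G \<omega> b = p - 2 * b * q + b\<^sup>2 * a'" for b
      unfolding G_def p_def q_def a'_def sum_distrib_left sum_subtractf[symmetric] sum.distrib[symmetric]
      by (rule sum.cong) (auto simp: power2_eq_square algebra_simps)
    have "h \<omega> * a' = q" using a' by (simp add: h_def q_def a'_def)
    then show ?thesis unfolding G by (auto simp: power2_eq_square algebra_simps)
  qed
  have [measurable]: "case_prod (\<lambda>\<omega> b. ennreal (?I \<omega> b)) \<in> borel_measurable (M \<Otimes>\<^sub>M lborel)"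
  proof -
    define G0 where "G0 \<omega> = G \<omega> (h \<omega>)" for \<omega>
    have [measurable]: "G0 \<in> borel_measurable M" by (simp add: G0_def[abs_def])
    have "G \<omega> b = G0 \<omega> + a' * (b - h \<omega>)\<^sup>2" for \<omega> b by (simp only: G0_def quad[of \<omega> b])
    then show ?thesis by simp
  qed
  interpret pair_sigma_finite M lborel ..
  have "(\<integral>\<^sup>+\<omega>. ennreal (?F \<omega>) \<partial>M)
      \<le> (\<integral>\<^sup>+\<omega>. \<integral>\<^sup>+b. ennreal (?I \<omega> b) \<partial>lborel \<partial>M)"
  proof (rule nn_integral_mono)
    fix \<omega>
    have \<theta>0: "0 \<le> \<theta>" using e1 by (simp add: \<theta>_def)
    have eq: "- (G \<omega> (h \<omega>) - Z \<omega>) / 4 - a' * (b - h \<omega>)\<^sup>2 / 4 = - (G \<omega> b - Z \<omega>) / 4" for b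
      by (subst quad[of \<omega> b]) (simp add: field_simps)
    show "ennreal (?F \<omega>)
        \<le> (\<integral>\<^sup>+b. ennreal (?I \<omega> b) \<partial>lborel)"
      using gaussian_profile_le_integral[OF a'(1) \<theta>0, of "- (G \<omega> (h \<omega>) - Z \<omega>) / 4" "h \<omega>" b0]
      by (simp only: eq)
  qed
  also have "\<dots> = (\<integral>\<^sup>+b. \<integral>\<^sup>+\<omega>. ennreal (?I \<omega> b) \<partial>M \<partial>lborel)"
    by (rule Fubini'[symmetric]) measurable
  also have "\<dots> \<le> (\<integral>\<^sup>+b. ennreal (P * exp (- e0 / 4)) * ennreal (exp (- (e1 / 8) * (b - b0)\<^sup>2)) \<partial>lborel)"
  proof (rule nn_integral_mono)
    fix b
    have [measurable]: "(\<lambda>\<omega>. G \<omega> b) \<in> borel_measurable M" unfolding G_def by measurable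
    have G: "G \<omega> b = (\<Sum>j<n. m j * (\<xi> j \<omega> + (c j - b * v j))\<^sup>2)" for \<omega>
      by (simp add: G_def algebra_simps)
    have "(\<integral>\<^sup>+\<omega>. ennreal (?I \<omega> b) \<partial>M)
        = ennreal (exp (\<theta> * (b - b0)\<^sup>2)) * (\<integral>\<^sup>+\<omega>. ennreal (exp (- (G \<omega> b - Z \<omega>) / 4)) \<partial>M)"
      by (subst nn_integral_cmult[symmetric]) (simp_all add: ennreal_mult'[symmetric] exp_add mult.commute)
    also have "\<dots> \<le> ennreal (exp (\<theta> * (b - b0)\<^sup>2)) * ennreal (P * exp (- (e0 + e1 * (b - b0)\<^sup>2) / 4))"
      unfolding G Z_def P_def
      by (intro mult_left_mono gaussian_tilt_expectation[OF g m low]) simp_all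
    also have "\<dots> = ennreal (P * exp (- e0 / 4)) * ennreal (exp (- (e1 / 8) * (b - b0)\<^sup>2))"
    proof -
      have "exp (\<theta> * (b - b0)\<^sup>2) * exp (- (e0 + e1 * (b - b0)\<^sup>2) / 4) = exp (- e0 / 4) * exp (- (e1 / 8) * (b - b0)\<^sup>2)"
        unfolding exp_add[symmetric] \<theta>_def by (rule arg_cong[where f = exp]) (simp add: field_simps)
      then show ?thesis using P by (simp add: ennreal_mult'[symmetric] mult_ac)
    qed
    finally show "(\<integral>\<^sup>+\<omega>. ennreal (?I \<omega> b) \<partial>M)
        \<le> ennreal (P * exp (- e0 / 4)) * ennreal (exp (- (e1 / 8) * (b - b0)\<^sup>2))" .
  qed
  also have "\<dots> = ennreal (P * exp (- e0 / 4)) * (\<integral>\<^sup>+b. ennreal (exp (- (e1 / 8) * (b - b0)\<^sup>2)) \<partial>lborel)"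
    by (rule nn_integral_cmult) simp
  also have "(\<integral>\<^sup>+b. ennreal (exp (- (e1 / 8) * (b - b0)\<^sup>2)) \<partial>lborel) = (\<integral>\<^sup>+x. ennreal (exp (- (e1 / 8) * x\<^sup>2 + 0 * x)) \<partial>lborel)"
    by (subst nn_integral_real_affine[where c = 1 and t = b0]) simp_all
  also have "\<dots> = ennreal (sqrt (8 * pi / e1))"
    using e1 by (subst nn_integral_gaussian) (simp_all add: mult.commute)
  finally have main: "(\<integral>\<^sup>+\<omega>. ennreal (?F \<omega>) \<partial>M)
      \<le> ennreal (P * exp (- e0 / 4) * sqrt (8 * pi / e1))"
    using P by (simp add: ennreal_mult')
  \<comment> \<open>Normalization for Markov: on the event, where the deviation of h is at least t,
    k times the integrand is at least 1.\<close>
  define k where "k = exp (- \<theta> * t\<^sup>2) / sqrt (4 * pi / a')"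
  have k: "0 \<le> k" using a' by (simp add: k_def)
  have sq: "0 < sqrt (4 * pi / a')" using a' by simp
  have rhs: "k * (P * exp (- e0 / 4) * sqrt (8 * pi / e1)) \<le> sqrt (2 * a / e1) * P * exp (- e0 / 4 - e1 * t\<^sup>2 / 8)"
  proof -
    have r: "sqrt (8 * pi / e1) / sqrt (4 * pi / a') = sqrt (2 * a' / e1)"
      unfolding real_sqrt_divide[symmetric] using a' e1 by (simp add: field_simps)
    have "k * (P * exp (- e0 / 4) * sqrt (8 * pi / e1))
        = sqrt (8 * pi / e1) / sqrt (4 * pi / a') * P * (exp (- e0 / 4) * exp (- \<theta> * t\<^sup>2))"
      by (simp add: k_def)
    also have "\<dots> = sqrt (2 * a' / e1) * P * (exp (- e0 / 4) * exp (- \<theta> * t\<^sup>2))" unfolding r ..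
    also have "exp (- e0 / 4) * exp (- \<theta> * t\<^sup>2) = exp (- e0 / 4 - e1 * t\<^sup>2 / 8)"
      unfolding exp_add[symmetric] by (simp add: \<theta>_def)
    also have "sqrt (2 * a' / e1) * P * exp (- e0 / 4 - e1 * t\<^sup>2 / 8) \<le> sqrt (2 * a / e1) * P * exp (- e0 / 4 - e1 * t\<^sup>2 / 8)"
      using a' e1 P by (intro mult_right_mono real_sqrt_le_mono divide_right_mono) simp_all
    finally show ?thesis .
  qed
  show ?thesis
    unfolding P_def[symmetric]
  proof (rule prob_le_of_nn_integral[where F = "\<lambda>\<omega>. ennreal k * ennreal (?F \<omega>)"])
    show "?A \<in> events"
      unfolding Z_def[symmetric] by measurable
  next
    fix \<omega> assume "\<omega> \<in> ?A"
    then have 1: "G \<omega> (h \<omega>) \<le> Z \<omega>" and 2: "t \<le> \<bar>h \<omega> - b0\<bar>" by (auto simp: Z_def)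
    have "t\<^sup>2 \<le> (h \<omega> - b0)\<^sup>2" using 2 t by (metis power2_abs power_mono)
    then have "\<theta> * t\<^sup>2 \<le> \<theta> * (h \<omega> - b0)\<^sup>2" using e1 by (simp add: \<theta>_def)
    moreover have "0 \<le> - (G \<omega> (h \<omega>) - Z \<omega>) / 4" using 1 by simp
    ultimately have "0 \<le> - \<theta> * t\<^sup>2 + (- (G \<omega> (h \<omega>) - Z \<omega>) / 4 + \<theta> * (h \<omega> - b0)\<^sup>2)" by linarith
    then have "1 \<le> exp (- \<theta> * t\<^sup>2 + (- (G \<omega> (h \<omega>) - Z \<omega>) / 4 + \<theta> * (h \<omega> - b0)\<^sup>2))" by simp
    also have "\<dots> = k * (?F \<omega>)"
      unfolding exp_add[of "- \<theta> * t\<^sup>2"] using sq a' by (simp add: k_def)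
    finally show "1 \<le> ennreal k * ennreal (?F \<omega>)"
      using k by (subst ennreal_mult'[symmetric]) (simp_all flip: ennreal_1)
  next
    have "(\<integral>\<^sup>+\<omega>. ennreal k * ennreal (?F \<omega>) \<partial>M)
        = ennreal k * (\<integral>\<^sup>+\<omega>. ennreal (?F \<omega>) \<partial>M)"
      by (rule nn_integral_cmult) measurable
    also have "\<dots> \<le> ennreal k * ennreal (P * exp (- e0 / 4) * sqrt (8 * pi / e1))"
      by (rule mult_left_mono[OF main]) simp
    also have "\<dots> = ennreal (k * (P * exp (- e0 / 4) * sqrt (8 * pi / e1)))"
      using k by (rule ennreal_mult'[symmetric])
    also have "\<dots> \<le> ennreal (sqrt (2 * a / e1) * P * exp (- e0 / 4 - e1 * t\<^sup>2 / 8))"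
      by (rule ennreal_leI[OF rhs])
    finally show "(\<integral>\<^sup>+\<omega>. ennreal k * ennreal (?F \<omega>) \<partial>M)
        \<le> ennreal (sqrt (2 * a / e1) * P * exp (- e0 / 4 - e1 * t\<^sup>2 / 8))" .
  next
    show "0 \<le> sqrt (2 * a / e1) * P * exp (- e0 / 4 - e1 * t\<^sup>2 / 8)" using P a' e1 by simp
  qed
qed

text \<open>Conditioning by Fubini: the joint law is a product, so a bound that is uniform over
  frozen values of U survives integration over U.\<close>

lemma (in prob_space) indep_var_conditional_bound:
  assumes ind: "indep_var S U T V" and E[measurable]: "E \<in> sets (S \<Otimes>\<^sub>M T)"
    and bound: "\<And>x. x \<in> space S \<Longrightarrow> prob {\<omega> \<in> space M. (x, V \<omega>) \<in> E} \<le> p" and p: "0 \<le> p"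
  shows "prob {\<omega> \<in> space M. (U \<omega>, V \<omega>) \<in> E} \<le> p"
proof -
  have U[measurable]: "U \<in> measurable M S" and V[measurable]: "V \<in> measurable M T"
    and d: "distr M S U \<Otimes>\<^sub>M distr M T V = distr M (S \<Otimes>\<^sub>M T) (\<lambda>x. (U x, V x))"
    using ind unfolding indep_var_distribution_eq by auto
  interpret DU: prob_space "distr M S U" by (rule prob_space_distr[OF U])
  interpret DV: prob_space "distr M T V" by (rule prob_space_distr[OF V])
  have E': "E \<in> sets (distr M S U \<Otimes>\<^sub>M distr M T V)" by (simp cong: sets_pair_measure_cong)
  have "emeasure M {\<omega> \<in> space M. (U \<omega>, V \<omega>) \<in> E} = emeasure (distr M (S \<Otimes>\<^sub>M T) (\<lambda>x. (U x, V x))) E"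
    by (subst emeasure_distr) (auto intro!: arg_cong[where f = "emeasure M"])
  also have "\<dots> = (\<integral>\<^sup>+x. emeasure (distr M T V) (Pair x -` E) \<partial>distr M S U)"
    unfolding d[symmetric] by (rule DV.emeasure_pair_measure_alt[OF E'])
  also have "\<dots> \<le> (\<integral>\<^sup>+x. ennreal p \<partial>distr M S U)"
  proof (rule nn_integral_mono)
    fix x assume "x \<in> space (distr M S U)"
    then have x: "x \<in> space S" by simp
    have "Pair x -` E \<in> sets T" by (rule sets_Pair1[OF E])
    then have "emeasure (distr M T V) (Pair x -` E) = emeasure M {\<omega> \<in> space M. (x, V \<omega>) \<in> E}"
      by (subst emeasure_distr) (auto intro!: arg_cong[where f = "emeasure M"])
    also have "\<dots> \<le> ennreal p" using bound[OF x] by (simp add: emeasure_eq_measure p)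
    finally show "emeasure (distr M T V) (Pair x -` E) \<le> ennreal p" .
  qed
  also have "\<dots> = ennreal p" using DU.emeasure_space_1 by simp
  finally show ?thesis using p by (simp add: emeasure_eq_measure)
qed

lemma (in prob_space) centered_normal_second_moment:
  assumes X[measurable]: "X \<in> borel_measurable M" and d: "distr M borel X = centered_normal v" and v: "0 \<le> v"
  shows "(\<integral>\<^sup>+\<omega>. ennreal ((X \<omega>)\<^sup>2) \<partial>M) = ennreal v"
proof -
  have "(\<integral>\<^sup>+\<omega>. ennreal ((X \<omega>)\<^sup>2) \<partial>M) = (\<integral>\<^sup>+x. ennreal (x\<^sup>2) \<partial>distr M borel X)"
    by (simp add: nn_integral_distr)
  also have "\<dots> = ennreal v"
  proof (cases "v = 0")
    case True
    then show ?thesis by (simp add: d centered_normal_def nn_integral_return)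
  next
    case False
    with v have v: "0 < v" by simp
    have "(\<integral>\<^sup>+x. ennreal (x\<^sup>2) \<partial>distr M borel X)
        = (\<integral>\<^sup>+x. ennreal (normal_density 0 (sqrt v) x * (x - 0) ^ (2 * 1)) \<partial>lborel)"
      unfolding d centered_normal_def using v
      by (simp add: nn_integral_density ennreal_mult')
    also have "\<dots> = ennreal (fact (2 * 1) / ((2 / (sqrt v)\<^sup>2) ^ 1 * fact 1))"
      using normal_moment_even[of "sqrt v" 0 1] v
      by (intro nn_integral_eq_integral[THEN trans])
        (auto simp: has_bochner_integral_iff normal_density_nonneg fact_numeral)
    also have "\<dots> = ennreal v" using v by (simp add: fact_numeral)
    finally show ?thesis .
  qed
  finally show ?thesis .
qed

subsection \<open>Generalized least squares with permuted noise\<close>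

definition vperm :: "nat \<Rightarrow> (nat \<Rightarrow> nat) \<Rightarrow> real vec \<Rightarrow> real vec" where
  "vperm n q x = vec n (\<lambda>i. x $ q i)"

lemma vperm_carrier [simp]: "vperm n q x \<in> carrier_vec n"
  by (simp add: vperm_def)

lemma vperm_scalar_prod:
  assumes q: "q permutes {..<n}" and "y \<in> carrier_vec n"
  shows "vperm n q x \<bullet> vperm n q y = x \<bullet> y"
proof -
  have "vperm n q x \<bullet> vperm n q y = (\<Sum>i<n. x $ q i * y $ q i)"
    by (simp add: vperm_def scalar_prod_def lessThan_atLeast0)
  also have "\<dots> = (\<Sum>i<n. x $ i * y $ i)"
    using sum.permute[OF q, of "\<lambda>i. x $ i * y $ i"] by (simp add: o_def)
  finally show ?thesis using assms by (simp add: scalar_prod_def lessThan_atLeast0)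
qed

lemma vperm_add_smult:
  assumes q: "q permutes {..<n}" and xy: "x \<in> carrier_vec n" "y \<in> carrier_vec n"
  shows "vperm n q (x + b \<cdot>\<^sub>v y) = vperm n q x + b \<cdot>\<^sub>v vperm n q y"
  using xy permutes_in_image[OF q] by (intro eq_vecI) (auto simp: vperm_def)

text \<open>Permuting indices is contravariant. This reversal fixes the order of composition in
  \<open>relX\<close> and in the coding of the candidates.\<close>

lemma vperm_vperm:
  assumes q: "q permutes {..<n}"
  shows "vperm n q (vperm n r x) = vperm n (r \<circ> q) x"
  using permutes_in_image[OF q] by (intro eq_vecI) (auto simp: vperm_def)

definition perm_mat :: "nat \<Rightarrow> (nat \<Rightarrow> nat) \<Rightarrow> real mat" where
  "perm_mat n q = mat n n (\<lambda>(i, j). if j = q i then 1 else 0)"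

lemma perm_mat_carrier [simp]: "perm_mat n q \<in> carrier_mat n n"
  and perm_mat_dim [simp]: "dim_row (perm_mat n q) = n" "dim_col (perm_mat n q) = n"
  by (simp_all add: perm_mat_def)

lemma perm_mat_mult_vec:
  assumes q: "q permutes {..<n}" and x: "x \<in> carrier_vec n"
  shows "perm_mat n q *\<^sub>v x = vperm n q x"
proof (rule eq_vecI)
  fix i assume "i < dim_vec (vperm n q x)"
  then have i: "i < n" by (simp add: vperm_def)
  then have qi: "q i < n" using permutes_in_image[OF q, of i] by simp
  have "(perm_mat n q *\<^sub>v x) $ i = (\<Sum>j = 0..<n. (if j = q i then 1 else 0) * x $ j)"
    using i x by (simp add: perm_mat_def scalar_prod_def)
  also have "\<dots> = (\<Sum>j = 0..<n. if j = q i then x $ j else 0)"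
    by (rule sum.cong) auto
  finally show "(perm_mat n q *\<^sub>v x) $ i = vperm n q x $ i" using i qi by (simp add: vperm_def)
qed (simp add: perm_mat_def vperm_def)

text \<open>The sign of the permutation drops out of the square, which is what the determinant of a
  Gram matrix needs.\<close>

lemma perm_mat_det_sq:
  assumes q: "q permutes {..<n}"
  shows "det (perm_mat n q) * det (perm_mat n q) = 1"
proof -
  have "perm_mat n q * transpose_mat (perm_mat n q) = 1\<^sub>m n"
  proof (rule eq_matI)
    fix i j assume "i < dim_row (1\<^sub>m n :: real mat)" "j < dim_col (1\<^sub>m n :: real mat)"
    then have ij: "i < n" "j < n" by auto
    then have qi: "q i < n" using permutes_in_image[OF q, of i] by simp
    have "(perm_mat n q * transpose_mat (perm_mat n q)) $$ (i, j)
        = (\<Sum>k = 0..<n. (if k = q i then 1 else 0) * (if k = q j then 1 else 0))"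
      using ij by (simp add: perm_mat_def scalar_prod_def)
    also have "\<dots> = (\<Sum>k = 0..<n. if k = q i then (if q i = q j then 1 else 0) else 0)"
      by (rule sum.cong) auto
    also have "\<dots> = (if i = j then 1 else 0)"
      using qi permutes_inj[OF q] by (auto simp: inj_eq)
    finally show "(perm_mat n q * transpose_mat (perm_mat n q)) $$ (i, j) = 1\<^sub>m n $$ (i, j)" using ij by simp
  qed (simp_all add: perm_mat_def)
  then have "det (perm_mat n q) * det (transpose_mat (perm_mat n q)) = 1"
    using det_mult[of "perm_mat n q" n "transpose_mat (perm_mat n q)"] by (simp add: perm_mat_def)
  then show ?thesis by (simp add: det_transpose[OF perm_mat_carrier])
qed

text \<open>With Q the permutation matrix of q and L = R Q R^-1, one has R Q v = L (R v). The data
  are an orthonormal eigenbasis of L^T L with its eigenvalues: \<open>m j\<close> are the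
  eigenvalues of the precision matrix conjugated by Q, relative to the original one. They multiply
  to 1 because R and R^-1 cancel in det L and det Q is 1 or -1.\<close>

definition gls_basis :: "nat \<Rightarrow> real mat \<Rightarrow> (nat \<Rightarrow> nat) \<Rightarrow> (nat \<Rightarrow> real vec) \<Rightarrow> (nat \<Rightarrow> real) \<Rightarrow> bool" where
  "gls_basis n R q e m \<longleftrightarrow> (\<forall>j<n. e j \<in> carrier_vec n) \<and>
     (\<forall>i<n. \<forall>j<n. e i \<bullet> e j = (if i = j then 1 else 0)) \<and>
     (\<forall>v \<in> carrier_vec n. \<forall>w \<in> carrier_vec n. v \<bullet> w = (\<Sum>j<n. (e j \<bullet> v) * (e j \<bullet> w))) \<and>
     (\<forall>v \<in> carrier_vec n. \<forall>w \<in> carrier_vec n. (R *\<^sub>v vperm n q v) \<bullet> (R *\<^sub>v vperm n q w)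
        = (\<Sum>j<n. m j * ((e j \<bullet> (R *\<^sub>v v)) * (e j \<bullet> (R *\<^sub>v w))))) \<and>
     (\<forall>j<n. 0 < m j) \<and> (\<Prod>j<n. m j) = 1"

lemma inv_sqrt_mat_inverse:
  assumes S: "pos_def_mat n S"
  defines "R \<equiv> inv_sqrt_mat S"
  shows "R \<in> carrier_mat n n" "transpose_mat R = R" "S * R \<in> carrier_mat n n"
    "R * (S * R) = 1\<^sub>m n" "(S * R) * R = 1\<^sub>m n"
proof -
  have Sc: "S \<in> carrier_mat n n" using S by (simp add: pos_def_mat_def)
  show Rc: "R \<in> carrier_mat n n" and "transpose_mat R = R"
    using inv_sqrt_mat_pos_def(1)[OF S] by (auto simp: pos_def_mat_def R_def)
  show SR: "S * R \<in> carrier_mat n n" using Sc Rc by simp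
  show e: "(S * R) * R = 1\<^sub>m n"
    using inv_sqrt_mat_pos_def(3)[OF S] assoc_mult_mat[OF Sc Rc Rc] by (simp add: R_def)
  show "R * (S * R) = 1\<^sub>m n" by (rule mat_mult_left_right_inverse[OF SR Rc e])
qed

lemma gls_basis_exists:
  assumes S: "pos_def_mat n S" and q: "q permutes {..<n}"
  shows "\<exists>e m. gls_basis n (inv_sqrt_mat S) q e m"
proof -
  define R where "R = inv_sqrt_mat S"
  \<comment> \<open>Since R is the inverse square root of S, the product S R is the inverse of
    R.\<close>
  define T where "T = S * R"
  note R = inv_sqrt_mat_inverse[OF S, folded R_def, folded T_def]
  define G where "G = perm_mat n q"
  have G: "G \<in> carrier_mat n n" by (simp add: G_def)
  define L where "L = R * (G * T)"
  have GT: "G * T \<in> carrier_mat n n" using G R(3) by (rule mult_carrier_mat)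
  have L: "L \<in> carrier_mat n n" unfolding L_def using R(1) GT by (rule mult_carrier_mat)
  define A where "A = transpose_mat L * L"
  have Lt: "transpose_mat L \<in> carrier_mat n n" using L by simp
  have A: "A \<in> carrier_mat n n" unfolding A_def using Lt L by (rule mult_carrier_mat)
  have At: "transpose_mat A = A" unfolding A_def using transpose_mult[OF Lt L] by simp
  have LR: "L *\<^sub>v (R *\<^sub>v v) = R *\<^sub>v vperm n q v" if v: "v \<in> carrier_vec n" for v
  proof -
    have Rv: "R *\<^sub>v v \<in> carrier_vec n" using R(1) v by simp
    have "L *\<^sub>v (R *\<^sub>v v) = R *\<^sub>v (G *\<^sub>v (T *\<^sub>v (R *\<^sub>v v)))"
      unfolding L_def using assoc_mult_mat_vec[OF R(1) GT Rv] assoc_mult_mat_vec[OF G R(3) Rv] by simp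
    also have "T *\<^sub>v (R *\<^sub>v v) = v"
      using assoc_mult_mat_vec[OF R(3) R(1) v] R(5) v by simp
    finally show ?thesis by (simp add: G_def perm_mat_mult_vec[OF q v])
  qed
  have quad: "(L *\<^sub>v x) \<bullet> (L *\<^sub>v y) = x \<bullet> (A *\<^sub>v y)" if x: "x \<in> carrier_vec n" and y: "y \<in> carrier_vec n" for x y
  proof -
    have Ly: "L *\<^sub>v y \<in> carrier_vec n" using L y by simp
    have "(L *\<^sub>v x) \<bullet> (L *\<^sub>v y) = x \<bullet> (transpose_mat L *\<^sub>v (L *\<^sub>v y))"
      using transpose_vec_mult_scalar[OF Lt Ly x] by simp
    then show ?thesis unfolding A_def using assoc_mult_mat_vec[OF Lt L y] by simp
  qed
  obtain e m where e: "\<And>j. j < n \<Longrightarrow> e j \<in> carrier_vec n"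
    and on: "\<And>i j. i < n \<Longrightarrow> j < n \<Longrightarrow> e i \<bullet> e j = (if i = j then 1 else 0)"
    and ev: "\<And>j. j < n \<Longrightarrow> A *\<^sub>v e j = m j \<cdot>\<^sub>v e j"
    and pars: "\<And>v w. v \<in> carrier_vec n \<Longrightarrow> w \<in> carrier_vec n \<Longrightarrow> v \<bullet> w = (\<Sum>j<n. (e j \<bullet> v) * (e j \<bullet> w))"
    and det: "det A = (\<Prod>j<n. m j)"
    by (rule symmetric_spectral_basis[OF A At]) blast
  have "det A = 1"
  proof -
    have dA: "det A = det L * det L"
      unfolding A_def using det_mult[OF Lt L] det_transpose[OF L] by simp
    have dL: "det L = det R * (det G * det T)"
      unfolding L_def using det_mult[OF R(1) GT] det_mult[OF G R(3)] by simp
    have "det R * det T = 1" using det_mult[OF R(1) R(3)] R(4) by simp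
    moreover have "det G * det G = 1" unfolding G_def by (rule perm_mat_det_sq[OF q])
    moreover have "det A = (det R * det T) * (det R * det T) * (det G * det G)"
      unfolding dA dL by (simp only: mult_ac)
    ultimately show ?thesis by simp
  qed
  with det have prod: "(\<Prod>j<n. m j) = 1" by simp
  have "0 < m j" if j: "j < n" for j
  proof -
    \<comment> \<open>Nonzero because the product is 1, nonnegative as the squared length of L
      applied to \<open>e j\<close>.\<close>
    have "m j \<noteq> 0" using prod j by (metis finite_lessThan lessThan_iff prod_zero_iff zero_neq_one)
    moreover have "(L *\<^sub>v e j) \<bullet> (L *\<^sub>v e j) = m j"
      using quad[OF e[OF j] e[OF j]] ev[OF j] on[OF j j] e[OF j] by simp
    ultimately show ?thesis using scalar_prod_self_nonneg[of "L *\<^sub>v e j"] by simp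
  qed
  moreover have "(R *\<^sub>v vperm n q v) \<bullet> (R *\<^sub>v vperm n q w) = (\<Sum>j<n. m j * ((e j \<bullet> (R *\<^sub>v v)) * (e j \<bullet> (R *\<^sub>v w))))"
    if v: "v \<in> carrier_vec n" and w: "w \<in> carrier_vec n" for v w
  proof -
    have Rv: "R *\<^sub>v v \<in> carrier_vec n" and Rw: "R *\<^sub>v w \<in> carrier_vec n" using R(1) v w by simp_all
    have "(R *\<^sub>v vperm n q v) \<bullet> (R *\<^sub>v vperm n q w) = (R *\<^sub>v v) \<bullet> (A *\<^sub>v (R *\<^sub>v w))"
      using quad[OF Rv Rw] LR[OF v] LR[OF w] by simp
    then show ?thesis using spectral_quadratic_form[OF A At e ev pars Rv Rw] by simp
  qed
  ultimately have "gls_basis n R q e m"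
    unfolding gls_basis_def by (intro conjI ballI allI impI e on pars prod)
  then show ?thesis unfolding R_def by blast
qed

lemma inv_sqrt_mat_quadratic_form:
  assumes S: "pos_def_mat n S" and x: "x \<in> carrier_vec n"
  defines "R \<equiv> inv_sqrt_mat S"
  shows "(R *\<^sub>v x) \<bullet> (S *\<^sub>v (R *\<^sub>v x)) = x \<bullet> x"
proof -
  note R = inv_sqrt_mat_inverse[OF S, folded R_def]
  have Sc: "S \<in> carrier_mat n n" using S by (simp add: pos_def_mat_def)
  have Rx: "R *\<^sub>v x \<in> carrier_vec n" using R(1) x by simp
  have "(R *\<^sub>v x) \<bullet> (S *\<^sub>v (R *\<^sub>v x)) = x \<bullet> (R *\<^sub>v (S *\<^sub>v (R *\<^sub>v x)))"
    using symmetric_mat_swap[OF R(1,2) x, of "S *\<^sub>v (R *\<^sub>v x)"] Sc Rx by simp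
  also have "R *\<^sub>v (S *\<^sub>v (R *\<^sub>v x)) = x"
    using assoc_mult_mat_vec[OF Sc R(1) x] assoc_mult_mat_vec[OF R(1) R(3) x] R(4) x by simp
  finally show ?thesis .
qed

lemma inv_sqrt_mat_bounds:
  assumes S: "pos_def_mat n S" and n: "0 < n" and x: "x \<in> carrier_vec n"
  defines "R \<equiv> inv_sqrt_mat S"
  shows "lambda_min S * ((R *\<^sub>v x) \<bullet> (R *\<^sub>v x)) \<le> x \<bullet> x"
    and "x \<bullet> x \<le> lambda_max S * ((R *\<^sub>v x) \<bullet> (R *\<^sub>v x))"
proof -
  have "R *\<^sub>v x \<in> carrier_vec n"
    using inv_sqrt_mat_inverse(1)[OF S] x by (simp add: R_def)
  then show "lambda_min S * ((R *\<^sub>v x) \<bullet> (R *\<^sub>v x)) \<le> x \<bullet> x"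
    and "x \<bullet> x \<le> lambda_max S * ((R *\<^sub>v x) \<bullet> (R *\<^sub>v x))"
    using pos_def_mat_spectrum_bounds(3,4)[OF S n] inv_sqrt_mat_quadratic_form[OF S x]
    unfolding R_def by force+
qed

text \<open>The setting for a frozen covariate: the covariates are fixed vectors, only W is random,
  and R W is a standard normal vector.\<close>

locale gls_noise = prob_space M for M :: "'a measure" +
  fixes n :: nat and S :: "real mat" and W :: "'a \<Rightarrow> real vec"
  assumes S: "pos_def_mat n S" and n: "0 < n"
    and W: "\<And>\<omega>. \<omega> \<in> space M \<Longrightarrow> W \<omega> \<in> carrier_vec n"
    and whitened: "std_gaussian_family M n (\<lambda>j \<omega>. (inv_sqrt_mat S *\<^sub>v W \<omega>) $ j)"
begin

definition R :: "real mat" where "R = inv_sqrt_mat S"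
definition lmax :: real where "lmax = lambda_max S"
definition lmin :: real where "lmin = lambda_min S"

lemma R_carrier: "R \<in> carrier_mat n n"
  using inv_sqrt_mat_inverse(1)[OF S] by (simp add: R_def)

lemma R_vec [simp]: "R *\<^sub>v x \<in> carrier_vec n"
  using R_carrier unfolding carrier_vec_def by simp

lemma lmin_pos: "0 < lmin" and lmin_le_lmax: "lmin \<le> lmax" and lmax_pos: "0 < lmax"
  using pos_def_mat_spectrum_bounds(1,2)[OF S n] by (simp_all add: lmin_def lmax_def)

lemma R_bounds:
  assumes "x \<in> carrier_vec n"
  shows "lmin * ((R *\<^sub>v x) \<bullet> (R *\<^sub>v x)) \<le> x \<bullet> x" "x \<bullet> x \<le> lmax * ((R *\<^sub>v x) \<bullet> (R *\<^sub>v x))"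
  using inv_sqrt_mat_bounds[OF S n assms] by (simp_all add: R_def lmin_def lmax_def)

lemma R_surj:
  assumes z: "z \<in> carrier_vec n"
  obtains x where "x \<in> carrier_vec n" "R *\<^sub>v x = z"
proof -
  note R = inv_sqrt_mat_inverse[OF S, folded R_def]
  have "(S * R) *\<^sub>v z \<in> carrier_vec n" using R(3) z by simp
  moreover have "R *\<^sub>v ((S * R) *\<^sub>v z) = z"
    using assoc_mult_mat_vec[OF R(1) R(3) z] R(4) z by simp
  ultimately show ?thesis by (rule that)
qed

lemma R_add_smult:
  assumes "x \<in> carrier_vec n" "y \<in> carrier_vec n"
  shows "R *\<^sub>v (x + b \<cdot>\<^sub>v y) = R *\<^sub>v x + b \<cdot>\<^sub>v (R *\<^sub>v y)"
  using mult_add_distrib_mat_vec[OF R_carrier assms(1), of "b \<cdot>\<^sub>v y"] mult_mat_vec[OF R_carrier assms(2), of b] assms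
  by simp

context
  fixes q e m
  assumes q: "q permutes {..<n}" and basis: "gls_basis n R q e m"
begin

lemma e_carrier: "j < n \<Longrightarrow> e j \<in> carrier_vec n"
  and e_orth: "i < n \<Longrightarrow> j < n \<Longrightarrow> e i \<bullet> e j = (if i = j then 1 else 0)"
  and e_parseval: "v \<in> carrier_vec n \<Longrightarrow> w \<in> carrier_vec n \<Longrightarrow> v \<bullet> w = (\<Sum>j<n. (e j \<bullet> v) * (e j \<bullet> w))"
  and e_form: "v \<in> carrier_vec n \<Longrightarrow> w \<in> carrier_vec n \<Longrightarrow>
    (R *\<^sub>v vperm n q v) \<bullet> (R *\<^sub>v vperm n q w) = (\<Sum>j<n. m j * ((e j \<bullet> (R *\<^sub>v v)) * (e j \<bullet> (R *\<^sub>v w))))"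
  and m_pos: "j < n \<Longrightarrow> 0 < m j"
  and m_prod: "(\<Prod>j<n. m j) = 1"
  using basis unfolding gls_basis_def by blast+

lemma coord_linear:
  assumes "j < n" "x \<in> carrier_vec n" "y \<in> carrier_vec n"
  shows "e j \<bullet> (R *\<^sub>v (x + b \<cdot>\<^sub>v y)) = e j \<bullet> (R *\<^sub>v x) + b * (e j \<bullet> (R *\<^sub>v y))"
  using e_carrier[OF assms(1)] assms(2,3)
  by (simp add: R_add_smult scalar_prod_add_distrib[of _ n])

lemma coord_gaussian: "std_gaussian_family M n (\<lambda>j \<omega>. e j \<bullet> (R *\<^sub>v W \<omega>))"
proof -
  have "std_gaussian_family M n (\<lambda>j \<omega>. \<Sum>i<n. e j $ i * (inv_sqrt_mat S *\<^sub>v W \<omega>) $ i)"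
  proof (rule std_gaussian_family_orthonormal[OF whitened])
    fix k l assume kl: "k < n" "l < n"
    then have "(\<Sum>i<n. e k $ i * e l $ i) = e k \<bullet> e l"
      using e_carrier[of l] by (simp add: scalar_prod_def lessThan_atLeast0)
    then show "(\<Sum>i<n. e k $ i * e l $ i) = (if k = l then 1 else 0)" using e_orth kl by simp
  qed
  moreover have "(\<Sum>i<n. e j $ i * (inv_sqrt_mat S *\<^sub>v W \<omega>) $ i) = e j \<bullet> (R *\<^sub>v W \<omega>)" for j \<omega>
    using R_carrier by (simp add: scalar_prod_def[of "e j"] lessThan_atLeast0 R_def)
  ultimately show ?thesis by simp
qed

text \<open>With x chosen such that R x is the j-th basis vector, \<open>m j\<close> is the squared
  length of R Q x. As Q preserves the length of x, the extreme eigenvalues of S compare this with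
  the squared length of R x, which is 1.\<close>

lemma m_le: "j < n \<Longrightarrow> m j \<le> lmax / lmin"
proof -
  assume j: "j < n"
  obtain x where x: "x \<in> carrier_vec n" "R *\<^sub>v x = e j" using R_surj[OF e_carrier[OF j]] by blast
  have "(R *\<^sub>v vperm n q x) \<bullet> (R *\<^sub>v vperm n q x) = (\<Sum>i<n. m i * ((e i \<bullet> e j) * (e i \<bullet> e j)))"
    using e_form[OF x(1) x(1)] x(2) by simp
  also have "\<dots> = (\<Sum>i<n. if i = j then m j else 0)"
    by (rule sum.cong) (auto simp: e_orth j)
  also have "\<dots> = m j" using j by simp
  finally have mj: "m j = (R *\<^sub>v vperm n q x) \<bullet> (R *\<^sub>v vperm n q x)" by simp
  have "lmin * m j \<le> x \<bullet> x"
    unfolding mj using R_bounds(1)[of "vperm n q x"] vperm_scalar_prod[OF q x(1)] by simp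
  also have "\<dots> \<le> lmax * (e j \<bullet> e j)" using R_bounds(2)[OF x(1)] x(2) by simp
  also have "e j \<bullet> e j = 1" using e_orth[OF j j] by simp
  finally show "m j \<le> lmax / lmin" using lmin_pos by (simp add: field_simps)
qed

lemma form_lower:
  assumes x: "x \<in> carrier_vec n"
  shows "(x \<bullet> x) / lmax \<le> (\<Sum>j<n. m j * (e j \<bullet> (R *\<^sub>v x))\<^sup>2)"
    and "(\<Sum>j<n. m j * (e j \<bullet> (R *\<^sub>v x))\<^sup>2) \<le> (x \<bullet> x) / lmin"
proof -
  have "(\<Sum>j<n. m j * (e j \<bullet> (R *\<^sub>v x))\<^sup>2) = (R *\<^sub>v vperm n q x) \<bullet> (R *\<^sub>v vperm n q x)"
    using e_form[OF x x] by (simp add: power2_eq_square)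
  moreover have "vperm n q x \<bullet> vperm n q x = x \<bullet> x" by (rule vperm_scalar_prod[OF q x])
  ultimately show "(x \<bullet> x) / lmax \<le> (\<Sum>j<n. m j * (e j \<bullet> (R *\<^sub>v x))\<^sup>2)"
    and "(\<Sum>j<n. m j * (e j \<bullet> (R *\<^sub>v x))\<^sup>2) \<le> (x \<bullet> x) / lmin"
    using R_bounds[of "vperm n q x"] lmin_pos lmax_pos by (simp_all add: field_simps)
qed

lemma gls_linear_tail:
  assumes s: "(\<Sum>j<n. (a j)\<^sup>2) \<le> s" "0 < s" and z: "0 \<le> z"
  shows "prob {\<omega> \<in> space M. z < \<bar>\<Sum>j<n. a j * (e j \<bullet> (R *\<^sub>v W \<omega>))\<bar>} \<le> 2 * exp (- z\<^sup>2 / (2 * s))"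
proof (rule centered_normal_tail[OF _ _ _ s(1) z s(2)])
  note g = coord_gaussian
  have [measurable]: "j < n \<Longrightarrow> (\<lambda>\<omega>. e j \<bullet> (R *\<^sub>v W \<omega>)) \<in> borel_measurable M" for j
    using std_gaussian_family_measurable[OF g] .
  show "(\<lambda>\<omega>. \<Sum>j<n. a j * (e j \<bullet> (R *\<^sub>v W \<omega>))) \<in> borel_measurable M" by measurable
  show "distr M borel (\<lambda>\<omega>. \<Sum>j<n. a j * (e j \<bullet> (R *\<^sub>v W \<omega>))) = centered_normal (\<Sum>j<n. (a j)\<^sup>2)"
    using g unfolding std_gaussian_family_def by blast
qed (simp add: sum_nonneg)

text \<open>The center of the deviation is the ordinary least squares coefficient of \<beta> u on v,
  and the first term of the exponent holds the squared distance of \<beta> u from the line through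
  v. Off that line, t = 0 already bounds the probability of selection; for u = v the distance
  vanishes and t carries the bound.\<close>

lemma gls_profile_tail:
  fixes u v :: "real vec" and \<beta> t :: real
  defines "x \<equiv> R *\<^sub>v vperm n q v"
    and "y \<equiv> \<lambda>\<omega>. R *\<^sub>v vperm n q (W \<omega> + \<beta> \<cdot>\<^sub>v u)"
  defines "h \<equiv> \<lambda>\<omega>. inverse (x \<bullet> x) * (x \<bullet> y \<omega>)"
  assumes u: "u \<in> carrier_vec n" and v: "v \<in> carrier_vec n" and v0: "0 < v \<bullet> v" and t: "0 \<le> t"
  shows "prob {\<omega> \<in> space M. (y \<omega> - h \<omega> \<cdot>\<^sub>v x) \<bullet> (y \<omega> - h \<omega> \<cdot>\<^sub>v x) \<le> (R *\<^sub>v W \<omega>) \<bullet> (R *\<^sub>v W \<omega>)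
        \<and> t \<le> \<bar>h \<omega> - \<beta> * (u \<bullet> v) / (v \<bullet> v)\<bar>}
    \<le> 2 * sqrt (lmax / lmin) * (\<Prod>j<n. sqrt (2 / (1 + m j)))
      * exp (- (\<beta>\<^sup>2 * (u \<bullet> u - (u \<bullet> v)\<^sup>2 / (v \<bullet> v))) / (8 * lmax) - (v \<bullet> v) * t\<^sup>2 / (16 * lmax))"
proof -
  define \<xi> where "\<xi> j \<omega> = e j \<bullet> (R *\<^sub>v W \<omega>)" for j \<omega>
  define c where "c j = \<beta> * (e j \<bullet> (R *\<^sub>v u))" for j
  define v' where "v' j = e j \<bullet> (R *\<^sub>v v)" for j
  define b0 where "b0 = \<beta> * (u \<bullet> v) / (v \<bullet> v)"
  define d where "d = \<beta>\<^sup>2 * (u \<bullet> u - (u \<bullet> v)\<^sup>2 / (v \<bullet> v))"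
  \<comment> \<open>The 2 here and in \<open>e1\<close> is the constant in |s|^2 / 2 \<le> |s + z|^2
    + |z|^2, with equality at z = - s / 2.\<close>
  define e0 where "e0 = d / (2 * lmax)"
  define e1 where "e1 = (v \<bullet> v) / (2 * lmax)"
  have g: "std_gaussian_family M n \<xi>" using coord_gaussian by (simp add: \<xi>_def[abs_def])
  have xx: "x \<bullet> x = (\<Sum>j<n. m j * (v' j)\<^sup>2)"
    unfolding x_def v'_def using e_form[OF v v] by (simp add: power2_eq_square)
  have fl: "(v \<bullet> v) / lmax \<le> (\<Sum>j<n. m j * (v' j)\<^sup>2)" "(\<Sum>j<n. m j * (v' j)\<^sup>2) \<le> (v \<bullet> v) / lmin"
    using form_lower[OF v] by (simp_all add: v'_def)
  have a_pos: "0 < (\<Sum>j<n. m j * (v' j)\<^sup>2)"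
    using fl(1) v0 lmax_pos by (smt (verit) divide_pos_pos)
  have e1: "0 < e1" using v0 lmax_pos by (simp add: e1_def)
  have low: "e0 + e1 * (b - b0)\<^sup>2 \<le> (\<Sum>j<n. m j * (c j - b * v' j + w j)\<^sup>2 + (w j)\<^sup>2)" for b w
  proof -
    \<comment> \<open>The free numbers w become the coordinates of some R z. The sum then consists
      of quadratic forms of s + z and of z, and each is at least the squared length divided by
      lmax.\<close>
    define ww where "ww = vec n (\<lambda>i. \<Sum>j<n. w j * e j $ i)"
    have ww: "ww \<in> carrier_vec n" by (simp add: ww_def)
    have eww: "e k \<bullet> ww = w k" if k: "k < n" for k
    proof -
      have "e k \<bullet> ww = (\<Sum>i<n. \<Sum>j<n. w j * (e k $ i * e j $ i))"
        by (simp add: ww_def scalar_prod_def lessThan_atLeast0 sum_distrib_left mult.left_commute)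
      also have "\<dots> = (\<Sum>j<n. w j * (\<Sum>i<n. e k $ i * e j $ i))"
        by (subst sum.swap) (simp add: sum_distrib_left)
      also have "\<dots> = (\<Sum>j<n. w j * (e k \<bullet> e j))"
        by (intro sum.cong) (auto simp: scalar_prod_def lessThan_atLeast0 carrier_vecD[OF e_carrier])
      also have "\<dots> = (\<Sum>j<n. if j = k then w k else 0)"
        by (rule sum.cong) (auto simp: e_orth k)
      finally show ?thesis using k by simp
    qed
    obtain z where z: "z \<in> carrier_vec n" "R *\<^sub>v z = ww" using R_surj[OF ww] by blast
    define s where "s = \<beta> \<cdot>\<^sub>v u + (- b) \<cdot>\<^sub>v v"
    have s: "s \<in> carrier_vec n" using u v by (simp add: s_def)
    have sz: "s + 1 \<cdot>\<^sub>v z \<in> carrier_vec n" using s z by simp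
    have es: "e j \<bullet> (R *\<^sub>v (s + 1 \<cdot>\<^sub>v z)) = c j - b * v' j + w j" if j: "j < n" for j
    proof -
      have "e j \<bullet> (R *\<^sub>v s) = e j \<bullet> (R *\<^sub>v (\<beta> \<cdot>\<^sub>v u)) + (- b) * v' j"
        unfolding s_def v'_def using u v j by (intro coord_linear) auto
      moreover have "e j \<bullet> (R *\<^sub>v (\<beta> \<cdot>\<^sub>v u)) = c j"
        using mult_mat_vec[OF R_carrier u, of \<beta>] e_carrier[OF j] by (simp add: c_def)
      ultimately show ?thesis using coord_linear[OF j s z(1), of 1] eww[OF j] z(2) by simp
    qed
    have "((s + 1 \<cdot>\<^sub>v z) \<bullet> (s + 1 \<cdot>\<^sub>v z)) / lmax \<le> (\<Sum>j<n. m j * (c j - b * v' j + w j)\<^sup>2)"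
    proof -
      have "(\<Sum>j<n. m j * (e j \<bullet> (R *\<^sub>v (s + 1 \<cdot>\<^sub>v z)))\<^sup>2) = (\<Sum>j<n. m j * (c j - b * v' j + w j)\<^sup>2)"
        by (rule sum.cong) (simp_all only: es lessThan_iff)
      then show ?thesis using form_lower(1)[OF sz] by (simp only:)
    qed
    moreover have "(z \<bullet> z) / lmax \<le> (\<Sum>j<n. (w j)\<^sup>2)"
    proof -
      have "(R *\<^sub>v z) \<bullet> (R *\<^sub>v z) = (\<Sum>j<n. (w j)\<^sup>2)"
        unfolding z(2) e_parseval[OF ww ww] by (rule sum.cong) (simp_all add: eww power2_eq_square)
      then show ?thesis using R_bounds(2)[OF z(1)] lmax_pos by (simp add: field_simps)
    qed
    moreover have "(s \<bullet> s) / 2 \<le> (s + 1 \<cdot>\<^sub>v z) \<bullet> (s + 1 \<cdot>\<^sub>v z) + z \<bullet> z"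
    proof -
      have "0 \<le> (s + 2 \<cdot>\<^sub>v z) \<bullet> (s + 2 \<cdot>\<^sub>v z)" by (rule scalar_prod_self_nonneg)
      then show ?thesis using s z(1) comm_scalar_prod[OF s z(1)]
        by (simp add: add_scalar_prod_distrib[of _ n] scalar_prod_add_distrib[of _ n])
    qed
    moreover have "s \<bullet> s = (v \<bullet> v) * (b - b0)\<^sup>2 + d"
    proof -
      have "s \<bullet> s = \<beta>\<^sup>2 * (u \<bullet> u) - 2 * b * \<beta> * (u \<bullet> v) + b\<^sup>2 * (v \<bullet> v)"
        using u v comm_scalar_prod[OF u v]
        by (simp add: s_def add_scalar_prod_distrib[of _ n] scalar_prod_add_distrib[of _ n] power2_eq_square algebra_simps)
      moreover have "(v \<bullet> v) * (b - b0)\<^sup>2 + d = \<beta>\<^sup>2 * (u \<bullet> u) - 2 * b * \<beta> * (u \<bullet> v) + b\<^sup>2 * (v \<bullet> v)"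
        using v0 by (simp add: b0_def d_def divide_simps power2_eq_square) (simp add: algebra_simps)
      ultimately show ?thesis by simp
    qed
    ultimately have "((v \<bullet> v) * (b - b0)\<^sup>2 + d) / 2 / lmax \<le> (\<Sum>j<n. m j * (c j - b * v' j + w j)\<^sup>2) + (\<Sum>j<n. (w j)\<^sup>2)"
      using divide_right_mono[of "(s \<bullet> s) / 2" "(s + 1 \<cdot>\<^sub>v z) \<bullet> (s + 1 \<cdot>\<^sub>v z) + z \<bullet> z" lmax] lmax_pos
      by (simp add: add_divide_distrib)
    then show ?thesis by (simp add: e0_def e1_def sum.distrib add_divide_distrib algebra_simps)
  qed
  have yc: "e j \<bullet> (R *\<^sub>v (W \<omega> + \<beta> \<cdot>\<^sub>v u)) = \<xi> j \<omega> + c j" if "j < n" "\<omega> \<in> space M" for j \<omega>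
    using coord_linear[OF that(1) W[OF that(2)] u, of \<beta>] by (simp add: \<xi>_def c_def)
  have hx: "h \<omega> = (\<Sum>j<n. m j * v' j * (\<xi> j \<omega> + c j)) / (\<Sum>j<n. m j * (v' j)\<^sup>2)" if \<omega>: "\<omega> \<in> space M" for \<omega>
  proof -
    have "x \<bullet> y \<omega> = (\<Sum>j<n. m j * (v' j * (\<xi> j \<omega> + c j)))"
    proof -
      have Wu: "W \<omega> + \<beta> \<cdot>\<^sub>v u \<in> carrier_vec n" using W[OF \<omega>] u by simp
      show ?thesis
        unfolding x_def y_def e_form[OF v Wu] v'_def
        by (rule sum.cong) (simp_all add: yc[OF _ \<omega>])
    qed
    then show ?thesis by (simp add: h_def xx inverse_eq_divide mult.assoc)
  qed
  have rx: "(y \<omega> - b \<cdot>\<^sub>v x) \<bullet> (y \<omega> - b \<cdot>\<^sub>v x) = (\<Sum>j<n. m j * (\<xi> j \<omega> + c j - b * v' j)\<^sup>2)"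
    if \<omega>: "\<omega> \<in> space M" for \<omega> b
  proof -
    define r where "r = (W \<omega> + \<beta> \<cdot>\<^sub>v u) + (- b) \<cdot>\<^sub>v v"
    have Wu: "W \<omega> + \<beta> \<cdot>\<^sub>v u \<in> carrier_vec n" using W[OF \<omega>] u by simp
    have r: "r \<in> carrier_vec n" using Wu v by (simp add: r_def)
    have "R *\<^sub>v vperm n q r = y \<omega> + (- b) \<cdot>\<^sub>v x"
      unfolding r_def y_def x_def vperm_add_smult[OF q Wu v] by (rule R_add_smult) simp_all
    also have "\<dots> = y \<omega> - b \<cdot>\<^sub>v x" by (rule eq_vecI) (auto simp: x_def y_def)
    finally have "(y \<omega> - b \<cdot>\<^sub>v x) \<bullet> (y \<omega> - b \<cdot>\<^sub>v x) = (\<Sum>j<n. m j * (e j \<bullet> (R *\<^sub>v r))\<^sup>2)"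
      using e_form[OF r r] by (simp add: power2_eq_square)
    moreover have "e j \<bullet> (R *\<^sub>v r) = \<xi> j \<omega> + c j - b * v' j" if "j < n" for j
      unfolding r_def using coord_linear[OF that Wu v, of "- b"] yc[OF that \<omega>] by (simp add: v'_def)
    then have "(\<Sum>j<n. m j * (e j \<bullet> (R *\<^sub>v r))\<^sup>2) = (\<Sum>j<n. m j * (\<xi> j \<omega> + c j - b * v' j)\<^sup>2)"
      by (intro sum.cong) simp_all
    ultimately show ?thesis by simp
  qed
  have zz: "(R *\<^sub>v W \<omega>) \<bullet> (R *\<^sub>v W \<omega>) = (\<Sum>j<n. (\<xi> j \<omega>)\<^sup>2)" for \<omega>
    using e_parseval[OF R_vec R_vec, of "W \<omega>" "W \<omega>"] by (simp add: \<xi>_def power2_eq_square)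
  have "prob {\<omega> \<in> space M. (y \<omega> - h \<omega> \<cdot>\<^sub>v x) \<bullet> (y \<omega> - h \<omega> \<cdot>\<^sub>v x) \<le> (R *\<^sub>v W \<omega>) \<bullet> (R *\<^sub>v W \<omega>) \<and> t \<le> \<bar>h \<omega> - b0\<bar>}
      \<le> sqrt (2 * ((v \<bullet> v) / lmin) / e1) * (\<Prod>j<n. sqrt (2 / (1 + m j))) * exp (- e0 / 4 - e1 * t\<^sup>2 / 8)"
  proof -
    have "{\<omega> \<in> space M. (y \<omega> - h \<omega> \<cdot>\<^sub>v x) \<bullet> (y \<omega> - h \<omega> \<cdot>\<^sub>v x) \<le> (R *\<^sub>v W \<omega>) \<bullet> (R *\<^sub>v W \<omega>) \<and> t \<le> \<bar>h \<omega> - b0\<bar>}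
      = {\<omega> \<in> space M. (\<Sum>j<n. m j * (\<xi> j \<omega> + c j - ((\<Sum>j<n. m j * v' j * (\<xi> j \<omega> + c j)) / (\<Sum>j<n. m j * (v' j)\<^sup>2)) * v' j)\<^sup>2)
          \<le> (\<Sum>j<n. (\<xi> j \<omega>)\<^sup>2) \<and> t \<le> \<bar>(\<Sum>j<n. m j * v' j * (\<xi> j \<omega> + c j)) / (\<Sum>j<n. m j * (v' j)\<^sup>2) - b0\<bar>}"
      by (intro Collect_cong conj_cong refl) (simp_all only: rx zz hx)
    then show ?thesis
      using profile_deviation_tail[OF g m_pos a_pos fl(2) e1 t low] by (simp only:)
  qed
  \<comment> \<open>The profile integral leaves the square root of twice the ratio of curvature to
    e1. The curvature is at most |v|^2 / lmin while e1 is |v|^2 / (2 lmax), which is the origin of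
    the condition number in the bound.\<close>
  moreover have "sqrt (2 * ((v \<bullet> v) / lmin) / e1) = 2 * sqrt (lmax / lmin)"
  proof -
    have "2 * ((v \<bullet> v) / lmin) / e1 = 2\<^sup>2 * (lmax / lmin)"
      using v0 lmax_pos lmin_pos by (simp add: e1_def field_simps)
    then show ?thesis by (simp only: real_sqrt_mult real_sqrt_abs abs_numeral)
  qed
  moreover have "- e0 / 4 - e1 * t\<^sup>2 / 8 = - d / (8 * lmax) - (v \<bullet> v) * t\<^sup>2 / (16 * lmax)"
    by (simp add: e0_def e1_def)
  ultimately show ?thesis by (simp add: b0_def d_def)
qed

text \<open>When the candidate covariate is the true one, \<beta> cancels exactly and the error is a
  linear functional of W.\<close>

lemma gls_slope_error:
  fixes v :: "real vec" and \<beta> :: real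
  defines "x \<equiv> R *\<^sub>v vperm n q v"
  assumes v: "v \<in> carrier_vec n" and v0: "0 < v \<bullet> v" and \<omega>: "\<omega> \<in> space M"
  shows "inverse (x \<bullet> x) * (x \<bullet> (R *\<^sub>v vperm n q (W \<omega> + \<beta> \<cdot>\<^sub>v v))) - \<beta>
    = (\<Sum>j<n. m j * (e j \<bullet> (R *\<^sub>v v)) * (e j \<bullet> (R *\<^sub>v W \<omega>))) / (x \<bullet> x)"
    and "(v \<bullet> v) / lmax \<le> x \<bullet> x" and "0 < x \<bullet> x"
    and "x \<bullet> x = (\<Sum>j<n. m j * (e j \<bullet> (R *\<^sub>v v))\<^sup>2)"
proof -
  show xx: "x \<bullet> x = (\<Sum>j<n. m j * (e j \<bullet> (R *\<^sub>v v))\<^sup>2)"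
    unfolding x_def using e_form[OF v v] by (simp add: power2_eq_square)
  show lo: "(v \<bullet> v) / lmax \<le> x \<bullet> x" unfolding xx by (rule form_lower(1)[OF v])
  have "0 < (v \<bullet> v) / lmax" using v0 lmax_pos by simp
  with lo show pos: "0 < x \<bullet> x" by simp
  have "R *\<^sub>v vperm n q (W \<omega> + \<beta> \<cdot>\<^sub>v v) = R *\<^sub>v vperm n q (W \<omega>) + \<beta> \<cdot>\<^sub>v x"
    unfolding vperm_add_smult[OF q W[OF \<omega>] v] x_def by (rule R_add_smult) simp_all
  then have "x \<bullet> (R *\<^sub>v vperm n q (W \<omega> + \<beta> \<cdot>\<^sub>v v)) = x \<bullet> (R *\<^sub>v vperm n q (W \<omega>)) + \<beta> * (x \<bullet> x)"
    by (simp add: x_def scalar_prod_add_distrib[of _ n])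
  also have "x \<bullet> (R *\<^sub>v vperm n q (W \<omega>)) = (\<Sum>j<n. m j * (e j \<bullet> (R *\<^sub>v v)) * (e j \<bullet> (R *\<^sub>v W \<omega>)))"
    unfolding x_def using e_form[OF v W[OF \<omega>]] by (simp add: mult.assoc)
  finally show "inverse (x \<bullet> x) * (x \<bullet> (R *\<^sub>v vperm n q (W \<omega> + \<beta> \<cdot>\<^sub>v v))) - \<beta>
      = (\<Sum>j<n. m j * (e j \<bullet> (R *\<^sub>v v)) * (e j \<bullet> (R *\<^sub>v W \<omega>))) / (x \<bullet> x)"
    using pos by (simp add: field_simps)
qed

text \<open>The numerator has variance equal to the sum of the squared coefficients, and bounding
  one factor \<open>m j\<close> by \<open>lmax / lmin\<close> returns x . x. The error itself
  therefore has variance at most \<open>lmax / lmin\<close> divided by x . x.\<close>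

lemma gls_slope_tail:
  fixes v :: "real vec" and \<beta> t :: real
  defines "x \<equiv> R *\<^sub>v vperm n q v"
  assumes v: "v \<in> carrier_vec n" and v0: "0 < v \<bullet> v" and t: "0 \<le> t"
  shows "prob {\<omega> \<in> space M. t < \<bar>inverse (x \<bullet> x) * (x \<bullet> (R *\<^sub>v vperm n q (W \<omega> + \<beta> \<cdot>\<^sub>v v))) - \<beta>\<bar>}
    \<le> 2 * exp (- (t\<^sup>2 * (v \<bullet> v)) / (2 * (lmax / lmin) * lmax))"
proof -
  let ?E = "{\<omega> \<in> space M. t < \<bar>inverse (x \<bullet> x) * (x \<bullet> (R *\<^sub>v vperm n q (W \<omega> + \<beta> \<cdot>\<^sub>v v))) - \<beta>\<bar>}"
  note err = gls_slope_error[OF v v0, folded x_def]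
  obtain \<omega>0 where "\<omega>0 \<in> space M" using not_empty by blast
  note x = err(2-4)[OF this]
  have k: "0 < lmax / lmin" using lmax_pos lmin_pos by simp
  have "(\<Sum>j<n. (m j * (e j \<bullet> (R *\<^sub>v v)))\<^sup>2) \<le> (\<Sum>j<n. lmax / lmin * (m j * (e j \<bullet> (R *\<^sub>v v))\<^sup>2))"
  proof (rule sum_mono)
    fix j assume "j \<in> {..<n}"
    then have j: "m j \<le> lmax / lmin" "0 < m j" using m_le m_pos by auto
    then have "m j * (m j * (e j \<bullet> (R *\<^sub>v v))\<^sup>2) \<le> lmax / lmin * (m j * (e j \<bullet> (R *\<^sub>v v))\<^sup>2)"
      by (intro mult_right_mono) simp_all
    then show "(m j * (e j \<bullet> (R *\<^sub>v v)))\<^sup>2 \<le> lmax / lmin * (m j * (e j \<bullet> (R *\<^sub>v v))\<^sup>2)"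
      by (simp add: power2_eq_square mult_ac)
  qed
  then have s: "(\<Sum>j<n. (m j * (e j \<bullet> (R *\<^sub>v v)))\<^sup>2) \<le> lmax / lmin * (x \<bullet> x)"
    by (simp add: x(3) sum_distrib_left)
  have "?E
      = {\<omega> \<in> space M. t * (x \<bullet> x) < \<bar>\<Sum>j<n. m j * (e j \<bullet> (R *\<^sub>v v)) * (e j \<bullet> (R *\<^sub>v W \<omega>))\<bar>}"
    using x(2) by (intro Collect_cong conj_cong refl) (simp add: err(1) abs_divide pos_less_divide_eq)
  then have "prob ?E
      \<le> 2 * exp (- (t * (x \<bullet> x))\<^sup>2 / (2 * (lmax / lmin * (x \<bullet> x))))"
    using gls_linear_tail[OF s mult_pos_pos[OF k x(2)] mult_nonneg_nonneg[OF t less_imp_le[OF x(2)]]]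
    by (simp only:)
  also have "- (t * (x \<bullet> x))\<^sup>2 / (2 * (lmax / lmin * (x \<bullet> x))) = - (t\<^sup>2 * (x \<bullet> x) / (2 * (lmax / lmin)))"
    using x(2) by (simp add: power2_eq_square)
  also have "2 * exp (- (t\<^sup>2 * (x \<bullet> x) / (2 * (lmax / lmin)))) \<le> 2 * exp (- (t\<^sup>2 * ((v \<bullet> v) / lmax) / (2 * (lmax / lmin))))"
  proof -
    have "t\<^sup>2 * ((v \<bullet> v) / lmax) / (2 * (lmax / lmin)) \<le> t\<^sup>2 * (x \<bullet> x) / (2 * (lmax / lmin))"
      by (intro divide_right_mono mult_left_mono x(1)) (use k in simp_all)
    then show ?thesis by simp
  qed
  also have "- (t\<^sup>2 * ((v \<bullet> v) / lmax) / (2 * (lmax / lmin))) = - (t\<^sup>2 * (v \<bullet> v)) / (2 * (lmax / lmin) * lmax)"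
    by simp
  finally show ?thesis .
qed

text \<open>For the identity permutation this is the numerator of the slope error. Its variance is
  the squared length of R v, at most |v|^2 / lmin.\<close>

lemma gls_score_tail:
  fixes v :: "real vec"
  assumes v: "v \<in> carrier_vec n" and v0: "0 < v \<bullet> v" and z: "0 \<le> z"
  shows "prob {\<omega> \<in> space M. z < \<bar>(R *\<^sub>v v) \<bullet> (R *\<^sub>v W \<omega>)\<bar>} \<le> 2 * exp (- z\<^sup>2 / (2 * ((v \<bullet> v) / lmin)))"
proof -
  have "(\<Sum>j<n. (e j \<bullet> (R *\<^sub>v v))\<^sup>2) \<le> (v \<bullet> v) / lmin"
    using e_parseval[OF R_vec R_vec, of v v] R_bounds(1)[OF v] lmin_pos
    by (simp add: power2_eq_square field_simps)
  from gls_linear_tail[OF this _ z] show ?thesis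
    using v0 lmin_pos unfolding e_parseval[OF R_vec R_vec] by simp
qed

text \<open>The numerator of the error is the score, which does not depend on q, plus a remainder
  with the coefficients \<open>m j - 1\<close>. An error above t makes the numerator exceed t |v|^2
  / lmax; if the score accounts for at most 7/8 of this, the remainder exceeds 1/8 of it.\<close>

lemma gls_slope_tail_near:
  fixes v :: "real vec" and \<beta> t s :: real
  defines "x \<equiv> R *\<^sub>v vperm n q v"
  assumes v: "v \<in> carrier_vec n" and v0: "0 < v \<bullet> v" and t: "0 \<le> t"
    and s: "(\<Sum>j<n. (m j - 1)\<^sup>2 * (e j \<bullet> (R *\<^sub>v v))\<^sup>2) \<le> s" "0 < s"
  shows "prob {\<omega> \<in> space M. t < \<bar>inverse (x \<bullet> x) * (x \<bullet> (R *\<^sub>v vperm n q (W \<omega> + \<beta> \<cdot>\<^sub>v v))) - \<beta>\<bar>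
      \<and> \<bar>(R *\<^sub>v v) \<bullet> (R *\<^sub>v W \<omega>)\<bar> \<le> 7 / 8 * (t * ((v \<bullet> v) / lmax))}
    \<le> 2 * exp (- (t * ((v \<bullet> v) / lmax) / 8)\<^sup>2 / (2 * s))"
proof -
  let ?E = "{\<omega> \<in> space M. t < \<bar>inverse (x \<bullet> x) * (x \<bullet> (R *\<^sub>v vperm n q (W \<omega> + \<beta> \<cdot>\<^sub>v v))) - \<beta>\<bar>
      \<and> \<bar>(R *\<^sub>v v) \<bullet> (R *\<^sub>v W \<omega>)\<bar> \<le> 7 / 8 * (t * ((v \<bullet> v) / lmax))}"
  let ?D = "{\<omega> \<in> space M. t * ((v \<bullet> v) / lmax) / 8 < \<bar>\<Sum>j<n. (m j - 1) * (e j \<bullet> (R *\<^sub>v v)) * (e j \<bullet> (R *\<^sub>v W \<omega>))\<bar>}"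
  have z: "0 \<le> t * ((v \<bullet> v) / lmax) / 8" using t v0 lmax_pos by simp
  have s': "(\<Sum>j<n. ((m j - 1) * (e j \<bullet> (R *\<^sub>v v)))\<^sup>2) \<le> s" using s(1) by (simp add: power_mult_distrib)
  have [measurable]: "j < n \<Longrightarrow> (\<lambda>\<omega>. e j \<bullet> (R *\<^sub>v W \<omega>)) \<in> borel_measurable M" for j
    using std_gaussian_family_measurable[OF coord_gaussian] .
  have "prob ?E
    \<le> prob ?D"
  proof (rule finite_measure_mono)
    show "?D \<in> events"
      by measurable
    show "?E
      \<subseteq> ?D"
    proof safe
      fix \<omega> assume \<omega>: "\<omega> \<in> space M"
        and 1: "t < \<bar>inverse (x \<bullet> x) * (x \<bullet> (R *\<^sub>v vperm n q (W \<omega> + \<beta> \<cdot>\<^sub>v v))) - \<beta>\<bar>"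
        and 2: "\<bar>(R *\<^sub>v v) \<bullet> (R *\<^sub>v W \<omega>)\<bar> \<le> 7 / 8 * (t * ((v \<bullet> v) / lmax))"
      note err = gls_slope_error[OF v v0 \<omega>, folded x_def]
      define N where "N = (\<Sum>j<n. m j * (e j \<bullet> (R *\<^sub>v v)) * (e j \<bullet> (R *\<^sub>v W \<omega>)))"
      define N1 where "N1 = (\<Sum>j<n. (m j - 1) * (e j \<bullet> (R *\<^sub>v v)) * (e j \<bullet> (R *\<^sub>v W \<omega>)))"
      define T where "T = t * ((v \<bullet> v) / lmax)"
      have "N = N1 + (R *\<^sub>v v) \<bullet> (R *\<^sub>v W \<omega>)"
        unfolding N_def N1_def e_parseval[OF R_vec R_vec] sum.distrib[symmetric]
        by (rule sum.cong) (auto simp: algebra_simps)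
      moreover have "t * ((v \<bullet> v) / lmax) < \<bar>N\<bar>"
      proof -
        have "t * ((v \<bullet> v) / lmax) \<le> t * (x \<bullet> x)" by (rule mult_left_mono[OF err(2) t])
        also have "\<dots> < \<bar>N\<bar>" using 1 err(3) by (simp add: err(1) N_def abs_divide pos_less_divide_eq)
        finally show ?thesis .
      qed
      ultimately show "t * ((v \<bullet> v) / lmax) / 8 < \<bar>\<Sum>j<n. (m j - 1) * (e j \<bullet> (R *\<^sub>v v)) * (e j \<bullet> (R *\<^sub>v W \<omega>))\<bar>"
        using 2 unfolding N1_def[symmetric] T_def[symmetric] by linarith
    qed
  qed
  also have "\<dots> \<le> 2 * exp (- (t * ((v \<bullet> v) / lmax) / 8)\<^sup>2 / (2 * s))"
    by (rule gls_linear_tail[OF s' s(2) z])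
  finally show ?thesis .
qed

end

end

subsection \<open>Block permutations and random vectors\<close>

text \<open>Indices from K * b on stay fixed, as \<open>permutes\<close> on the initial segment
  demands.\<close>

definition blift :: "nat \<Rightarrow> nat \<Rightarrow> (nat \<Rightarrow> nat) \<Rightarrow> nat \<Rightarrow> nat" where
  "blift K b s i = (if i < K * b then K * (i div K) + s (i mod K) else i)"

lemma blift_less:
  assumes s: "s permutes {..<K}" and i: "i < K * b"
  shows "blift K b s i < K * b" "blift K b s i div K = i div K" "blift K b s i mod K = s (i mod K)"
proof -
  have K: "0 < K" using i by (cases K) auto
  then have "i mod K < K" by simp
  then have si: "s (i mod K) < K" using permutes_in_image[OF s] by simp
  have "i div K < b" using i K by (simp add: div_less_iff_less_mult mult.commute)
  then have "K * (i div K) + K \<le> K * b" by (metis Suc_leI mult_Suc_right add.commute mult_le_mono2)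
  then show "blift K b s i < K * b" using si i by (simp add: blift_def)
  show "blift K b s i div K = i div K" "blift K b s i mod K = s (i mod K)"
    using si i by (simp_all add: blift_def)
qed

lemma blift_comp:
  assumes t: "t permutes {..<K}"
  shows "blift K b s \<circ> blift K b t = blift K b (s \<circ> t)"
proof
  fix i
  show "(blift K b s \<circ> blift K b t) i = blift K b (s \<circ> t) i"
  proof (cases "i < K * b")
    case True
    from blift_less[OF t True] show ?thesis
      by (simp add: blift_def[of K b s] blift_def[of K b "s \<circ> t"] True)
  next
    case False
    then show ?thesis by (simp add: blift_def)
  qed
qed

lemma blift_id: "blift K b id = id"
  by (auto simp: blift_def fun_eq_iff)

lemma blift_permutes:
  assumes s: "s permutes {..<K}"
  shows "blift K b s permutes {..<K * b}"
proof -
  note s' = permutes_inv[OF s]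
  have "blift K b s \<circ> blift K b (inv_into UNIV s) = id" "blift K b (inv_into UNIV s) \<circ> blift K b s = id"
    using blift_comp[OF s', of b s] blift_comp[OF s, of b "inv_into UNIV s"] permutes_inv_o[OF s] by (simp_all add: blift_id)
  then have "bij (blift K b s)" by (metis o_bij)
  then show ?thesis unfolding permutes_def bij_iff by (simp add: blift_def)
qed

lemma perm_mats_eq: "perm_mats k = perm_mat k ` {s. s permutes {..<k}}"
  by (auto simp: perm_mats_def perm_mat_def)

lemma bdiag_perm_mat:
  assumes s: "s permutes {..<K}"
  shows "bdiag b (perm_mat K s) = perm_mat (K * b) (blift K b s)"
proof (induction b)
  case 0
  then show ?case by (intro eq_matI) (auto simp: bdiag_def perm_mat_def)
next
  case (Suc b)
  have IH: "diag_block_mat (replicate b (perm_mat K s)) = perm_mat (K * b) (blift K b s)"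
    using Suc by (simp add: bdiag_def)
  have eq: "bdiag (Suc b) (perm_mat K s)
      = four_block_mat (perm_mat K s) (0\<^sub>m K (K * b)) (0\<^sub>m (K * b) K) (perm_mat (K * b) (blift K b s))"
    by (simp add: bdiag_def IH Let_def)
  show ?case
  proof (rule eq_matI)
    fix i j assume "i < dim_row (perm_mat (K * Suc b) (blift K (Suc b) s))" "j < dim_col (perm_mat (K * Suc b) (blift K (Suc b) s))"
    then have ij: "i < K + K * b" "j < K + K * b" by (simp_all add: perm_mat_def)
    have bl: "blift K (Suc b) s i = (if i < K then s i else K + blift K b s (i - K))"
    proof (cases "i < K")
      case False
      moreover have "0 < K" using ij by (cases K) auto
      ultimately show ?thesis using ij by (simp add: blift_def le_div_geq le_mod_geq)
    qed (use ij in \<open>simp add: blift_def\<close>)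
    have sK: "s i < K" if "i < K" using permutes_in_image[OF s, of i] that by simp
    show "bdiag (Suc b) (perm_mat K s) $$ (i, j) = perm_mat (K * Suc b) (blift K (Suc b) s) $$ (i, j)"
      unfolding eq using ij sK by (auto simp: perm_mat_def bl)
  qed (simp_all add: eq)
qed

lemma bdiag_mult_vec:
  assumes s: "s permutes {..<K}" and x: "x \<in> carrier_vec (K * b)"
  shows "bdiag b (perm_mat K s) *\<^sub>v x = vperm (K * b) (blift K b s) x"
  unfolding bdiag_perm_mat[OF s] by (rule perm_mat_mult_vec[OF blift_permutes[OF s] x])

section \<open>Measurability of random vectors and sums of normal variables\<close>

lemma scalar_prod_measurable:
  assumes "random_vec N n V" "random_vec N n V'"
  shows "(\<lambda>\<omega>. V \<omega> \<bullet> V' \<omega>) \<in> borel_measurable N"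
proof -
  have [measurable]: "i < n \<Longrightarrow> (\<lambda>\<omega>. V \<omega> $ i) \<in> borel_measurable N"
    "i < n \<Longrightarrow> (\<lambda>\<omega>. V' \<omega> $ i) \<in> borel_measurable N" for i
    using assms by (auto simp: random_vec_def)
  have "(\<lambda>\<omega>. \<Sum>i<n. V \<omega> $ i * V' \<omega> $ i) \<in> borel_measurable N" by measurable
  then show ?thesis
  proof (rule measurable_cong[THEN iffD1, rotated])
    fix \<omega> assume "\<omega> \<in> space N"
    then have "V' \<omega> \<in> carrier_vec n" using assms by (auto simp: random_vec_def)
    then show "(\<Sum>i<n. V \<omega> $ i * V' \<omega> $ i) = V \<omega> \<bullet> V' \<omega>" by (simp add: scalar_prod_def lessThan_atLeast0)
  qed
qed

lemma random_vec_const: "x \<in> carrier_vec n \<Longrightarrow> random_vec N n (\<lambda>\<omega>. x)"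
  by (simp add: random_vec_def)

lemma random_vec_mult_mat:
  assumes A: "A \<in> carrier_mat n n" and V: "random_vec N n V"
  shows "random_vec N n (\<lambda>\<omega>. A *\<^sub>v V \<omega>)"
  unfolding random_vec_def
proof (intro conjI allI impI funcsetI)
  fix i assume i: "i < n"
  have r: "random_vec N n (\<lambda>\<omega>. row A i)" by (rule random_vec_const) (use A i in auto)
  show "(\<lambda>\<omega>. (A *\<^sub>v V \<omega>) $ i) \<in> borel_measurable N"
    using scalar_prod_measurable[OF r V] A i by simp
qed (use A V in \<open>auto simp: random_vec_def intro: mult_mat_vec_carrier\<close>)

lemma random_vec_vperm:
  assumes q: "q permutes {..<n}" and V: "random_vec N n V"
  shows "random_vec N n (\<lambda>\<omega>. vperm n q (V \<omega>))"
  using V permutes_in_image[OF q] by (auto simp: random_vec_def vperm_def)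

lemma random_vec_add:
  assumes "random_vec N n V" "random_vec N n V'"
  shows "random_vec N n (\<lambda>\<omega>. V \<omega> + V' \<omega>)"
  unfolding random_vec_def
proof (intro conjI allI impI funcsetI)
  fix i assume i: "i < n"
  have "(\<lambda>\<omega>. V \<omega> $ i + V' \<omega> $ i) \<in> borel_measurable N"
  proof -
    have [measurable]: "(\<lambda>\<omega>. V \<omega> $ i) \<in> borel_measurable N" "(\<lambda>\<omega>. V' \<omega> $ i) \<in> borel_measurable N"
      using assms i by (simp_all add: random_vec_def)
    show ?thesis by measurable
  qed
  then show "(\<lambda>\<omega>. (V \<omega> + V' \<omega>) $ i) \<in> borel_measurable N"
    by (rule measurable_cong[THEN iffD1, rotated]) (use assms i in \<open>auto simp: random_vec_def Pi_iff carrier_vecD\<close>)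
qed (use assms in \<open>auto simp: random_vec_def intro: add_carrier_vec minus_carrier_vec\<close>)

lemma random_vec_smult:
  assumes f: "f \<in> borel_measurable N" and V: "random_vec N n V"
  shows "random_vec N n (\<lambda>\<omega>. f \<omega> \<cdot>\<^sub>v V \<omega>)"
  unfolding random_vec_def
proof (intro conjI allI impI funcsetI)
  fix i assume i: "i < n"
  have "(\<lambda>\<omega>. f \<omega> * V \<omega> $ i) \<in> borel_measurable N" using f V i by (auto simp: random_vec_def)
  then show "(\<lambda>\<omega>. (f \<omega> \<cdot>\<^sub>v V \<omega>) $ i) \<in> borel_measurable N"
    by (rule measurable_cong[THEN iffD1, rotated]) (use V i in \<open>auto simp: random_vec_def Pi_iff carrier_vecD\<close>)
qed (use V in \<open>auto simp: random_vec_def\<close>)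

lemma random_vec_minus:
  assumes "random_vec N n V" "random_vec N n V'"
  shows "random_vec N n (\<lambda>\<omega>. V \<omega> - V' \<omega>)"
  unfolding random_vec_def
proof (intro conjI allI impI funcsetI)
  fix i assume i: "i < n"
  have "(\<lambda>\<omega>. V \<omega> $ i - V' \<omega> $ i) \<in> borel_measurable N"
  proof -
    have [measurable]: "(\<lambda>\<omega>. V \<omega> $ i) \<in> borel_measurable N" "(\<lambda>\<omega>. V' \<omega> $ i) \<in> borel_measurable N"
      using assms i by (simp_all add: random_vec_def)
    show ?thesis by measurable
  qed
  then show "(\<lambda>\<omega>. (V \<omega> - V' \<omega>) $ i) \<in> borel_measurable N"
    by (rule measurable_cong[THEN iffD1, rotated]) (use assms i in \<open>auto simp: random_vec_def Pi_iff carrier_vecD\<close>)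
qed (use assms in \<open>auto simp: random_vec_def intro: add_carrier_vec minus_carrier_vec\<close>)

text \<open>Characteristic functions treat densities and point masses alike; process and noise may
  both have degenerate functionals.\<close>

lemma (in prob_space) centered_normal_sum:
  assumes ind: "indep_vars (\<lambda>_. borel) L I" and fin: "finite I"
    and d: "\<And>l. l \<in> I \<Longrightarrow> distr M borel (L l) = centered_normal (v l)" and v: "\<And>l. l \<in> I \<Longrightarrow> 0 \<le> v l"
  shows "distr M borel (\<lambda>\<omega>. \<Sum>l\<in>I. L l \<omega>) = centered_normal (\<Sum>l\<in>I. v l)"
proof (rule Levy_uniqueness)
  have [measurable]: "l \<in> I \<Longrightarrow> L l \<in> borel_measurable M" for l
    using ind unfolding indep_vars_def2 by simp
  show "real_distribution (distr M borel (\<lambda>\<omega>. \<Sum>l\<in>I. L l \<omega>))"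
    by (rule real_distribution_distr) measurable
  show "real_distribution (centered_normal (\<Sum>l\<in>I. v l))"
    by (rule real_distribution_centered_normal) (simp add: sum_nonneg v)
  show "char (distr M borel (\<lambda>\<omega>. \<Sum>l\<in>I. L l \<omega>)) = char (centered_normal (\<Sum>l\<in>I. v l))"
  proof
    fix t
    have "char (distr M borel (\<lambda>\<omega>. \<Sum>l\<in>I. L l \<omega>)) t = (\<Prod>l\<in>I. char (distr M borel (L l)) t)"
      by (rule char_distr_sum[OF ind])
    also have "\<dots> = (\<Prod>l\<in>I. complex_of_real (exp (- v l * t\<^sup>2 / 2)))"
      by (rule prod.cong) (simp_all add: d v char_centered_normal)
    also have "\<dots> = complex_of_real (exp (\<Sum>l\<in>I. - v l * t\<^sup>2 / 2))"
      using fin by (simp add: exp_sum)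
    also have "(\<Sum>l\<in>I. - v l * t\<^sup>2 / 2) = - (\<Sum>l\<in>I. v l) * t\<^sup>2 / 2"
      by (simp add: sum_divide_distrib sum_distrib_right sum_negf)
    finally show "char (distr M borel (\<lambda>\<omega>. \<Sum>l\<in>I. L l \<omega>)) t = char (centered_normal (\<Sum>l\<in>I. v l)) t"
      by (simp add: char_centered_normal sum_nonneg v)
  qed
qed

lemma std_gaussian_family_subfamily:
  assumes g: "std_gaussian_family M n \<xi>" and f: "\<And>k. k < m \<Longrightarrow> f k < n" and inj: "inj_on f {..<m}"
  shows "std_gaussian_family M m (\<lambda>k. \<xi> (f k))"
proof -
  have pick: "(\<Sum>j<n. (if j = f k then 1 else 0) * g j) = g (f k)" if "k < m" for k and g :: "nat \<Rightarrow> real"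
  proof -
    have "(\<Sum>j<n. (if j = f k then 1 else 0) * g j) = (\<Sum>j<n. if j = f k then g j else 0)"
      by (rule sum.cong) auto
    then show ?thesis using f[OF that] by simp
  qed
  have fam: "std_gaussian_family M m (\<lambda>k \<omega>. \<Sum>j<n. (if j = f k then 1 else 0) * \<xi> j \<omega>)"
  proof (rule std_gaussian_family_orthonormal[OF g])
    fix k l assume kl: "k < m" "l < m"
    then show "(\<Sum>j<n. (if j = f k then 1 else 0) * (if j = f l then 1 else 0) :: real) = (if k = l then 1 else 0)"
      unfolding pick[OF kl(1)] using inj_on_eq_iff[OF inj, of k l] by auto
  qed
  have eq: "(\<Sum>k<m. a k * (\<Sum>j<n. (if j = f k then 1 else 0) * \<xi> j \<omega>)) = (\<Sum>k<m. a k * \<xi> (f k) \<omega>)" for a \<omega>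
    by (rule sum.cong) (simp_all only: pick lessThan_iff)
  show ?thesis
    unfolding std_gaussian_family_def
  proof (intro conjI allI impI)
    show "\<xi> (f k) \<in> borel_measurable M" if "k < m" for k
      by (rule std_gaussian_family_measurable[OF g f[OF that]])
    show "distr M borel (\<lambda>\<omega>. \<Sum>k<m. a k * \<xi> (f k) \<omega>) = centered_normal (\<Sum>k<m. (a k)\<^sup>2)" for a
      using spec[OF conjunct2[OF fam[unfolded std_gaussian_family_def]], of a] unfolding eq .
  qed
qed

text \<open>Sites may coincide, so the coefficients are first collected per distinct site.\<close>

lemma isotropic_correlation_quadratic_form:
  fixes n :: nat
  assumes \<rho>: "isotropic_correlation d \<rho>" and s: "\<And>i. i < n \<Longrightarrow> s i \<in> carrier_vec d"
  shows "0 \<le> (\<Sum>i<n. \<Sum>j<n. c i * c j * \<rho> (eucl_dist (s i) (s j)))"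
proof -
  define C where "C p = (\<Sum>i\<in>{i \<in> {..<n}. s i = p}. c i)" for p
  have grp: "(\<Sum>i<n. c i * f (s i)) = (\<Sum>p\<in>s ` {..<n}. C p * f p)" for f
  proof -
    have "(\<Sum>i<n. c i * f (s i)) = (\<Sum>p\<in>s ` {..<n}. \<Sum>i\<in>{i \<in> {..<n}. s i = p}. c i * f (s i))"
      by (rule sum.image_gen) simp
    also have "\<dots> = (\<Sum>p\<in>s ` {..<n}. C p * f p)"
      by (rule sum.cong) (auto simp: C_def sum_distrib_right)
    finally show ?thesis .
  qed
  have "(\<Sum>i<n. \<Sum>j<n. c i * c j * \<rho> (eucl_dist (s i) (s j)))
      = (\<Sum>i<n. c i * (\<Sum>q\<in>s ` {..<n}. C q * \<rho> (eucl_dist (s i) q)))"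
    unfolding grp[symmetric] by (simp add: sum_distrib_left mult.assoc)
  also have "\<dots> = (\<Sum>p\<in>s ` {..<n}. C p * (\<Sum>q\<in>s ` {..<n}. C q * \<rho> (eucl_dist p q)))"
    by (rule grp)
  also have "\<dots> = (\<Sum>p\<in>s ` {..<n}. \<Sum>q\<in>s ` {..<n}. C p * C q * \<rho> (eucl_dist p q))"
    by (simp add: sum_distrib_left mult.assoc)
  also have "0 \<le> \<dots>"
    using \<rho> s unfolding isotropic_correlation_def by (auto simp: image_subset_iff)
  finally show ?thesis .
qed

subsection \<open>The block regression model\<close>

lemma sum_lessThan_add: "(\<Sum>j<n + k. f j) = (\<Sum>j<n. f j) + (\<Sum>j<k. f (n + j :: nat) :: real)"
  by (induction k) (simp_all add: add.assoc)

lemma smult_mat_vec: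
  fixes A :: "real mat"
  assumes "A \<in> carrier_mat n k" "v \<in> carrier_vec k"
  shows "(c \<cdot>\<^sub>m A) *\<^sub>v v = c \<cdot>\<^sub>v (A *\<^sub>v v)"
  using assms by (intro eq_vecI) (auto simp: scalar_prod_def sum_distrib_left mult.assoc)

locale block_gls =
  fixes m :: "'a block_model"
  assumes model: "block_regression_model m"
begin

abbreviation n :: nat where "n \<equiv> nobs m"
abbreviation K :: nat where "K \<equiv> bsize m"
abbreviation B :: nat where "B \<equiv> nblocks m"
abbreviation M :: "'a measure" where "M \<equiv> Pr m"

lemma prob_space_M: "prob_space M"
  and K2: "2 \<le> K" and B1: "1 \<le> B" and sdX_pos: "0 < sdX m"
  and pd: "pos_def_mat n (Sigma_mat m)"
  and gX: "gaussian_vec M n ((sdX m)\<^sup>2 \<cdot>\<^sub>m 1\<^sub>m n) (covariate m)"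
  and gW: "gaussian_vec M n (Sigma_star m) (process m)"
  and gE: "gaussian_vec M n ((sdE m)\<^sup>2 \<cdot>\<^sub>m 1\<^sub>m n) (noise m)"
  and ind: "indep_vecs M n [covariate m, process m, noise m]"
  and iso: "isotropic_correlation (dom_dim m) (corr m)"
  and site: "i < n \<Longrightarrow> site m i \<in> carrier_vec (dom_dim m)"
  using model unfolding block_regression_model_def by auto

lemma n_eq: "n = K * B" by (simp add: nobs_def)
lemma n_pos: "0 < n" using K2 B1 by (simp add: n_eq)

interpretation prob_space M by (rule prob_space_M)

definition sX where "sX = (SOME s. s permutes {..<K} \<and> permX m = perm_mat K s)"
definition sS where "sS = (SOME s. s permutes {..<K} \<and> permS m = perm_mat K s)"

lemma sX: "sX permutes {..<K}" "permX m = perm_mat K sX"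
  and sS: "sS permutes {..<K}" "permS m = perm_mat K sS"
proof -
  have "\<exists>s. s permutes {..<K} \<and> permX m = perm_mat K s" "\<exists>s. s permutes {..<K} \<and> permS m = perm_mat K s"
    using model unfolding block_regression_model_def perm_mats_eq by auto
  from someI_ex[OF this(1)] someI_ex[OF this(2)]
  show "sX permutes {..<K}" "permX m = perm_mat K sX" "sS permutes {..<K}" "permS m = perm_mat K sS"
    by (simp_all add: sX_def sS_def)
qed

definition lift :: "(nat \<Rightarrow> nat) \<Rightarrow> nat \<Rightarrow> nat" where "lift = blift K B"

lemma lift_permutes: "s permutes {..<K} \<Longrightarrow> lift s permutes {..<n}"
  using blift_permutes[of s K B] by (simp add: lift_def n_eq)

lemma lift_vperm:
  assumes "s permutes {..<K}"
  shows "vperm n (lift s) (vperm n (lift t) x) = vperm n (lift (t \<circ> s)) x"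
  using vperm_vperm[OF lift_permutes[OF assms]] blift_comp[OF assms, of B t] by (simp add: lift_def)

lemma lift_vperm_id:
  assumes "x \<in> carrier_vec n"
  shows "vperm n (lift id) x = x"
  using assms by (intro eq_vecI) (auto simp: lift_def blift_id vperm_def)

lemma bdiag_lift: "s permutes {..<K} \<Longrightarrow> x \<in> carrier_vec n \<Longrightarrow> bdiag B (perm_mat K s) *\<^sub>v x = vperm n (lift s) x"
  using bdiag_mult_vec[of s K x B] by (simp add: lift_def n_eq)

definition sS' where "sS' = inv_into UNIV sS"

lemma sS': "sS' permutes {..<K}" "sS \<circ> sS' = id" "sS' \<circ> sS = id"
  using permutes_inv[OF sS(1)] permutes_inv_o[OF sS(1)] by (simp_all add: sS'_def)

text \<open>The index permutation of the relative matrix \<pi>_1, the transpose of \<pi>_S times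
  \<pi>_X, in the order dictated by \<open>lift_vperm\<close>.\<close>

definition relX where "relX = sX \<circ> sS'"

lemma relX: "relX permutes {..<K}"
  unfolding relX_def by (rule permutes_compose[OF sS'(1) sX(1)])

text \<open>Undoing \<pi>_S on the response leaves the process in place and permutes only the noise.
  The noise covariance is a multiple of the identity, so the sum has covariance \<Sigma>
  again.\<close>

definition Wst where "Wst \<omega> = process m \<omega> + vperm n (lift sS') (noise m \<omega>)"

lemma vec_carrier:
  assumes "\<omega> \<in> space M"
  shows "covariate m \<omega> \<in> carrier_vec n" "process m \<omega> \<in> carrier_vec n" "noise m \<omega> \<in> carrier_vec n"
    "Wst \<omega> \<in> carrier_vec n"
  using assms gX gW gE by (auto simp: gaussian_vec_def random_vec_def Wst_def intro!: add_carrier_vec)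

lemma response_eq:
  assumes \<omega>: "\<omega> \<in> space M"
  shows "response m \<omega> = vperm n (lift sS) (Wst \<omega> + slope m \<cdot>\<^sub>v vperm n (lift relX) (covariate m \<omega>))"
proof -
  note c = vec_carrier[OF \<omega>]
  have "vperm n (lift sS) (Wst \<omega> + slope m \<cdot>\<^sub>v vperm n (lift relX) (covariate m \<omega>))
      = vperm n (lift sS) (Wst \<omega>) + slope m \<cdot>\<^sub>v vperm n (lift sS) (vperm n (lift relX) (covariate m \<omega>))"
    by (rule vperm_add_smult[OF lift_permutes[OF sS(1)]]) (use c in simp_all)
  also have "vperm n (lift sS) (vperm n (lift relX) (covariate m \<omega>)) = vperm n (lift sX) (covariate m \<omega>)"
    unfolding lift_vperm[OF sS(1)] relX_def by (simp add: comp_assoc sS')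
  also have "vperm n (lift sS) (Wst \<omega>) = vperm n (lift sS) (process m \<omega> + 1 \<cdot>\<^sub>v vperm n (lift sS') (noise m \<omega>))"
    by (simp add: Wst_def)
  also have "\<dots> = vperm n (lift sS) (process m \<omega>) + 1 \<cdot>\<^sub>v vperm n (lift sS) (vperm n (lift sS') (noise m \<omega>))"
    by (rule vperm_add_smult[OF lift_permutes[OF sS(1)]]) (use c in simp_all)
  also have "vperm n (lift sS) (vperm n (lift sS') (noise m \<omega>)) = noise m \<omega>"
    unfolding lift_vperm[OF sS(1)] sS'(3) by (rule lift_vperm_id[OF c(3)])
  finally show ?thesis
    unfolding response_def sX(2) sS(2) bdiag_lift[OF sX(1) c(1)] bdiag_lift[OF sS(1) c(2)]
    using c by (intro eq_vecI) (auto simp: vperm_def)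
qed

lemma Sigma_star_carrier: "Sigma_star m \<in> carrier_mat n n"
  by (simp add: Sigma_star_def)

lemma Sigma_star_nonneg:
  assumes c: "c \<in> carrier_vec n"
  shows "0 \<le> c \<bullet> (Sigma_star m *\<^sub>v c)"
proof -
  have "c \<bullet> (Sigma_star m *\<^sub>v c)
      = (sdW m)\<^sup>2 * (\<Sum>i<n. \<Sum>j<n. c $ i * c $ j * corr m (eucl_dist (site m i) (site m j)))"
    using c by (simp add: scalar_prod_def Sigma_star_def lessThan_atLeast0 sum_distrib_left mult_ac)
  also have "0 \<le> \<dots>"
    using isotropic_correlation_quadratic_form[OF iso site] by simp
  finally show ?thesis .
qed

text \<open>A functional of the 2n coordinates splits along three independent vectors. With c = R
  a2, process and noise contribute the variances c . Sigma_star c and sdE^2 |c|^2, which add up to c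
  . \<Sigma> c = |a2|^2. Treating covariate and noise as one family also makes them
  independent.\<close>

lemma joint_gaussian:
  "std_gaussian_family M (n + n)
    (\<lambda>j \<omega>. if j < n then covariate m \<omega> $ j / sdX m else (inv_sqrt_mat (Sigma_mat m) *\<^sub>v Wst \<omega>) $ (j - n))"
  (is "std_gaussian_family M (n + n) ?\<zeta>")
  unfolding std_gaussian_family_def
proof (intro conjI allI impI)
  define R where "R = inv_sqrt_mat (Sigma_mat m)"
  note R = inv_sqrt_mat_inverse[OF pd, folded R_def]
  have rv: "random_vec M n (covariate m)" "random_vec M n (process m)" "random_vec M n (noise m)"
    using gX gW gE by (auto simp: gaussian_vec_def)
  have rWst: "random_vec M n Wst"
    unfolding Wst_def[abs_def]
    by (rule random_vec_add[OF rv(2) random_vec_vperm[OF lift_permutes[OF sS'(1)] rv(3)]])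
  {
    fix j assume j: "j < n + n"
    show "?\<zeta> j \<in> borel_measurable M"
      using rv(1) random_vec_mult_mat[OF R(1) rWst] j
      by (cases "j < n") (auto simp: random_vec_def R_def)
  }
  fix a :: "nat \<Rightarrow> real"
  define V where "V l = [covariate m, process m, noise m] ! l" for l
  define a2 where "a2 = vec n (\<lambda>i. a (n + i))"
  define c where "c = R *\<^sub>v a2"
  \<comment> \<open>The noise enters \<open>Wst\<close> through \<open>sS'\<close>, so its
    coefficient vector is c permuted back by \<open>sS\<close>.\<close>
  define co where "co l = [vec n (\<lambda>i. a i / sdX m), c, vperm n (lift sS) c] ! l" for l
  define v where "v l = [\<Sum>j<n. (a j)\<^sup>2, c \<bullet> (Sigma_star m *\<^sub>v c), (sdE m)\<^sup>2 * (c \<bullet> c)] ! l" for l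
  define L where "L l \<omega> = (\<Sum>i<n. co l $ i * V l \<omega> $ i)" for l \<omega>
  have a2: "a2 \<in> carrier_vec n" by (simp add: a2_def)
  have cc: "c \<in> carrier_vec n" using R(1) a2 by (simp add: c_def)
  have co: "co 0 \<in> carrier_vec n" "co (Suc 0) \<in> carrier_vec n" "co (Suc (Suc 0)) \<in> carrier_vec n"
    using cc by (simp_all add: co_def)
  have Lsp: "L l \<omega> = co l \<bullet> V l \<omega>" if "l < 3" "\<omega> \<in> space M" for l \<omega>
  proof -
    have "V l \<omega> \<in> carrier_vec n" using that vec_carrier by (auto simp: V_def less_Suc_eq numeral_3_eq_3)
    then show ?thesis by (simp add: L_def scalar_prod_def lessThan_atLeast0)
  qed
  have "(\<Sum>l<3. L l \<omega>) = (\<Sum>j<n + n. a j * ?\<zeta> j \<omega>)" if \<omega>: "\<omega> \<in> space M" for \<omega>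
  proof -
    note w = vec_carrier[OF \<omega>]
    have RW: "R *\<^sub>v Wst \<omega> \<in> carrier_vec n" using R(1) w(4) by simp
    have a2_dot: "(\<Sum>j<n. a (n + j) * y $ j) = a2 \<bullet> y" if "y \<in> carrier_vec n" for y
      using that by (simp add: a2_def scalar_prod_def lessThan_atLeast0)
    have "(\<Sum>j<n + n. a j * ?\<zeta> j \<omega>) = (\<Sum>j<n. a j * (covariate m \<omega> $ j / sdX m)) + (\<Sum>j<n. a (n + j) * (R *\<^sub>v Wst \<omega>) $ j)"
      by (simp add: sum_lessThan_add R_def)
    also have "(\<Sum>j<n. a (n + j) * (R *\<^sub>v Wst \<omega>) $ j) = a2 \<bullet> (R *\<^sub>v Wst \<omega>)" by (rule a2_dot[OF RW])
    also have "\<dots> = c \<bullet> Wst \<omega>" unfolding c_def by (rule symmetric_mat_swap[OF R(1,2) a2 w(4)])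
    also have "\<dots> = c \<bullet> process m \<omega> + c \<bullet> vperm n (lift sS') (noise m \<omega>)"
      unfolding Wst_def by (rule scalar_prod_add_distrib[OF cc w(2)]) simp
    also have "c \<bullet> vperm n (lift sS') (noise m \<omega>) = vperm n (lift sS) c \<bullet> vperm n (lift sS) (vperm n (lift sS') (noise m \<omega>))"
      by (rule vperm_scalar_prod[symmetric, OF lift_permutes[OF sS(1)]]) simp
    also have "vperm n (lift sS) (vperm n (lift sS') (noise m \<omega>)) = noise m \<omega>"
      unfolding lift_vperm[OF sS(1)] sS'(3) by (rule lift_vperm_id[OF w(3)])
    finally have "(\<Sum>j<n + n. a j * ?\<zeta> j \<omega>) = (\<Sum>j<n. a j * (covariate m \<omega> $ j / sdX m))
        + (c \<bullet> process m \<omega> + vperm n (lift sS) c \<bullet> noise m \<omega>)" .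
    moreover have "(\<Sum>l<3. L l \<omega>) = L 0 \<omega> + (L (Suc 0) \<omega> + L (Suc (Suc 0)) \<omega>)"
      by (simp add: numeral_3_eq_3)
    moreover have "L 0 \<omega> = (\<Sum>j<n. a j * (covariate m \<omega> $ j / sdX m))" by (simp add: L_def co_def V_def)
    moreover have "L (Suc 0) \<omega> = c \<bullet> process m \<omega>" using Lsp[OF _ \<omega>, of "Suc 0"] by (simp add: co_def V_def)
    moreover have "L (Suc (Suc 0)) \<omega> = vperm n (lift sS) c \<bullet> noise m \<omega>"
      using Lsp[OF _ \<omega>, of "Suc (Suc 0)"] by (simp add: co_def V_def)
    ultimately show ?thesis by simp
  qed
  then have "distr M borel (\<lambda>\<omega>. \<Sum>j<n + n. a j * ?\<zeta> j \<omega>) = distr M borel (\<lambda>\<omega>. \<Sum>l<3. L l \<omega>)"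
    by (intro distr_cong) simp_all
  also have "\<dots> = centered_normal (\<Sum>l<3. v l)"
  proof (rule centered_normal_sum)
    have "indep_vars (\<lambda>_. PiM {..<n} (\<lambda>_. borel)) (\<lambda>l \<omega>. \<lambda>i\<in>{..<n}. V l \<omega> $ i) {..<3}"
      using ind by (simp add: indep_vecs_def V_def numeral_3_eq_3)
    then have "indep_vars (\<lambda>_. borel) (\<lambda>l \<omega>. \<Sum>i<n. co l $ i * (\<lambda>i\<in>{..<n}. V l \<omega> $ i) i) {..<3}"
      by (rule indep_vars_compose2) measurable
    then show "indep_vars (\<lambda>_. borel) L {..<3}" by (simp add: L_def[abs_def])
  next
    fix l :: nat assume "l \<in> {..<3}"
    then have l: "l = 0 \<or> l = Suc 0 \<or> l = Suc (Suc 0)" by auto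
    have "distr M borel (L l) = distr M borel (\<lambda>\<omega>. co l \<bullet> V l \<omega>)"
      using l by (intro distr_cong) (auto simp: Lsp)
    moreover have "distr M borel (\<lambda>\<omega>. co 0 \<bullet> covariate m \<omega>) = centered_normal (co 0 \<bullet> (((sdX m)\<^sup>2 \<cdot>\<^sub>m 1\<^sub>m n) *\<^sub>v co 0))"
      using gX co(1) by (simp add: gaussian_vec_def)
    moreover have "co 0 \<bullet> (((sdX m)\<^sup>2 \<cdot>\<^sub>m 1\<^sub>m n) *\<^sub>v co 0) = v 0"
      using sdX_pos by (simp add: co_def v_def smult_mat_vec[of _ n n] scalar_prod_def lessThan_atLeast0
          sum_distrib_left power2_eq_square)
    moreover have "distr M borel (\<lambda>\<omega>. co (Suc 0) \<bullet> process m \<omega>) = centered_normal (v (Suc 0))"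
      using gW cc by (simp add: gaussian_vec_def co_def v_def)
    moreover have "distr M borel (\<lambda>\<omega>. co (Suc (Suc 0)) \<bullet> noise m \<omega>)
        = centered_normal (co (Suc (Suc 0)) \<bullet> (((sdE m)\<^sup>2 \<cdot>\<^sub>m 1\<^sub>m n) *\<^sub>v co (Suc (Suc 0))))"
      using gE co(3) by (simp add: gaussian_vec_def)
    moreover have "co (Suc (Suc 0)) \<bullet> (((sdE m)\<^sup>2 \<cdot>\<^sub>m 1\<^sub>m n) *\<^sub>v co (Suc (Suc 0))) = v (Suc (Suc 0))"
      using vperm_scalar_prod[OF lift_permutes[OF sS(1)] cc, of c]
      by (simp add: co_def v_def smult_mat_vec[of _ n n])
    ultimately show "distr M borel (L l) = centered_normal (v l)"
      using l by (auto simp: V_def)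
    show "0 \<le> v l" using l Sigma_star_nonneg[OF cc] scalar_prod_self_nonneg[of c] by (auto simp: v_def sum_nonneg)
  qed simp
  also have "(\<Sum>l<3. v l) = (\<Sum>j<n + n. (a j)\<^sup>2)"
  proof -
    have "c \<bullet> (Sigma_mat m *\<^sub>v c) = c \<bullet> (Sigma_star m *\<^sub>v c) + (sdE m)\<^sup>2 * (c \<bullet> c)"
      unfolding Sigma_mat_def using cc Sigma_star_carrier
      by (simp add: add_mult_distrib_mat_vec[of _ n n] smult_mat_vec[of _ n n]
          scalar_prod_add_distrib[of _ n])
    moreover have "c \<bullet> (Sigma_mat m *\<^sub>v c) = a2 \<bullet> a2"
      unfolding c_def R_def by (rule inv_sqrt_mat_quadratic_form[OF pd a2])
    moreover have "a2 \<bullet> a2 = (\<Sum>j<n. (a (n + j))\<^sup>2)"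
      by (simp add: a2_def scalar_prod_def lessThan_atLeast0 power2_eq_square)
    ultimately show ?thesis by (simp add: v_def numeral_3_eq_3 sum_lessThan_add)
  qed
  finally show "distr M borel (\<lambda>\<omega>. \<Sum>j<n + n. a j * ?\<zeta> j \<omega>) = centered_normal (\<Sum>j<n + n. (a j)\<^sup>2)" .
qed

lemma random_covariate: "random_vec M n (covariate m)"
  using gX by (auto simp: gaussian_vec_def)

lemma random_Wst: "random_vec M n Wst"
  unfolding Wst_def[abs_def] using gW gE
  by (intro random_vec_add random_vec_vperm[OF lift_permutes[OF sS'(1)]]) (auto simp: gaussian_vec_def)

lemma covariate_gaussian: "std_gaussian_family M n (\<lambda>j \<omega>. covariate m \<omega> $ j / sdX m)"
proof -
  have "std_gaussian_family M n (\<lambda>k \<omega>. if k < n then covariate m \<omega> $ k / sdX m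
      else (inv_sqrt_mat (Sigma_mat m) *\<^sub>v Wst \<omega>) $ (k - n))"
    by (rule std_gaussian_family_subfamily[OF joint_gaussian, of n "\<lambda>k. k"]) auto
  then show ?thesis unfolding std_gaussian_family_def by simp
qed

lemma Wst_gaussian: "std_gaussian_family M n (\<lambda>j \<omega>. (inv_sqrt_mat (Sigma_mat m) *\<^sub>v Wst \<omega>) $ j)"
  using std_gaussian_family_subfamily[OF joint_gaussian, of n "\<lambda>k. n + k"] by (simp add: inj_on_def)

sublocale gls_noise M n "Sigma_mat m" Wst
  by (intro gls_noise.intro prob_space_M gls_noise_axioms.intro pd n_pos vec_carrier Wst_gaussian)

text \<open>Freezes the covariate. The event is transported to the product space of the standardized
  coordinates, where the two blocks are independent; the measurability hypothesis is therefore
  required for arbitrary random vectors on that space and not just on the space of the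
  model.\<close>

lemma conditional_bound:
  fixes P :: "real vec \<Rightarrow> real vec \<Rightarrow> bool"
  assumes meas: "\<And>(N :: ((nat \<Rightarrow> real) \<times> (nat \<Rightarrow> real)) measure) x w.
      random_vec N n x \<Longrightarrow> random_vec N n w \<Longrightarrow> {z \<in> space N. P (x z) (w z)} \<in> sets N"
    and bound: "\<And>x. x \<in> carrier_vec n \<Longrightarrow> prob {\<omega> \<in> space M. P x (Wst \<omega>)} \<le> p" and p: "0 \<le> p"
  shows "prob {\<omega> \<in> space M. P (covariate m \<omega>) (Wst \<omega>)} \<le> p"
proof -
  define \<zeta> where "\<zeta> = (\<lambda>j \<omega>. if j < n then covariate m \<omega> $ j / sdX m else (R *\<^sub>v Wst \<omega>) $ (j - n))"
  have "std_gaussian_family M (n + n) \<zeta>" using joint_gaussian by (simp only: \<zeta>_def R_def)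
  from std_gaussian_family_indep[OF this]
  have ind: "indep_var (PiM {..<n} (\<lambda>_. borel)) (\<lambda>\<omega>. \<lambda>i\<in>{..<n}. \<zeta> i \<omega>) (PiM {n..<n + n} (\<lambda>_. borel)) (\<lambda>\<omega>. \<lambda>i\<in>{n..<n + n}. \<zeta> i \<omega>)"
    by (rule indep_var_restrict) auto
  define N where "N = PiM {..<n} (\<lambda>_. borel :: real measure) \<Otimes>\<^sub>M PiM {n..<n + n} (\<lambda>_. borel :: real measure)"
  \<comment> \<open>The inverse of R, which recovers \<open>Wst\<close> from its whitened
    coordinates.\<close>
  define T where "T = Sigma_mat m * R"
  note Rinv = inv_sqrt_mat_inverse[OF pd, folded R_def, folded T_def]
  define x where "x f = vec n (\<lambda>i. sdX m * f i)" for f :: "nat \<Rightarrow> real"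
  define w where "w f = T *\<^sub>v vec n (\<lambda>i. f (n + i))" for f :: "nat \<Rightarrow> real"
  have rx: "random_vec N n (\<lambda>z. x (fst z))"
    unfolding random_vec_def x_def N_def by (auto intro!: measurable_component_singleton[THEN measurable_compose[OF measurable_fst]])
  have rv: "random_vec N n (\<lambda>z. vec n (\<lambda>i. snd z (n + i)))"
    unfolding random_vec_def N_def by (auto intro!: measurable_component_singleton[THEN measurable_compose[OF measurable_snd]])
  have rw: "random_vec N n (\<lambda>z. w (snd z))"
    unfolding w_def by (rule random_vec_mult_mat[OF Rinv(3) rv])
  define E where "E = {z \<in> space N. P (x (fst z)) (w (snd z))}"
  have E: "E \<in> sets N" unfolding E_def by (rule meas[OF rx rw])
  have x\<omega>: "x (\<lambda>i\<in>{..<n}. \<zeta> i \<omega>) = covariate m \<omega>" if "\<omega> \<in> space M" for \<omega>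
    using vec_carrier(1)[OF that] sdX_pos by (intro eq_vecI) (auto simp: x_def \<zeta>_def)
  have w\<omega>: "w (\<lambda>i\<in>{n..<n + n}. \<zeta> i \<omega>) = Wst \<omega>" if \<omega>: "\<omega> \<in> space M" for \<omega>
  proof -
    have "vec n (\<lambda>i. (\<lambda>i\<in>{n..<n + n}. \<zeta> i \<omega>) (n + i)) = R *\<^sub>v Wst \<omega>"
      using carrier_vecD[OF R_vec, of "Wst \<omega>"] by (intro eq_vecI) (auto simp: \<zeta>_def)
    then have "w (\<lambda>i\<in>{n..<n + n}. \<zeta> i \<omega>) = T *\<^sub>v (R *\<^sub>v Wst \<omega>)" by (simp add: w_def)
    then show ?thesis
      using assoc_mult_mat_vec[OF Rinv(3,1) vec_carrier(4)[OF \<omega>]] Rinv(5) vec_carrier(4)[OF \<omega>] by simp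
  qed
  have sp: "(\<lambda>i\<in>{..<n}. f i) \<in> space (PiM {..<n} (\<lambda>_. borel :: real measure))"
    "(\<lambda>i\<in>{n..<n + n}. f i) \<in> space (PiM {n..<n + n} (\<lambda>_. borel :: real measure))" for f
    by (auto simp: space_PiM)
  have "prob {\<omega> \<in> space M. (\<lambda>i\<in>{..<n}. \<zeta> i \<omega>, \<lambda>i\<in>{n..<n + n}. \<zeta> i \<omega>) \<in> E} \<le> p"
  proof (rule indep_var_conditional_bound[OF ind E[unfolded N_def] _ p])
    fix f assume f: "f \<in> space (PiM {..<n} (\<lambda>_. borel :: real measure))"
    have "{\<omega> \<in> space M. (f, \<lambda>i\<in>{n..<n + n}. \<zeta> i \<omega>) \<in> E} = {\<omega> \<in> space M. P (x f) (Wst \<omega>)}"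
      using f sp(2) by (intro Collect_cong conj_cong refl) (simp add: E_def N_def space_pair_measure w\<omega>)
    then show "prob {\<omega> \<in> space M. (f, \<lambda>i\<in>{n..<n + n}. \<zeta> i \<omega>) \<in> E} \<le> p"
      using bound[of "x f"] by (simp add: x_def)
  qed
  moreover have "{\<omega> \<in> space M. (\<lambda>i\<in>{..<n}. \<zeta> i \<omega>, \<lambda>i\<in>{n..<n + n}. \<zeta> i \<omega>) \<in> E} = {\<omega> \<in> space M. P (covariate m \<omega>) (Wst \<omega>)}"
    using sp by (intro Collect_cong conj_cong refl) (simp add: E_def N_def space_pair_measure w\<omega> x\<omega>)
  ultimately show ?thesis by simp
qed

end

subsection \<open>Tail bounds for a single candidate\<close>

text \<open>By 4m \<le> (1 + m)^2 the fourth power of each factor is at most 1 / m j, and these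
  reciprocals multiply to 1.\<close>

lemma prod_two_div_le_one:
  fixes n :: nat
  assumes m: "\<And>j. j < n \<Longrightarrow> 0 < (m j :: real)" and prod: "(\<Prod>j<n. m j) = 1"
  shows "(\<Prod>j<n. sqrt (2 / (1 + m j))) \<le> 1"
proof -
  have "(\<Prod>j<n. sqrt (2 / (1 + m j))) ^ 4 = (\<Prod>j<n. (2 / (1 + m j))\<^sup>2)"
    unfolding prod_power_distrib
  proof (rule prod.cong[OF refl])
    fix j assume "j \<in> {..<n}"
    then have "0 \<le> 2 / (1 + m j)" using m[of j] by simp
    then have "((sqrt (2 / (1 + m j)))\<^sup>2)\<^sup>2 = (2 / (1 + m j))\<^sup>2" by simp
    then show "sqrt (2 / (1 + m j)) ^ 4 = (2 / (1 + m j))\<^sup>2" by (simp only: power_mult[symmetric]) simp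
  qed
  also have "\<dots> \<le> (\<Prod>j<n. 1 / m j)"
  proof (rule prod_mono, safe)
    fix j assume "j < n"
    then have mj: "0 < m j" by (rule m)
    have "4 * m j \<le> (1 + m j)\<^sup>2" using zero_le_power2[of "1 - m j"] by (simp add: power2_eq_square algebra_simps)
    then show "(2 / (1 + m j))\<^sup>2 \<le> 1 / m j" using mj by (simp add: power_divide divide_simps)
  qed simp
  also have "\<dots> = 1" using prod by (simp add: prod_dividef)
  finally have "(\<Prod>j<n. sqrt (2 / (1 + m j))) ^ 4 \<le> 1" .
  moreover have "0 \<le> (\<Prod>j<n. sqrt (2 / (1 + m j)))"
    using m by (intro prod_nonneg) (auto simp: less_imp_le add_nonneg_nonneg)
  ultimately show ?thesis using power_le_one_iff[of "\<Prod>j<n. sqrt (2 / (1 + m j))" 4] by simp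
qed

lemma prod_two_div_le_inverse_sqrt:
  fixes n :: nat
  assumes m: "\<And>j. j < n \<Longrightarrow> 0 < (m j :: real)" and H: "0 < H" "H \<le> (\<Prod>j<n. (1 + m j) / 2)"
  shows "(\<Prod>j<n. sqrt (2 / (1 + m j))) \<le> 1 / sqrt H"
proof -
  have pos: "0 \<le> (\<Prod>j<n. 2 / (1 + m j))" using m by (intro prod_nonneg) (auto simp: less_imp_le add_nonneg_nonneg)
  have "(\<Prod>j<n. 2 / (1 + m j)) = 1 / (\<Prod>j<n. (1 + m j) / 2)" by (simp add: prod_dividef)
  also have "\<dots> \<le> 1 / H" using H by (simp add: frac_le)
  finally have "sqrt (\<Prod>j<n. 2 / (1 + m j)) \<le> sqrt (1 / H)" by simp
  moreover have "sqrt (\<Prod>j<k. 2 / (1 + m j)) = (\<Prod>j<k. sqrt (2 / (1 + m j)))" for k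
    by (induction k) (simp_all only: lessThan_Suc prod.insert finite_lessThan lessThan_iff less_irrefl
        not_False_eq_True real_sqrt_mult mult.commute lessThan_0 prod.empty real_sqrt_one)
  ultimately show ?thesis by (simp add: real_sqrt_divide)
qed

text \<open>Because the \<open>m j\<close> multiply to 1, the square of the product of all (1 + m j)
  / 2 is the product of the 1 + x j, where x j = (1 - m j)^2 / (4 m j). It dominates 1 plus the sum
  of the x j, so this sum is at most H^2. Each single factor bounds m j by 4 H^2, and (m j - 1)^2 =
  4 (m j) (x j) is summed.\<close>

lemma sum_sq_dev_le:
  fixes n :: nat
  assumes m: "\<And>j. j < n \<Longrightarrow> 0 < (m j :: real)" and prod: "(\<Prod>j<n. m j) = 1"
    and H: "(\<Prod>j<n. (1 + m j) / 2) \<le> H"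
  shows "(\<Sum>j<n. (m j - 1)\<^sup>2) \<le> 16 * H ^ 4"
proof -
  define x where "x j = (1 - m j)\<^sup>2 / (4 * m j)" for j
  have x0: "0 \<le> x j" if "j < n" for j using m[OF that] by (simp add: x_def)
  have x1: "1 + x j = ((1 + m j) / 2)\<^sup>2 / m j" if "j < n" for j
    using m[OF that] by (simp add: x_def field_simps power2_eq_square)
  have H0: "0 \<le> (\<Prod>j<n. (1 + m j) / 2)" using m by (intro prod_nonneg) (auto simp: less_imp_le add_nonneg_nonneg)
  have "1 + (\<Sum>j<k. x j) \<le> (\<Prod>j<k. 1 + x j)" if "k \<le> n" for k
    using that
  proof (induction k)
    case (Suc k)
    then have IH: "1 + (\<Sum>j<k. x j) \<le> (\<Prod>j<k. 1 + x j)" and xk: "0 \<le> x k" and S: "0 \<le> (\<Sum>j<k. x j)"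
      using x0 by (auto intro!: sum_nonneg)
    have "1 + (\<Sum>j<Suc k. x j) \<le> (1 + (\<Sum>j<k. x j)) * (1 + x k)"
      using xk S by (simp add: algebra_simps)
    also have "\<dots> \<le> (\<Prod>j<Suc k. 1 + x j)" using mult_right_mono[OF IH, of "1 + x k"] xk by simp
    finally show ?case .
  qed simp
  from this[OF order_refl] have "1 + (\<Sum>j<n. x j) \<le> (\<Prod>j<n. ((1 + m j) / 2)\<^sup>2 / m j)"
    using x1 by simp
  also have "\<dots> = (\<Prod>j<n. ((1 + m j) / 2)\<^sup>2) / (\<Prod>j<n. m j)" by (rule prod_dividef)
  also have "\<dots> = (\<Prod>j<n. (1 + m j) / 2)\<^sup>2" by (simp only: prod prod_power_distrib div_by_1)
  also have "\<dots> \<le> H\<^sup>2" using H H0 by (rule power_mono)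
  finally have S: "1 + (\<Sum>j<n. x j) \<le> H\<^sup>2" .
  have "(\<Sum>j<n. (m j - 1)\<^sup>2) \<le> (\<Sum>j<n. 16 * H\<^sup>2 * x j)"
  proof (rule sum_mono)
    fix j assume "j \<in> {..<n}"
    then have j: "j < n" and mj: "0 < m j" using m by auto
    have "x j \<le> (\<Sum>j<n. x j)" by (rule member_le_sum) (use j x0 in auto)
    then have "((1 + m j) / 2)\<^sup>2 / m j \<le> H\<^sup>2" using S x1[OF j] by simp
    then have "(1 + m j)\<^sup>2 \<le> 4 * H\<^sup>2 * m j" using mj by (simp add: field_simps power2_eq_square)
    moreover have "m j * m j \<le> (1 + m j)\<^sup>2" using mj by (simp add: power2_eq_square algebra_simps)
    ultimately have "m j * m j \<le> (4 * H\<^sup>2) * m j" by simp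
    then have "m j \<le> 4 * H\<^sup>2" using mj by simp
    then have "m j * (4 * x j) \<le> 4 * H\<^sup>2 * (4 * x j)" using x0[OF j] by (intro mult_right_mono) auto
    moreover have "m j * (4 * x j) = (m j - 1)\<^sup>2" using mj by (simp add: x_def power2_commute)
    ultimately show "(m j - 1)\<^sup>2 \<le> 16 * H\<^sup>2 * x j" by simp
  qed
  also have "\<dots> = 16 * H\<^sup>2 * (\<Sum>j<n. x j)" by (simp add: sum_distrib_left)
  also have "\<dots> \<le> 16 * H\<^sup>2 * H\<^sup>2" using S by (intro mult_left_mono) auto
  finally show ?thesis by (simp add: power4_eq_xxxx power2_eq_square mult_ac)
qed

abbreviation chi_rate :: real where "chi_rate \<equiv> exp (1 / 8) * sqrt (3 / 4)"

context block_gls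
begin

interpretation prob_space M by (rule prob_space_M)

text \<open>Candidates are coded by (g, v): v permutes the covariate, and g is the permutation that
  then acts in common on it and on the noise. A correct covariate means v = \<open>relX\<close>,
  whatever g is.\<close>

definition cand_x where "cand_x g v c = R *\<^sub>v vperm n (lift g) (vperm n (lift v) c)"
definition cand_y where "cand_y g c w = R *\<^sub>v vperm n (lift g) (w + slope m \<cdot>\<^sub>v vperm n (lift relX) c)"
definition cand_slope where "cand_slope g v c w = inverse (cand_x g v c \<bullet> cand_x g v c) * (cand_x g v c \<bullet> cand_y g c w)"
definition cand_rss where "cand_rss g v c w =
  (cand_y g c w - cand_slope g v c w \<cdot>\<^sub>v cand_x g v c) \<bullet> (cand_y g c w - cand_slope g v c w \<cdot>\<^sub>v cand_x g v c)"
text \<open>The first condition is necessary for being selected, since the true permutations with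
  the true slope attain the right-hand side. Comparing with this value avoids the minimum over all
  candidates.\<close>

definition bad where "bad g v t c w \<longleftrightarrow>
  cand_rss g v c w \<le> (R *\<^sub>v w) \<bullet> (R *\<^sub>v w) \<and> t < \<bar>cand_slope g v c w - slope m\<bar>"

lemma cand_measurable:
  assumes g: "g permutes {..<K}" and v: "v permutes {..<K}" and x: "random_vec N n x" and w: "random_vec N n w"
  shows "(\<lambda>z. cand_slope g v (x z) (w z)) \<in> borel_measurable N"
    and "(\<lambda>z. cand_rss g v (x z) (w z)) \<in> borel_measurable N"
    and "(\<lambda>z. (R *\<^sub>v w z) \<bullet> (R *\<^sub>v w z)) \<in> borel_measurable N"
proof -
  have X: "random_vec N n (\<lambda>z. cand_x g v (x z))"
    unfolding cand_x_def
    by (intro random_vec_mult_mat[OF R_carrier] random_vec_vperm lift_permutes g v x)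
  have Y: "random_vec N n (\<lambda>z. cand_y g (x z) (w z))"
    unfolding cand_y_def
    by (intro random_vec_mult_mat[OF R_carrier] random_vec_vperm lift_permutes g random_vec_add w
        random_vec_smult relX x borel_measurable_const)
  have [measurable]: "(\<lambda>z. cand_x g v (x z) \<bullet> cand_x g v (x z)) \<in> borel_measurable N"
    "(\<lambda>z. cand_x g v (x z) \<bullet> cand_y g (x z) (w z)) \<in> borel_measurable N"
    by (rule scalar_prod_measurable[OF X X], rule scalar_prod_measurable[OF X Y])
  show s: "(\<lambda>z. cand_slope g v (x z) (w z)) \<in> borel_measurable N"
    unfolding cand_slope_def by measurable
  show "(\<lambda>z. cand_rss g v (x z) (w z)) \<in> borel_measurable N"
    unfolding cand_rss_def by (intro scalar_prod_measurable[where n = n] random_vec_minus random_vec_smult X Y s)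
  show "(\<lambda>z. (R *\<^sub>v w z) \<bullet> (R *\<^sub>v w z)) \<in> borel_measurable N"
    by (intro scalar_prod_measurable[where n = n] random_vec_mult_mat[OF R_carrier] w)
qed

lemma bad_measurable:
  assumes g: "g permutes {..<K}" and v: "v permutes {..<K}" and x: "random_vec N n x" and w: "random_vec N n w"
  shows "Measurable.pred N (\<lambda>z. bad g v t (x z) (w z))"
proof -
  note [measurable] = cand_measurable[OF assms]
  show ?thesis unfolding bad_def by measurable
qed

lemma covariate_norm_tail:
  "prob {\<omega> \<in> space M. covariate m \<omega> \<bullet> covariate m \<omega> < 3 / 4 * real n * (sdX m)\<^sup>2} \<le> chi_rate ^ n"
proof -
  have "{\<omega> \<in> space M. covariate m \<omega> \<bullet> covariate m \<omega> < 3 / 4 * real n * (sdX m)\<^sup>2}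
      = {\<omega> \<in> space M. (\<Sum>j<n. (covariate m \<omega> $ j / sdX m)\<^sup>2) < 3 / 4 * real n}"
  proof (intro Collect_cong conj_cong refl)
    fix \<omega> assume \<omega>: "\<omega> \<in> space M"
    have "covariate m \<omega> \<bullet> covariate m \<omega> = (sdX m)\<^sup>2 * (\<Sum>j<n. (covariate m \<omega> $ j / sdX m)\<^sup>2)"
      using carrier_vecD[OF vec_carrier(1)[OF \<omega>]] sdX_pos
      by (simp add: scalar_prod_def lessThan_atLeast0 sum_distrib_left power_divide) (simp add: power2_eq_square)
    then show "(covariate m \<omega> \<bullet> covariate m \<omega> < 3 / 4 * real n * (sdX m)\<^sup>2)
        = ((\<Sum>j<n. (covariate m \<omega> $ j / sdX m)\<^sup>2) < 3 / 4 * real n)"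
      using sdX_pos by (simp add: mult.commute)
  qed
  then show ?thesis using std_gaussian_family_sum_sq_lower_tail[OF covariate_gaussian] by simp
qed

text \<open>Sum and difference of two independent standard normal entries, divided by sqrt 2, are
  standard normal, and different blocks use disjoint entries.\<close>

lemma block_pair_family:
  assumes i: "i < K" and j: "j < K" and ij: "i \<noteq> j" and \<epsilon>: "\<epsilon>\<^sup>2 = (1::real)"
  shows "std_gaussian_family M B
    (\<lambda>b \<omega>. (covariate m \<omega> $ (K * b + i) + \<epsilon> * covariate m \<omega> $ (K * b + j)) / (sqrt 2 * sdX m))"
proof -
  define u where "u b l = (if l = K * b + i then 1 / sqrt 2 else if l = K * b + j then \<epsilon> / sqrt 2 else 0)" for b l
  have less: "K * b + k < n" if "b < B" "k < K" for b k
  proof -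
    have "K * b + K \<le> K * B" using that(1) by (metis Suc_leI mult_Suc_right add.commute mult_le_mono2)
    then show ?thesis using that(2) by (simp add: n_eq)
  qed
  have pick: "(\<Sum>l<n. u b l * f l) = (f (K * b + i) + \<epsilon> * f (K * b + j)) / sqrt 2" if b: "b < B" for b and f :: "nat \<Rightarrow> real"
  proof -
    have "(\<Sum>l<n. u b l * f l) = (\<Sum>l<n. (if l = K * b + i then f l / sqrt 2 else 0) + (if l = K * b + j then \<epsilon> * f l / sqrt 2 else 0))"
      using ij by (intro sum.cong) (auto simp: u_def)
    also have "\<dots> = f (K * b + i) / sqrt 2 + \<epsilon> * f (K * b + j) / sqrt 2"
      using less[OF b i] less[OF b j] by (simp add: sum.distrib)
    finally show ?thesis by (simp add: add_divide_distrib)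
  qed
  have eq: "K * b + k = K * b' + k' \<longleftrightarrow> b = b' \<and> k = k'" if "k < K" "k' < K" for b b' k k'
  proof
    assume e: "K * b + k = K * b' + k'"
    have "(K * b + k) div K = b" "(K * b' + k') div K = b'" using that by simp_all
    with e show "b = b' \<and> k = k'" by simp
  qed simp
  have "std_gaussian_family M B (\<lambda>b \<omega>. \<Sum>l<n. u b l * (covariate m \<omega> $ l / sdX m))"
  proof (rule std_gaussian_family_orthonormal[OF covariate_gaussian])
    fix b b' assume b: "b < B" "b' < B"
    show "(\<Sum>l<n. u b l * u b' l) = (if b = b' then 1 else 0)"
      unfolding pick[OF b(1)] using ij \<epsilon> i j
      by (simp add: u_def eq) (simp add: power2_eq_square field_simps)
  qed
  moreover have "(\<Sum>l<n. u b l * (covariate m \<omega> $ l / sdX m))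
      = (covariate m \<omega> $ (K * b + i) + \<epsilon> * covariate m \<omega> $ (K * b + j)) / (sqrt 2 * sdX m)" if "b < B" for b \<omega>
    unfolding pick[OF that] by (simp add: add_divide_distrib mult.commute)
  ultimately show ?thesis by (rule std_gaussian_family_cong)
qed

text \<open>Let U and V be the two permutations of the covariate X. Then |U + V|^2 and |U - V|^2 are
  2 |X|^2 + 2 U.V and 2 |X|^2 - 2 U.V, so the margin is half of the smaller one; both signs matter
  as b may have either. The entries at one position k of every block, where the permutations
  disagree, already contribute 2 sdX^2 times a chi-square variable with B degrees of
  freedom.\<close>

lemma separation_tail:
  assumes v: "v permutes {..<K}" and ne: "v \<noteq> relX"
  shows "prob {\<omega> \<in> space M. \<not> 3 / 4 * real B * (sdX m)\<^sup>2 \<le> covariate m \<omega> \<bullet> covariate m \<omega>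
      - \<bar>vperm n (lift relX) (covariate m \<omega>) \<bullet> vperm n (lift v) (covariate m \<omega>)\<bar>} \<le> 2 * chi_rate ^ B"
proof -
  let ?E = "{\<omega> \<in> space M. \<not> 3 / 4 * real B * (sdX m)\<^sup>2 \<le> covariate m \<omega> \<bullet> covariate m \<omega>
      - \<bar>vperm n (lift relX) (covariate m \<omega>) \<bullet> vperm n (lift v) (covariate m \<omega>)\<bar>}"
  obtain k where ke: "v k \<noteq> relX k" using ne by auto
  have k: "k < K"
  proof (rule ccontr)
    assume "\<not> k < K"
    then have "v k = k" "relX k = k" using permutes_not_in[OF v, of k] permutes_not_in[OF relX, of k] by auto
    with ke show False by simp
  qed
  have rk: "relX k < K" "v k < K" using permutes_in_image[OF relX, of k] permutes_in_image[OF v, of k] k by auto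
  define \<xi> where "\<xi> \<epsilon> b \<omega> = (covariate m \<omega> $ (K * b + relX k) + \<epsilon> * covariate m \<omega> $ (K * b + v k)) / (sqrt 2 * sdX m)"
    for \<epsilon> :: real and b \<omega>
  let ?X = "\<lambda>\<epsilon>. {\<omega> \<in> space M. (\<Sum>b<B. (\<xi> \<epsilon> b \<omega>)\<^sup>2) < 3 / 4 * real B}"
  have fam: "std_gaussian_family M B (\<xi> \<epsilon>)" if "\<epsilon>\<^sup>2 = 1" for \<epsilon>
    using block_pair_family[OF rk ke[symmetric] that] by (simp add: \<xi>_def[abs_def])
  have [measurable]: "b < B \<Longrightarrow> \<xi> \<epsilon> b \<in> borel_measurable M" if "\<epsilon>\<^sup>2 = 1" for \<epsilon> b
    using std_gaussian_family_measurable[OF fam[OF that]] .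
  have ev: "(?X \<epsilon>) \<in> events" if e: "\<epsilon>\<^sup>2 = 1" for \<epsilon>
  proof -
    have [measurable]: "(\<lambda>\<omega>. \<Sum>b<B. (\<xi> \<epsilon> b \<omega>)\<^sup>2) \<in> borel_measurable M"
      by (intro borel_measurable_sum borel_measurable_power std_gaussian_family_measurable[OF fam[OF e]]) simp
    show ?thesis by measurable
  qed
  have low: "2 * (sdX m)\<^sup>2 * (\<Sum>b<B. (\<xi> \<epsilon> b \<omega>)\<^sup>2)
      \<le> 2 * (covariate m \<omega> \<bullet> covariate m \<omega>) + 2 * \<epsilon> * (vperm n (lift relX) (covariate m \<omega>) \<bullet> vperm n (lift v) (covariate m \<omega>))"
    if \<omega>: "\<omega> \<in> space M" and e: "\<epsilon>\<^sup>2 = 1" for \<epsilon> \<omega>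
  proof -
    define c where "c = covariate m \<omega>"
    have c: "c \<in> carrier_vec n" using vec_carrier(1)[OF \<omega>] by (simp add: c_def)
    define y where "y = vperm n (lift relX) c + \<epsilon> \<cdot>\<^sub>v vperm n (lift v) c"
    have yc: "y \<in> carrier_vec n" by (simp add: y_def)
    have idx: "K * b + k < n" if "b < B" for b
    proof -
      have "K * b + K \<le> K * B" using that by (metis Suc_leI mult_Suc_right add.commute mult_le_mono2)
      then show ?thesis using k by (simp add: n_eq)
    qed
    have lf: "lift s (K * b + k) = K * b + s k" if "b < B" for s b
      using idx[OF that] k by (simp add: lift_def blift_def n_eq)
    have yb: "(y $ (K * b + k))\<^sup>2 = 2 * (sdX m)\<^sup>2 * (\<xi> \<epsilon> b \<omega>)\<^sup>2" if b: "b < B" for b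
    proof -
      have "y $ (K * b + k) = sqrt 2 * sdX m * \<xi> \<epsilon> b \<omega>"
        using idx[OF b] lf[OF b] sdX_pos by (simp add: y_def vperm_def \<xi>_def c_def)
      then show ?thesis by (simp add: power_mult_distrib)
    qed
    have inj: "inj_on (\<lambda>b. K * b + k) {..<B}" using k by (auto simp: inj_on_def)
    have "2 * (sdX m)\<^sup>2 * (\<Sum>b<B. (\<xi> \<epsilon> b \<omega>)\<^sup>2) = (\<Sum>b<B. (y $ (K * b + k))\<^sup>2)"
      unfolding sum_distrib_left by (rule sum.cong) (simp_all add: yb)
    also have "\<dots> = (\<Sum>l\<in>(\<lambda>b. K * b + k) ` {..<B}. (y $ l)\<^sup>2)"
      by (simp add: sum.reindex[OF inj])
    also have "\<dots> \<le> (\<Sum>l<n. (y $ l)\<^sup>2)"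
      by (rule sum_mono2) (use idx in auto)
    also have "\<dots> = y \<bullet> y" using yc by (simp add: scalar_prod_def lessThan_atLeast0 power2_eq_square)
    also have "\<dots> = 2 * (c \<bullet> c) + 2 * \<epsilon> * (vperm n (lift relX) c \<bullet> vperm n (lift v) c)"
      using vperm_scalar_prod[OF lift_permutes[OF relX] c, of c] vperm_scalar_prod[OF lift_permutes[OF v] c, of c]
        comm_scalar_prod[of "vperm n (lift v) c" n "vperm n (lift relX) c"] e
      by (simp add: y_def add_scalar_prod_distrib[of _ n] scalar_prod_add_distrib[of _ n]
          smult_scalar_prod_distrib[of _ n] power2_eq_square algebra_simps flip: mult.assoc)
    finally show ?thesis by (simp add: c_def)
  qed
  have "?E
    \<subseteq> (?X 1) \<union> (?X (- 1))"
  proof safe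
    fix \<omega> assume \<omega>: "\<omega> \<in> space M"
      and n1: "\<not> (\<Sum>b<B. (\<xi> (- 1) b \<omega>)\<^sup>2) < 3 / 4 * real B"
      and sep: "\<not> 3 / 4 * real B * (sdX m)\<^sup>2 \<le> covariate m \<omega> \<bullet> covariate m \<omega>
        - \<bar>vperm n (lift relX) (covariate m \<omega>) \<bullet> vperm n (lift v) (covariate m \<omega>)\<bar>"
    show "(\<Sum>b<B. (\<xi> 1 b \<omega>)\<^sup>2) < 3 / 4 * real B"
    proof (rule ccontr)
      assume n2: "\<not> (\<Sum>b<B. (\<xi> 1 b \<omega>)\<^sup>2) < 3 / 4 * real B"
      have "2 * (sdX m)\<^sup>2 * (3 / 4 * real B) \<le> 2 * (sdX m)\<^sup>2 * (\<Sum>b<B. (\<xi> 1 b \<omega>)\<^sup>2)"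
        "2 * (sdX m)\<^sup>2 * (3 / 4 * real B) \<le> 2 * (sdX m)\<^sup>2 * (\<Sum>b<B. (\<xi> (- 1) b \<omega>)\<^sup>2)"
        using n1 n2 by (intro mult_left_mono; simp)+
      with low[OF \<omega>, of 1] low[OF \<omega>, of "- 1"] sep show False by (simp add: abs_if split: if_splits)
    qed
  qed
  then have "prob ?E
    \<le> prob ((?X 1) \<union> (?X (- 1)))"
    by (rule finite_measure_mono) (intro sets.Un ev, simp_all)
  also have "\<dots> \<le> prob (?X 1)
      + prob (?X (- 1))"
    by (rule measure_Un_le) (intro ev, simp)+
  also have "\<dots> \<le> chi_rate ^ B + chi_rate ^ B"
    by (intro add_mono std_gaussian_family_sum_sq_lower_tail fam) simp_all
  finally show ?thesis by simp
qed

section \<open>Candidates with a wrong relative permutation\<close>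

lemma cond_ge_one: "1 \<le> lmax / lmin"
  using lmin_pos lmin_le_lmax by simp

text \<open>The logarithmic condition says SNR > e, and e is rounded down to 2.\<close>

lemma slope_sq_lower:
  assumes snr: "1 < ln (SNR m)"
  shows "2 * (lmax * (lmax / lmin)) \<le> (slope m)\<^sup>2"
proof -
  have eq: "SNR m = (slope m)\<^sup>2 / (lmax * (lmax / lmin))"
    by (simp add: SNR_def cond_number_def lmax_def lmin_def)
  have d: "0 < lmax * (lmax / lmin)" using lmax_pos lmin_pos by simp
  have "0 \<le> SNR m" unfolding eq using d by (intro divide_nonneg_pos) simp_all
  moreover have "SNR m \<noteq> 0" using snr by auto
  ultimately have "0 < SNR m" by simp
  then have "exp 1 < SNR m" using snr by (metis exp_less_cancel_iff exp_ln)
  moreover have "2 \<le> exp (1::real)" using exp_ge_add_one_self[of 1] by simp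
  ultimately have "2 \<le> SNR m" by linarith
  then show ?thesis unfolding eq by (simp only: pos_le_divide_eq[OF d])
qed

text \<open>On the separation event \<beta> U has squared distance at least 3/4 \<beta>^2 B from the
  line through V, and the lower bound on \<beta>^2 turns the exponent into at least 3 B \<kappa> /
  16. The square root of \<kappa> is absorbed as exp \<kappa>; then \<kappa> \<ge> 1 removes
  \<kappa> altogether provided 3 B / 16 \<ge> 1, which B \<ge> 6 ensures.\<close>

lemma wrong_relative_tail:
  assumes g: "g permutes {..<K}" and v: "v permutes {..<K}" and ne: "v \<noteq> relX"
    and snr: "1 < ln (SNR m)" and sd: "1 \<le> sdX m" and B: "6 \<le> B"
  shows "prob {\<omega> \<in> space M. bad g v t (covariate m \<omega>) (Wst \<omega>)} \<le> 2 * chi_rate ^ B + 2 * exp (- (3 * real B / 16 - 1))"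
proof -
  define \<kappa> where "\<kappa> = lmax / lmin"
  have \<kappa>: "1 \<le> \<kappa>" using cond_ge_one by (simp add: \<kappa>_def)
  define sep where "sep c \<longleftrightarrow> 3 / 4 * real B * (sdX m)\<^sup>2 \<le> c \<bullet> c - \<bar>vperm n (lift relX) c \<bullet> vperm n (lift v) c\<bar>" for c
  have sepm: "Measurable.pred N (\<lambda>z. sep (x z))" if x: "random_vec N n x" for N and x
  proof -
    have [measurable]: "(\<lambda>z. x z \<bullet> x z) \<in> borel_measurable N"
      "(\<lambda>z. vperm n (lift relX) (x z) \<bullet> vperm n (lift v) (x z)) \<in> borel_measurable N"
      by (intro scalar_prod_measurable[where n = n] random_vec_vperm lift_permutes relX v x)+
    show ?thesis unfolding sep_def by measurable
  qed
  have badm: "Measurable.pred M (\<lambda>\<omega>. bad g v t (covariate m \<omega>) (Wst \<omega>))"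
    by (rule bad_measurable[OF g v random_covariate random_Wst])
  note [measurable] = sepm[OF random_covariate] badm
  have "prob {\<omega> \<in> space M. bad g v t (covariate m \<omega>) (Wst \<omega>)}
      \<le> prob ({\<omega> \<in> space M. \<not> sep (covariate m \<omega>)} \<union> {\<omega> \<in> space M. sep (covariate m \<omega>) \<and> bad g v t (covariate m \<omega>) (Wst \<omega>)})"
    by (rule finite_measure_mono) auto
  also have "\<dots> \<le> prob {\<omega> \<in> space M. \<not> sep (covariate m \<omega>)} + prob {\<omega> \<in> space M. sep (covariate m \<omega>) \<and> bad g v t (covariate m \<omega>) (Wst \<omega>)}"
    by (rule measure_Un_le) auto
  also have "prob {\<omega> \<in> space M. \<not> sep (covariate m \<omega>)} \<le> 2 * chi_rate ^ B"
    unfolding sep_def by (rule separation_tail[OF v ne])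
  also have "prob {\<omega> \<in> space M. sep (covariate m \<omega>) \<and> bad g v t (covariate m \<omega>) (Wst \<omega>)} \<le> 2 * exp (- (3 * real B / 16 - 1))"
  proof (rule conditional_bound)
    fix N :: "((nat \<Rightarrow> real) \<times> (nat \<Rightarrow> real)) measure" and x w
    assume xw: "random_vec N n x" "random_vec N n w"
    note [measurable] = sepm[OF xw(1)] bad_measurable[OF g v xw]
    show "{z \<in> space N. sep (x z) \<and> bad g v t (x z) (w z)} \<in> sets N" by measurable
  next
    fix c :: "real vec" assume c: "c \<in> carrier_vec n"
    show "prob {\<omega> \<in> space M. sep c \<and> bad g v t c (Wst \<omega>)} \<le> 2 * exp (- (3 * real B / 16 - 1))"
    proof (cases "sep c")
      case True
      define u where "u = vperm n (lift relX) c"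
      define v' where "v' = vperm n (lift v) c"
      have uu: "u \<bullet> u = c \<bullet> c" and vv: "v' \<bullet> v' = c \<bullet> c"
        unfolding u_def v'_def by (rule vperm_scalar_prod[OF lift_permutes[OF relX] c], rule vperm_scalar_prod[OF lift_permutes[OF v] c])
      have s: "3 / 4 * real B * (sdX m)\<^sup>2 \<le> c \<bullet> c - \<bar>u \<bullet> v'\<bar>" using True by (simp add: sep_def u_def v'_def)
      have "1 * 1 \<le> sdX m * sdX m" using sd by (intro mult_mono) auto
      then have sd2: "1 \<le> (sdX m)\<^sup>2" by (simp add: power2_eq_square)
      have B0: "3 / 4 * real B \<le> 3 / 4 * real B * (sdX m)\<^sup>2" using sd2 by (simp add: mult_le_cancel_left1)
      have Bpos: "0 < 3 / 4 * real B" using B by simp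
      have cc: "0 < c \<bullet> c" using s B0 Bpos by linarith
      \<comment> \<open>The separation event already contains |u . v'| \<le> c . c, so the squared
        cosine term is at most |u . v'|.\<close>
      have "\<bar>u \<bullet> v'\<bar> * \<bar>u \<bullet> v'\<bar> \<le> \<bar>u \<bullet> v'\<bar> * (c \<bullet> c)"
      proof (rule mult_left_mono)
        show "\<bar>u \<bullet> v'\<bar> \<le> c \<bullet> c" using s B0 Bpos by linarith
      qed simp
      then have "(u \<bullet> v')\<^sup>2 / (c \<bullet> c) \<le> \<bar>u \<bullet> v'\<bar>"
        using cc by (simp add: pos_divide_le_eq power2_eq_square flip: abs_mult)
      then have h: "3 / 4 * real B \<le> u \<bullet> u - (u \<bullet> v')\<^sup>2 / (v' \<bullet> v')"
        unfolding uu vv using s B0 by linarith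
      obtain e mm where basis: "gls_basis n R (lift g) e mm"
        using gls_basis_exists[OF pd lift_permutes[OF g]] by (auto simp: R_def)
      note lg = lift_permutes[OF g]
      define D where "D = (slope m)\<^sup>2 * (u \<bullet> u - (u \<bullet> v')\<^sup>2 / (v' \<bullet> v')) / (8 * lmax)"
      have D: "3 * real B / 16 * \<kappa> \<le> D"
      proof -
        have "2 * (lmax * \<kappa>) * (3 / 4 * real B) \<le> (slope m)\<^sup>2 * (u \<bullet> u - (u \<bullet> v')\<^sup>2 / (v' \<bullet> v'))"
          using slope_sq_lower[OF snr] h Bpos lmax_pos \<kappa> by (intro mult_mono) (auto simp: \<kappa>_def)
        then have "2 * (lmax * \<kappa>) * (3 / 4 * real B) / (8 * lmax) \<le> D"
          unfolding D_def using lmax_pos by (intro divide_right_mono) auto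
        then show ?thesis using lmax_pos by (simp add: mult_ac)
      qed
      have "prob {\<omega> \<in> space M. sep c \<and> bad g v t c (Wst \<omega>)}
          \<le> prob {\<omega> \<in> space M. cand_rss g v c (Wst \<omega>) \<le> (R *\<^sub>v Wst \<omega>) \<bullet> (R *\<^sub>v Wst \<omega>) \<and> 0 \<le> \<bar>cand_slope g v c (Wst \<omega>) - slope m * (u \<bullet> v') / (v' \<bullet> v')\<bar>}"
      proof (rule finite_measure_mono)
        note [measurable] = cand_measurable[OF g v random_vec_const[OF c] random_Wst]
        show "{\<omega> \<in> space M. cand_rss g v c (Wst \<omega>) \<le> (R *\<^sub>v Wst \<omega>) \<bullet> (R *\<^sub>v Wst \<omega>) \<and> 0 \<le> \<bar>cand_slope g v c (Wst \<omega>) - slope m * (u \<bullet> v') / (v' \<bullet> v')\<bar>} \<in> events"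
          by measurable
      qed (auto simp: bad_def)
      also have "\<dots> \<le> 2 * sqrt (lmax / lmin) * (\<Prod>j<n. sqrt (2 / (1 + mm j)))
          * exp (- ((slope m)\<^sup>2 * (u \<bullet> u - (u \<bullet> v')\<^sup>2 / (v' \<bullet> v'))) / (8 * lmax) - (v' \<bullet> v') * 0\<^sup>2 / (16 * lmax))"
        unfolding cand_rss_def cand_y_def cand_slope_def cand_x_def u_def v'_def
        by (rule gls_profile_tail[OF lg basis]) (use cc vv in \<open>simp_all add: v'_def\<close>)
      also have "\<dots> \<le> 2 * \<kappa> * 1 * exp (- D)"
      proof -
        have "sqrt \<kappa> \<le> \<kappa>"
          by (rule real_le_lsqrt) (use \<kappa> mult_left_mono[of 1 \<kappa> \<kappa>] in \<open>auto simp: power2_eq_square\<close>)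
        moreover have "(\<Prod>j<n. sqrt (2 / (1 + mm j))) \<le> 1"
          using prod_two_div_le_one[OF m_pos[OF lg basis] m_prod[OF lg basis]] .
        moreover have "0 \<le> (\<Prod>j<n. sqrt (2 / (1 + mm j)))"
          using m_pos[OF lg basis] by (intro prod_nonneg) (auto simp: less_imp_le add_nonneg_nonneg)
        ultimately show ?thesis
          using \<kappa> unfolding \<kappa>_def[symmetric] D_def by (intro mult_mono) auto
      qed
      also have "\<dots> \<le> 2 * exp \<kappa> * 1 * exp (- (3 * real B / 16 * \<kappa>))"
      proof -
        have "\<kappa> \<le> exp \<kappa>" using exp_ge_add_one_self[of \<kappa>] by linarith
        then show ?thesis using D \<kappa> by (intro mult_mono) auto
      qed
      also have "\<dots> = 2 * exp (- ((3 * real B / 16 - 1) * \<kappa>))"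
        by (simp add: exp_add[symmetric] algebra_simps)
      also have "\<dots> \<le> 2 * exp (- (3 * real B / 16 - 1))"
      proof -
        have "(3 * real B / 16 - 1) * 1 \<le> (3 * real B / 16 - 1) * \<kappa>" using \<kappa> B by (intro mult_left_mono) auto
        then show ?thesis by simp
      qed
      finally show ?thesis .
    qed simp
  qed simp
  finally show ?thesis by simp
qed

end

context block_gls
begin

interpretation prob_space M by (rule prob_space_M)

section \<open>Candidates with the true relative permutation\<close>

definition large where "large c \<longleftrightarrow> 3 / 4 * real n * (sdX m)\<^sup>2 \<le> c \<bullet> (c :: real vec)"

lemma large_measurable:
  assumes "random_vec N n x"
  shows "Measurable.pred N (\<lambda>z. large (x z))"
proof -
  note [measurable] = scalar_prod_measurable[OF assms assms]
  show ?thesis unfolding large_def by measurable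
qed

lemma large_pos:
  assumes "large c" "1 \<le> sdX m"
  shows "3 / 4 * real n \<le> c \<bullet> c" "0 < c \<bullet> c"
proof -
  have "1 * 1 \<le> sdX m * sdX m" using assms(2) by (intro mult_mono) auto
  then have "3 / 4 * real n * 1 \<le> 3 / 4 * real n * (sdX m)\<^sup>2" by (intro mult_left_mono) (auto simp: power2_eq_square)
  with assms(1) show "3 / 4 * real n \<le> c \<bullet> c" by (simp add: large_def)
  then show "0 < c \<bullet> c" using n_pos by (smt (verit) mult_pos_pos of_nat_0_less_iff divide_pos_pos)
qed

lemma cand_slope_same:
  "cand_slope g relX c w = inverse ((R *\<^sub>v vperm n (lift g) (vperm n (lift relX) c)) \<bullet> (R *\<^sub>v vperm n (lift g) (vperm n (lift relX) c)))
    * ((R *\<^sub>v vperm n (lift g) (vperm n (lift relX) c)) \<bullet> (R *\<^sub>v vperm n (lift g) (w + slope m \<cdot>\<^sub>v vperm n (lift relX) c)))"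
  by (simp add: cand_slope_def cand_x_def cand_y_def)

text \<open>Here selection is given up: for a frozen covariate of sufficient length the Gaussian
  tail of the slope error suffices.\<close>

lemma same_relative_tail:
  assumes g: "g permutes {..<K}" and sd: "1 \<le> sdX m" and t: "0 \<le> t"
  shows "prob {\<omega> \<in> space M. large (covariate m \<omega>) \<and> bad g relX t (covariate m \<omega>) (Wst \<omega>)}
    \<le> 2 * exp (- (t\<^sup>2 * (3 / 4 * real n)) / (2 * (lmax / lmin) * lmax))"
proof (rule conditional_bound)
  fix N :: "((nat \<Rightarrow> real) \<times> (nat \<Rightarrow> real)) measure" and x w
  assume xw: "random_vec N n x" "random_vec N n w"
  note [measurable] = large_measurable[OF xw(1)] bad_measurable[OF g relX xw]
  show "{z \<in> space N. large (x z) \<and> bad g relX t (x z) (w z)} \<in> sets N" by measurable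
next
  fix c :: "real vec" assume c: "c \<in> carrier_vec n"
  show "prob {\<omega> \<in> space M. large c \<and> bad g relX t c (Wst \<omega>)}
    \<le> 2 * exp (- (t\<^sup>2 * (3 / 4 * real n)) / (2 * (lmax / lmin) * lmax))"
  proof (cases "large c")
    case True
    define u where "u = vperm n (lift relX) c"
    have u: "u \<in> carrier_vec n" by (simp add: u_def)
    have uu: "u \<bullet> u = c \<bullet> c" unfolding u_def by (rule vperm_scalar_prod[OF lift_permutes[OF relX] c])
    obtain e mm where basis: "gls_basis n R (lift g) e mm"
      using gls_basis_exists[OF pd lift_permutes[OF g]] by (auto simp: R_def)
    note lg = lift_permutes[OF g]
    note [measurable] = cand_measurable[OF g relX random_vec_const[OF c] random_Wst]
    have "prob {\<omega> \<in> space M. large c \<and> bad g relX t c (Wst \<omega>)}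
        \<le> prob {\<omega> \<in> space M. t < \<bar>cand_slope g relX c (Wst \<omega>) - slope m\<bar>}"
      by (rule finite_measure_mono) (auto simp: bad_def)
    also have "\<dots> \<le> 2 * exp (- (t\<^sup>2 * (u \<bullet> u)) / (2 * (lmax / lmin) * lmax))"
      unfolding cand_slope_same u_def[symmetric]
      by (rule gls_slope_tail[OF lg basis u _ t]) (simp add: uu large_pos[OF True sd])
    also have "\<dots> \<le> 2 * exp (- (t\<^sup>2 * (3 / 4 * real n)) / (2 * (lmax / lmin) * lmax))"
    proof -
      have "t\<^sup>2 * (3 / 4 * real n) / (2 * (lmax / lmin) * lmax) \<le> t\<^sup>2 * (u \<bullet> u) / (2 * (lmax / lmin) * lmax)"
        using large_pos[OF True sd] lmax_pos lmin_pos by (intro divide_right_mono mult_left_mono) (auto simp: uu)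
      then show ?thesis by simp
    qed
    finally show ?thesis .
  qed simp
qed simp

text \<open>The generalized least squares score with the true permutations; it dominates the error of
  all candidates that are statistically indistinguishable from the truth.\<close>

definition score_large where "score_large t c w \<longleftrightarrow>
  7 / 8 * (t * ((c \<bullet> c) / lmax)) < \<bar>(R *\<^sub>v vperm n (lift relX) c) \<bullet> (R *\<^sub>v w)\<bar>"

lemma score_large_measurable:
  assumes x: "random_vec N n x" and w: "random_vec N n w"
  shows "Measurable.pred N (\<lambda>z. score_large t (x z) (w z))"
proof -
  have [measurable]: "(\<lambda>z. x z \<bullet> x z) \<in> borel_measurable N"
    "(\<lambda>z. (R *\<^sub>v vperm n (lift relX) (x z)) \<bullet> (R *\<^sub>v w z)) \<in> borel_measurable N"
    by (intro scalar_prod_measurable[where n = n] random_vec_mult_mat[OF R_carrier] random_vec_vperm lift_permutes relX x w)+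
  show ?thesis unfolding score_large_def by measurable
qed

text \<open>The squared threshold over twice the variance bound is 49/128 = (7/8)^2 / 2 times T, and
  T \<ge> 5 * 3/4 = 15/4. The resulting 735/512 exceeds 1, so this tail stays strictly below
  \<open>2 * exp (- 1)\<close>.\<close>

lemma score_tail:
  assumes sd: "1 \<le> sdX m" and t: "0 \<le> t" "5 * lmax * (lmax / lmin) / real n \<le> t\<^sup>2"
  shows "prob {\<omega> \<in> space M. large (covariate m \<omega>) \<and> score_large t (covariate m \<omega>) (Wst \<omega>)} \<le> 2 * exp (- (735 / 512))"
proof (rule conditional_bound)
  fix N :: "((nat \<Rightarrow> real) \<times> (nat \<Rightarrow> real)) measure" and x w
  assume xw: "random_vec N n x" "random_vec N n w"
  note [measurable] = large_measurable[OF xw(1)] score_large_measurable[OF xw]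
  show "{z \<in> space N. large (x z) \<and> score_large t (x z) (w z)} \<in> sets N" by measurable
next
  fix c :: "real vec" assume c: "c \<in> carrier_vec n"
  show "prob {\<omega> \<in> space M. large c \<and> score_large t c (Wst \<omega>)} \<le> 2 * exp (- (735 / 512))"
  proof (cases "large c")
    case True
    define u where "u = vperm n (lift relX) c"
    have u: "u \<in> carrier_vec n" by (simp add: u_def)
    have uu: "u \<bullet> u = c \<bullet> c" unfolding u_def by (rule vperm_scalar_prod[OF lift_permutes[OF relX] c])
    note cc = large_pos[OF True sd]
    obtain e mm where basis: "gls_basis n R (lift relX) e mm"
      using gls_basis_exists[OF pd lift_permutes[OF relX]] by (auto simp: R_def)
    define z where "z = 7 / 8 * (t * ((c \<bullet> c) / lmax))"
    have z: "0 \<le> z" using t(1) cc lmax_pos by (simp add: z_def)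
    have "prob {\<omega> \<in> space M. large c \<and> score_large t c (Wst \<omega>)} = prob {\<omega> \<in> space M. z < \<bar>(R *\<^sub>v u) \<bullet> (R *\<^sub>v Wst \<omega>)\<bar>}"
      using True by (simp add: score_large_def z_def u_def)
    also have "\<dots> \<le> 2 * exp (- z\<^sup>2 / (2 * ((u \<bullet> u) / lmin)))"
      by (rule gls_score_tail[OF lift_permutes[OF relX] basis u _ z]) (simp add: uu cc)
    also have "\<dots> \<le> 2 * exp (- (735 / 512))"
    proof -
      define T where "T = t\<^sup>2 * (c \<bullet> c) * lmin / lmax\<^sup>2"
      have zT: "z\<^sup>2 / (2 * ((u \<bullet> u) / lmin)) = 49 / 128 * T"
        unfolding z_def uu T_def using cc lmax_pos lmin_pos by (simp add: power2_eq_square field_simps)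
      have "15 / 4 = 5 * lmax * (lmax / lmin) / real n * (3 / 4 * real n) * lmin / lmax\<^sup>2"
        using lmax_pos lmin_pos n_pos by (simp add: power2_eq_square field_simps)
      also have "\<dots> \<le> T"
        unfolding T_def using t(2) cc lmax_pos lmin_pos n_pos
        by (intro divide_right_mono mult_right_mono mult_mono) auto
      finally have "735 / 512 \<le> z\<^sup>2 / (2 * ((u \<bullet> u) / lmin))" unfolding zT by simp
      then show ?thesis by simp
    qed
    finally show ?thesis .
  qed simp
qed simp

text \<open>Removes the square root of the condition number from the profile bound; 15/64 is the
  rate supplied by the radius in \<open>far_candidate_tail\<close>.\<close>

lemma sqrt_mult_exp_le:
  fixes \<kappa> :: real
  assumes "0 \<le> \<kappa>"
  shows "sqrt \<kappa> * exp (- (15 * \<kappa> / 64)) \<le> 2"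
proof -
  have "\<kappa> \<le> (2 * exp (15 * \<kappa> / 64))\<^sup>2"
  proof -
    have "\<kappa> \<le> 4 * (1 + 15 * \<kappa> / 32)" using assms by simp
    also have "\<dots> \<le> 4 * exp (15 * \<kappa> / 32)" by (intro mult_left_mono exp_ge_add_one_self) simp
    also have "exp (15 * \<kappa> / 32) = (exp (15 * \<kappa> / 64))\<^sup>2"
      unfolding power2_eq_square exp_add[symmetric] by simp
    finally show ?thesis by (simp add: power_mult_distrib)
  qed
  then have "sqrt \<kappa> \<le> 2 * exp (15 * \<kappa> / 64)"
    using assms by (intro real_le_lsqrt) auto
  then have "sqrt \<kappa> * exp (- (15 * \<kappa> / 64)) \<le> 2 * exp (15 * \<kappa> / 64) * exp (- (15 * \<kappa> / 64))"
    by (rule mult_right_mono) simp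
  then show ?thesis by (simp add: mult.assoc exp_add[symmetric])
qed

text \<open>Being selected brings in the affinity factor, at most 1 / sqrt H. Being off by t in
  addition brings in exp (- 15 \<kappa> / 64), with 15/64 = 5 * (3/4) / 16, and this pays for the
  square root of \<kappa>.\<close>

lemma far_candidate_tail:
  assumes g: "g permutes {..<K}" and basis: "gls_basis n R (lift g) e mm"
    and H: "0 < H" "H \<le> (\<Prod>j<n. (1 + mm j) / 2)"
    and sd: "1 \<le> sdX m" and t: "0 \<le> t" "5 * lmax * (lmax / lmin) / real n \<le> t\<^sup>2"
  shows "prob {\<omega> \<in> space M. large (covariate m \<omega>) \<and> bad g relX t (covariate m \<omega>) (Wst \<omega>)} \<le> 4 / sqrt H"
proof (rule conditional_bound)
  fix N :: "((nat \<Rightarrow> real) \<times> (nat \<Rightarrow> real)) measure" and x w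
  assume xw: "random_vec N n x" "random_vec N n w"
  note [measurable] = large_measurable[OF xw(1)] bad_measurable[OF g relX xw]
  show "{z \<in> space N. large (x z) \<and> bad g relX t (x z) (w z)} \<in> sets N" by measurable
next
  fix c :: "real vec" assume c: "c \<in> carrier_vec n"
  show "prob {\<omega> \<in> space M. large c \<and> bad g relX t c (Wst \<omega>)} \<le> 4 / sqrt H"
  proof (cases "large c")
    case True
    define u where "u = vperm n (lift relX) c"
    have u: "u \<in> carrier_vec n" by (simp add: u_def)
    have uu: "u \<bullet> u = c \<bullet> c" unfolding u_def by (rule vperm_scalar_prod[OF lift_permutes[OF relX] c])
    note cc = large_pos[OF True sd]
    note lg = lift_permutes[OF g]
    define \<kappa> where "\<kappa> = lmax / lmin"
    have \<kappa>: "0 < \<kappa>" using lmax_pos lmin_pos by (simp add: \<kappa>_def)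
    have u0: "0 < u \<bullet> u" using cc uu by simp
    have "prob {\<omega> \<in> space M. large c \<and> bad g relX t c (Wst \<omega>)}
        \<le> prob {\<omega> \<in> space M. cand_rss g relX c (Wst \<omega>) \<le> (R *\<^sub>v Wst \<omega>) \<bullet> (R *\<^sub>v Wst \<omega>) \<and> t \<le> \<bar>cand_slope g relX c (Wst \<omega>) - slope m * (u \<bullet> u) / (u \<bullet> u)\<bar>}"
    proof (rule finite_measure_mono)
      note [measurable] = cand_measurable[OF g relX random_vec_const[OF c] random_Wst]
      show "{\<omega> \<in> space M. cand_rss g relX c (Wst \<omega>) \<le> (R *\<^sub>v Wst \<omega>) \<bullet> (R *\<^sub>v Wst \<omega>) \<and> t \<le> \<bar>cand_slope g relX c (Wst \<omega>) - slope m * (u \<bullet> u) / (u \<bullet> u)\<bar>} \<in> events"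
        by measurable
    qed (use u0 in \<open>auto simp: bad_def\<close>)
    also have "\<dots> \<le> 2 * sqrt (lmax / lmin) * (\<Prod>j<n. sqrt (2 / (1 + mm j)))
        * exp (- ((slope m)\<^sup>2 * (u \<bullet> u - (u \<bullet> u)\<^sup>2 / (u \<bullet> u))) / (8 * lmax) - (u \<bullet> u) * t\<^sup>2 / (16 * lmax))"
      unfolding cand_rss_def cand_y_def cand_slope_def cand_x_def u_def
      by (rule gls_profile_tail[OF lg basis]) (use u0 t in \<open>simp_all add: u_def\<close>)
    also have "- ((slope m)\<^sup>2 * (u \<bullet> u - (u \<bullet> u)\<^sup>2 / (u \<bullet> u))) / (8 * lmax) - (u \<bullet> u) * t\<^sup>2 / (16 * lmax) = - ((u \<bullet> u) * t\<^sup>2 / (16 * lmax))"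
      using u0 by (simp add: power2_eq_square)
    also have "2 * sqrt (lmax / lmin) * (\<Prod>j<n. sqrt (2 / (1 + mm j))) * exp (- ((u \<bullet> u) * t\<^sup>2 / (16 * lmax)))
        \<le> 2 * sqrt \<kappa> * (1 / sqrt H) * exp (- (15 * \<kappa> / 64))"
    proof -
      have "3 / 4 * real n * (5 * lmax * \<kappa> / real n) / (16 * lmax) \<le> (u \<bullet> u) * t\<^sup>2 / (16 * lmax)"
        using t(2) cc lmax_pos n_pos \<kappa> unfolding \<kappa>_def[symmetric]
        by (intro divide_right_mono mult_mono) (auto simp: uu)
      moreover have "3 / 4 * real n * (5 * lmax * \<kappa> / real n) / (16 * lmax) = 15 * \<kappa> / 64"
        using lmax_pos n_pos by (simp add: field_simps)
      ultimately have e: "15 * \<kappa> / 64 \<le> (u \<bullet> u) * t\<^sup>2 / (16 * lmax)" by simp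
      have "(\<Prod>j<n. sqrt (2 / (1 + mm j))) \<le> 1 / sqrt H"
        by (rule prod_two_div_le_inverse_sqrt[OF m_pos[OF lg basis] H])
      moreover have "0 \<le> (\<Prod>j<n. sqrt (2 / (1 + mm j)))"
        using m_pos[OF lg basis] by (intro prod_nonneg) (auto simp: less_imp_le add_nonneg_nonneg)
      ultimately show ?thesis
        using e \<kappa> H unfolding \<kappa>_def[symmetric] by (intro mult_mono) auto
    qed
    also have "\<dots> = 2 * (sqrt \<kappa> * exp (- (15 * \<kappa> / 64))) / sqrt H" by simp
    also have "\<dots> \<le> 2 * 2 / sqrt H"
      using sqrt_mult_exp_le[of \<kappa>] \<kappa> H by (intro divide_right_mono mult_left_mono) auto
    finally show ?thesis by simp
  qed (use H in simp)
qed (use H in simp)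

lemma covariate_functional:
  assumes a: "a \<in> carrier_vec n" and v: "v permutes {..<K}"
  shows "(\<lambda>\<omega>. a \<bullet> vperm n (lift v) (covariate m \<omega>)) \<in> borel_measurable M"
    and "(\<integral>\<^sup>+\<omega>. ennreal ((a \<bullet> vperm n (lift v) (covariate m \<omega>))\<^sup>2) \<partial>M) = ennreal ((sdX m)\<^sup>2 * (a \<bullet> a))"
proof -
  show meas: "(\<lambda>\<omega>. a \<bullet> vperm n (lift v) (covariate m \<omega>)) \<in> borel_measurable M"
    by (intro scalar_prod_measurable[where n = n] random_vec_const a random_vec_vperm lift_permutes v random_covariate)
  define v' where "v' = inv_into UNIV v"
  have v': "v' permutes {..<K}" "v \<circ> v' = id"
    using permutes_inv[OF v] permutes_inv_o[OF v] by (simp_all add: v'_def)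
  define b where "b = vperm n (lift v') a"
  have b: "b \<in> carrier_vec n" by (simp add: b_def)
  have eq: "a \<bullet> vperm n (lift v) (covariate m \<omega>) = b \<bullet> covariate m \<omega>" if \<omega>: "\<omega> \<in> space M" for \<omega>
  proof -
    have "vperm n (lift v') a \<bullet> vperm n (lift v') (vperm n (lift v) (covariate m \<omega>)) = a \<bullet> vperm n (lift v) (covariate m \<omega>)"
      by (rule vperm_scalar_prod[OF lift_permutes[OF v'(1)]]) simp
    then show ?thesis
      unfolding lift_vperm[OF v'(1)] v'(2) lift_vperm_id[OF vec_carrier(1)[OF \<omega>]] by (simp add: b_def)
  qed
  have "distr M borel (\<lambda>\<omega>. a \<bullet> vperm n (lift v) (covariate m \<omega>)) = distr M borel (\<lambda>\<omega>. b \<bullet> covariate m \<omega>)"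
    by (rule distr_cong) (simp_all add: eq)
  also have "\<dots> = centered_normal (b \<bullet> (((sdX m)\<^sup>2 \<cdot>\<^sub>m 1\<^sub>m n) *\<^sub>v b))"
    using gX b by (simp add: gaussian_vec_def)
  also have "b \<bullet> (((sdX m)\<^sup>2 \<cdot>\<^sub>m 1\<^sub>m n) *\<^sub>v b) = (sdX m)\<^sup>2 * (a \<bullet> a)"
    using b vperm_scalar_prod[OF lift_permutes[OF v'(1)] a, of a] by (simp add: smult_mat_vec[of _ n n] b_def)
  finally show "(\<integral>\<^sup>+\<omega>. ennreal ((a \<bullet> vperm n (lift v) (covariate m \<omega>))\<^sup>2) \<partial>M) = ennreal ((sdX m)\<^sup>2 * (a \<bullet> a))"
    by (rule centered_normal_second_moment[OF meas]) (simp add: scalar_prod_self_nonneg)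
qed

text \<open>For a frozen covariate, Q is the variance of the remainder in
  \<open>gls_slope_tail_near\<close>. Its mean is at most 16 H^4 sdX^2 / lmin, bounded in n, whereas
  the deviation asked of the remainder tolerates variances of order n. Markov at the intermediate
  level s, a fraction \<epsilon> of that order, makes both losses small.\<close>

lemma near_candidate_tail:
  assumes g: "g permutes {..<K}" and basis: "gls_basis n R (lift g) e mm"
    and H: "(\<Prod>j<n. (1 + mm j) / 2) \<le> H" and \<epsilon>: "0 < \<epsilon>"
    and sd: "1 \<le> sdX m" and t: "0 \<le> t" "5 * lmax * (lmax / lmin) / real n \<le> t\<^sup>2"
  shows "prob {\<omega> \<in> space M. large (covariate m \<omega>) \<and> \<not> score_large t (covariate m \<omega>) (Wst \<omega>)
      \<and> bad g relX t (covariate m \<omega>) (Wst \<omega>)} \<le> 16 * H ^ 4 / (\<epsilon> * real n) + 2 * exp (- (45 / (2048 * \<epsilon>)))"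
proof -
  note lg = lift_permutes[OF g]
  note ec = e_carrier[OF lg basis]
  define s where "s = \<epsilon> * (sdX m)\<^sup>2 * real n / lmin"
  have s: "0 < s" using \<epsilon> sdX_pos n_pos lmin_pos by (simp add: s_def)
  define Q where "Q c = (\<Sum>j<n. (mm j - 1)\<^sup>2 * (e j \<bullet> (R *\<^sub>v vperm n (lift relX) c))\<^sup>2)" for c
  have Qm: "(\<lambda>z. Q (x z)) \<in> borel_measurable N" if x: "random_vec N n x" for N x
  proof -
    have [measurable]: "(\<lambda>z. e j \<bullet> (R *\<^sub>v vperm n (lift relX) (x z))) \<in> borel_measurable N" if "j < n" for j
      by (intro scalar_prod_measurable[where n = n] random_vec_const ec[OF that] random_vec_mult_mat[OF R_carrier]
          random_vec_vperm lift_permutes relX x)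
    show ?thesis unfolding Q_def by measurable
  qed
  note [measurable] = Qm[OF random_covariate] large_measurable[OF random_covariate]
    score_large_measurable[OF random_covariate random_Wst] bad_measurable[OF g relX random_covariate random_Wst]
  have "prob {\<omega> \<in> space M. large (covariate m \<omega>) \<and> \<not> score_large t (covariate m \<omega>) (Wst \<omega>) \<and> bad g relX t (covariate m \<omega>) (Wst \<omega>)}
      \<le> prob ({\<omega> \<in> space M. s < Q (covariate m \<omega>)} \<union> {\<omega> \<in> space M. Q (covariate m \<omega>) \<le> s \<and> large (covariate m \<omega>)
          \<and> \<not> score_large t (covariate m \<omega>) (Wst \<omega>) \<and> bad g relX t (covariate m \<omega>) (Wst \<omega>)})"
    by (rule finite_measure_mono) auto
  also have "\<dots> \<le> prob {\<omega> \<in> space M. s < Q (covariate m \<omega>)} + prob {\<omega> \<in> space M. Q (covariate m \<omega>) \<le> s \<and> large (covariate m \<omega>)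
          \<and> \<not> score_large t (covariate m \<omega>) (Wst \<omega>) \<and> bad g relX t (covariate m \<omega>) (Wst \<omega>)}"
    by (rule measure_Un_le) auto
  also have "prob {\<omega> \<in> space M. s < Q (covariate m \<omega>)} \<le> 16 * H ^ 4 / (\<epsilon> * real n)"
  proof (rule prob_le_of_nn_integral[where F = "\<lambda>\<omega>. ennreal (1 / s) * ennreal (Q (covariate m \<omega>))"])
    fix \<omega> assume "\<omega> \<in> {\<omega> \<in> space M. s < Q (covariate m \<omega>)}"
    then have "1 \<le> 1 / s * Q (covariate m \<omega>)" using s by (simp add: field_simps)
    then show "1 \<le> ennreal (1 / s) * ennreal (Q (covariate m \<omega>))"
      using s by (subst ennreal_mult'[symmetric]) (auto simp flip: ennreal_1)
  next
    have Re: "R *\<^sub>v x \<in> carrier_vec n" for x by simp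
    have RtR: "transpose_mat R = R" using inv_sqrt_mat_inverse(2)[OF pd] by (simp add: R_def)
    have swap: "e j \<bullet> (R *\<^sub>v vperm n (lift relX) c) = (R *\<^sub>v e j) \<bullet> vperm n (lift relX) c" if "j < n" for j c
      by (rule symmetric_mat_swap[OF R_carrier RtR ec[OF that]]) simp
    have "(\<integral>\<^sup>+\<omega>. ennreal (Q (covariate m \<omega>)) \<partial>M)
        = (\<integral>\<^sup>+\<omega>. (\<Sum>j<n. ennreal ((mm j - 1)\<^sup>2) * ennreal (((R *\<^sub>v e j) \<bullet> vperm n (lift relX) (covariate m \<omega>))\<^sup>2)) \<partial>M)"
      unfolding Q_def by (intro nn_integral_cong) (simp add: swap ennreal_mult'[symmetric] sum_ennreal)
    also have "\<dots> = (\<Sum>j<n. \<integral>\<^sup>+\<omega>. ennreal ((mm j - 1)\<^sup>2) * ennreal (((R *\<^sub>v e j) \<bullet> vperm n (lift relX) (covariate m \<omega>))\<^sup>2) \<partial>M)"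
      using covariate_functional(1)[OF Re relX] by (intro nn_integral_sum) measurable
    also have "\<dots> = (\<Sum>j<n. ennreal ((mm j - 1)\<^sup>2) * ennreal ((sdX m)\<^sup>2 * ((R *\<^sub>v e j) \<bullet> (R *\<^sub>v e j))))"
    proof (rule sum.cong[OF refl])
      fix j
      have [measurable]: "(\<lambda>\<omega>. (R *\<^sub>v e j) \<bullet> vperm n (lift relX) (covariate m \<omega>)) \<in> borel_measurable M"
        by (rule covariate_functional(1)[OF Re relX])
      have "(\<integral>\<^sup>+\<omega>. ennreal ((mm j - 1)\<^sup>2) * ennreal (((R *\<^sub>v e j) \<bullet> vperm n (lift relX) (covariate m \<omega>))\<^sup>2) \<partial>M)
          = ennreal ((mm j - 1)\<^sup>2) * (\<integral>\<^sup>+\<omega>. ennreal (((R *\<^sub>v e j) \<bullet> vperm n (lift relX) (covariate m \<omega>))\<^sup>2) \<partial>M)"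
        by (rule nn_integral_cmult) measurable
      also have "(\<integral>\<^sup>+\<omega>. ennreal (((R *\<^sub>v e j) \<bullet> vperm n (lift relX) (covariate m \<omega>))\<^sup>2) \<partial>M)
          = ennreal ((sdX m)\<^sup>2 * ((R *\<^sub>v e j) \<bullet> (R *\<^sub>v e j)))"
        by (rule covariate_functional(2)[OF Re relX])
      finally show "(\<integral>\<^sup>+\<omega>. ennreal ((mm j - 1)\<^sup>2) * ennreal (((R *\<^sub>v e j) \<bullet> vperm n (lift relX) (covariate m \<omega>))\<^sup>2) \<partial>M)
          = ennreal ((mm j - 1)\<^sup>2) * ennreal ((sdX m)\<^sup>2 * ((R *\<^sub>v e j) \<bullet> (R *\<^sub>v e j)))" .
    qed
    also have "\<dots> \<le> (\<Sum>j<n. ennreal ((mm j - 1)\<^sup>2) * ennreal ((sdX m)\<^sup>2 / lmin))"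
    proof (intro sum_mono mult_left_mono ennreal_leI)
      fix j assume "j \<in> {..<n}"
      then have j: "j < n" by simp
      have "lmin * ((R *\<^sub>v e j) \<bullet> (R *\<^sub>v e j)) \<le> 1" using R_bounds(1)[OF ec[OF j]] e_orth[OF lg basis j j] by simp
      then have "(R *\<^sub>v e j) \<bullet> (R *\<^sub>v e j) \<le> 1 / lmin" using lmin_pos by (simp add: field_simps)
      then have "(sdX m)\<^sup>2 * ((R *\<^sub>v e j) \<bullet> (R *\<^sub>v e j)) \<le> (sdX m)\<^sup>2 * (1 / lmin)" by (rule mult_left_mono) simp
      then show "(sdX m)\<^sup>2 * ((R *\<^sub>v e j) \<bullet> (R *\<^sub>v e j)) \<le> (sdX m)\<^sup>2 / lmin" by simp
    qed simp
    also have "\<dots> = ennreal ((\<Sum>j<n. (mm j - 1)\<^sup>2) * ((sdX m)\<^sup>2 / lmin))"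
      using lmin_pos by (simp add: ennreal_mult'[symmetric] sum_ennreal sum_distrib_right sum_divide_distrib)
    also have "\<dots> \<le> ennreal (16 * H ^ 4 * ((sdX m)\<^sup>2 / lmin))"
      using sum_sq_dev_le[OF m_pos[OF lg basis] m_prod[OF lg basis] H] lmin_pos
      by (intro ennreal_leI mult_right_mono) auto
    finally have Q: "(\<integral>\<^sup>+\<omega>. ennreal (Q (covariate m \<omega>)) \<partial>M) \<le> ennreal (16 * H ^ 4 * ((sdX m)\<^sup>2 / lmin))" .
    have "(\<integral>\<^sup>+\<omega>. ennreal (1 / s) * ennreal (Q (covariate m \<omega>)) \<partial>M) = ennreal (1 / s) * (\<integral>\<^sup>+\<omega>. ennreal (Q (covariate m \<omega>)) \<partial>M)"
      by (rule nn_integral_cmult) measurable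
    also have "\<dots> \<le> ennreal (1 / s) * ennreal (16 * H ^ 4 * ((sdX m)\<^sup>2 / lmin))"
      by (rule mult_left_mono[OF Q]) simp
    also have "\<dots> = ennreal (1 / s * (16 * H ^ 4 * ((sdX m)\<^sup>2 / lmin)))"
      using s by (intro ennreal_mult'[symmetric]) simp
    also have "1 / s * (16 * H ^ 4 * ((sdX m)\<^sup>2 / lmin)) = 16 * H ^ 4 / (\<epsilon> * real n)"
      using sdX_pos lmin_pos \<epsilon> n_pos by (simp add: s_def field_simps)
    finally show "(\<integral>\<^sup>+\<omega>. ennreal (1 / s) * ennreal (Q (covariate m \<omega>)) \<partial>M) \<le> ennreal (16 * H ^ 4 / (\<epsilon> * real n))" .
  next
    show "0 \<le> 16 * H ^ 4 / (\<epsilon> * real n)" using \<epsilon> by simp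
  qed simp
  also have "prob {\<omega> \<in> space M. Q (covariate m \<omega>) \<le> s \<and> large (covariate m \<omega>)
          \<and> \<not> score_large t (covariate m \<omega>) (Wst \<omega>) \<and> bad g relX t (covariate m \<omega>) (Wst \<omega>)} \<le> 2 * exp (- (45 / (2048 * \<epsilon>)))"
  proof (rule conditional_bound)
    fix N :: "((nat \<Rightarrow> real) \<times> (nat \<Rightarrow> real)) measure" and x w
    assume xw: "random_vec N n x" "random_vec N n w"
    note [measurable] = Qm[OF xw(1)] large_measurable[OF xw(1)] score_large_measurable[OF xw] bad_measurable[OF g relX xw]
    show "{z \<in> space N. Q (x z) \<le> s \<and> large (x z) \<and> \<not> score_large t (x z) (w z) \<and> bad g relX t (x z) (w z)} \<in> sets N"
      by measurable
  next
    fix c :: "real vec" assume c: "c \<in> carrier_vec n"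
    show "prob {\<omega> \<in> space M. Q c \<le> s \<and> large c \<and> \<not> score_large t c (Wst \<omega>) \<and> bad g relX t c (Wst \<omega>)} \<le> 2 * exp (- (45 / (2048 * \<epsilon>)))"
    proof (cases "Q c \<le> s \<and> large c")
      case True
      define u where "u = vperm n (lift relX) c"
      have u: "u \<in> carrier_vec n" by (simp add: u_def)
      have uu: "u \<bullet> u = c \<bullet> c" unfolding u_def by (rule vperm_scalar_prod[OF lift_permutes[OF relX] c])
      note cc = large_pos[OF conjunct2[OF True] sd]
      have u0: "0 < u \<bullet> u" using cc uu by simp
      have Qs: "(\<Sum>j<n. (mm j - 1)\<^sup>2 * (e j \<bullet> (R *\<^sub>v u))\<^sup>2) \<le> s" using True by (simp add: Q_def u_def)
      note rc = random_vec_const[OF c, of M]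
      note [measurable] = cand_measurable[OF g relX rc random_Wst] score_large_measurable[OF rc random_Wst]
      have "prob {\<omega> \<in> space M. Q c \<le> s \<and> large c \<and> \<not> score_large t c (Wst \<omega>) \<and> bad g relX t c (Wst \<omega>)}
          \<le> prob {\<omega> \<in> space M. t < \<bar>cand_slope g relX c (Wst \<omega>) - slope m\<bar> \<and> \<not> score_large t c (Wst \<omega>)}"
        by (rule finite_measure_mono) (auto simp: bad_def)
      also have "\<dots> = prob {\<omega> \<in> space M. t < \<bar>cand_slope g relX c (Wst \<omega>) - slope m\<bar>
            \<and> \<bar>(R *\<^sub>v u) \<bullet> (R *\<^sub>v Wst \<omega>)\<bar> \<le> 7 / 8 * (t * ((u \<bullet> u) / lmax))}"
        by (simp add: score_large_def u_def[symmetric] uu not_less)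
      also have "\<dots> \<le> 2 * exp (- (t * ((u \<bullet> u) / lmax) / 8)\<^sup>2 / (2 * s))"
        unfolding cand_slope_same u_def[symmetric]
        by (rule gls_slope_tail_near[OF lg basis u u0 t(1) Qs s])
      also have "\<dots> \<le> 2 * exp (- (45 / (2048 * \<epsilon>)))"
      proof -
        have q: "3 / 4 * real n * (sdX m)\<^sup>2 \<le> u \<bullet> u" using True by (simp add: large_def uu)
        have "1 * 1 \<le> sdX m * sdX m" using sd by (intro mult_mono) auto
        then have sd2: "1 \<le> (sdX m)\<^sup>2" by (simp add: power2_eq_square)
        \<comment> \<open>45/2048 is 5 (3/4)^2 / 128: the squared radius, the length of the
          covariate twice, and 128 = 2 * 8^2 from the eighth left to the remainder.\<close>
        have "45 / (2048 * \<epsilon>) * 1 \<le> 45 / (2048 * \<epsilon>) * (sdX m)\<^sup>2" using sd2 \<epsilon> by (intro mult_left_mono) auto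
        also have "\<dots> = (5 * lmax * (lmax / lmin) / real n) * ((3 / 4 * real n * (sdX m)\<^sup>2) * (3 / 4 * real n * (sdX m)\<^sup>2)) / (128 * lmax\<^sup>2 * s)"
          using lmax_pos lmin_pos n_pos sdX_pos \<epsilon> unfolding s_def by (simp add: field_simps power2_eq_square)
        also have "\<dots> \<le> t\<^sup>2 * ((u \<bullet> u) * (u \<bullet> u)) / (128 * lmax\<^sup>2 * s)"
          using t(2) q s lmax_pos lmin_pos n_pos u0
          by (intro divide_right_mono mult_mono) auto
        also have "\<dots> = (t * ((u \<bullet> u) / lmax) / 8)\<^sup>2 / (2 * s)"
          by (simp add: power2_eq_square mult_ac)
        finally show ?thesis by simp
      qed
      finally show ?thesis .
    qed auto
  qed simp
  finally show ?thesis by simp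
qed

end

subsection \<open>The estimator\<close>

lemma residual_projection_le:
  fixes x y :: "real vec"
  assumes x: "x \<in> carrier_vec n" and y: "y \<in> carrier_vec n"
  defines "h \<equiv> inverse (x \<bullet> x) * (x \<bullet> y)"
  shows "(y - h \<cdot>\<^sub>v x) \<bullet> (y - h \<cdot>\<^sub>v x) \<le> (y - b \<cdot>\<^sub>v x) \<bullet> (y - b \<cdot>\<^sub>v x)"
proof -
  have ex: "(y - b \<cdot>\<^sub>v x) \<bullet> (y - b \<cdot>\<^sub>v x) = y \<bullet> y - 2 * b * (x \<bullet> y) + b\<^sup>2 * (x \<bullet> x)" for b
    using x y comm_scalar_prod[OF y x]
    by (simp add: minus_scalar_prod_distrib[of _ n] scalar_prod_minus_distrib[of _ n] power2_eq_square algebra_simps)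
  show ?thesis
  \<comment> \<open>For x = 0 the coefficient is 0 as well, by \<open>inverse 0 = 0\<close>, and
    both sides equal |y|^2.\<close>
  proof (cases "x = 0\<^sub>v n")
    case True
    then show ?thesis unfolding ex using y by simp
  next
    case False
    then have xx: "0 < x \<bullet> x" by (rule scalar_prod_self_pos[OF x])
    then have xy: "x \<bullet> y = h * (x \<bullet> x)" by (simp add: h_def)
    have "0 \<le> (x \<bullet> x) * (b - h)\<^sup>2" using xx by simp
    then show ?thesis unfolding ex xy by (simp add: power2_eq_square algebra_simps)
  qed
qed

lemma proj_perp_mult_vec:
  assumes x: "x \<in> carrier_vec n" and y: "y \<in> carrier_vec n"
  shows "proj_perp_mat n x *\<^sub>v y = y - (inverse (x \<bullet> x) * (x \<bullet> y)) \<cdot>\<^sub>v x"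
proof -
  have P: "proj_mat n x \<in> carrier_mat n n" by (simp add: proj_mat_def)
  have "proj_mat n x *\<^sub>v y = (inverse (x \<bullet> x) * (x \<bullet> y)) \<cdot>\<^sub>v x"
    using x y by (intro eq_vecI)
      (auto simp: proj_mat_def scalar_prod_def[of _ y] sum_distrib_left sum_distrib_right mult_ac)
  then show ?thesis
    unfolding proj_perp_mat_def using minus_mult_distrib_mat_vec[OF one_carrier_mat P y] y by simp
qed

text \<open>The eighth power is 81 e / 256, below 1 because e \<le> 3.\<close>

lemma chi_rate_less_one: "chi_rate < 1"
proof -
  have "exp (1 :: real) \<le> 3" by (rule exp_le)
  moreover have "chi_rate ^ 8 = exp 1 * (3 / 4) ^ 4"
  proof -
    have "exp (1 / 8 :: real) ^ 8 = exp 1" by (simp flip: exp_of_nat_mult)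
    moreover have "sqrt (3 / 4) ^ 8 = ((sqrt (3 / 4))\<^sup>2) ^ 4" by (simp only: power_mult[symmetric]) simp
    ultimately show ?thesis by (simp add: power_mult_distrib)
  qed
  ultimately have "chi_rate ^ 8 < 1" by (simp add: power_divide)
  then show ?thesis by (metis not_less one_le_power)
qed

context block_gls
begin

interpretation prob_space M by (rule prob_space_M)

lemma X_tilde_eq:
  assumes s1: "s1 permutes {..<K}" and g: "g permutes {..<K}" and \<omega>: "\<omega> \<in> space M"
    and vg: "v \<circ> g = s1"
  shows "X_tilde m (bdiag B (perm_mat K s1)) \<omega> = cand_x g v (covariate m \<omega>)"
  unfolding X_tilde_def bdiag_lift[OF s1 vec_carrier(1)[OF \<omega>]] cand_x_def lift_vperm[OF g] vg R_def ..

lemma Y_tilde_eq: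
  assumes s2: "s2 permutes {..<K}" and \<omega>: "\<omega> \<in> space M"
  shows "Y_tilde m (bdiag B (perm_mat K s2)) \<omega> = cand_y (sS \<circ> s2) (covariate m \<omega>) (Wst \<omega>)"
proof -
  have c: "response m \<omega> \<in> carrier_vec n" unfolding response_eq[OF \<omega>] by simp
  show ?thesis
    unfolding Y_tilde_def bdiag_lift[OF s2 c] cand_y_def
    unfolding response_eq[OF \<omega>] lift_vperm[OF s2] R_def ..
qed

lemma cand_carrier [simp]: "cand_x g v c \<in> carrier_vec n" "cand_y g c w \<in> carrier_vec n"
  by (simp_all add: cand_x_def cand_y_def)

lemma objective_eq:
  assumes s1: "s1 permutes {..<K}" and s2: "s2 permutes {..<K}" and \<omega>: "\<omega> \<in> space M"
    and vg: "v \<circ> (sS \<circ> s2) = s1"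
  shows "objective m (perm_mat K s1) (perm_mat K s2) \<omega> = cand_rss (sS \<circ> s2) v (covariate m \<omega>) (Wst \<omega>)"
proof -
  have g: "sS \<circ> s2 permutes {..<K}" by (rule permutes_compose[OF s2 sS(1)])
  show ?thesis
    unfolding objective_def X_tilde_eq[OF s1 g \<omega> vg] Y_tilde_eq[OF s2 \<omega>] Let_def
    by (simp add: proj_perp_mult_vec cand_rss_def cand_slope_def)
qed

text \<open>Passes from a pair of matrices to the coding (g, v): the permutation of the response
  determines g = sS o s2, and v is solved for from s1.\<close>

lemma rel_perm:
  assumes s1: "s1 permutes {..<K}" and s2: "s2 permutes {..<K}"
  obtains v where "v permutes {..<K}" "v \<circ> (sS \<circ> s2) = s1"
proof -
  have g: "sS \<circ> s2 permutes {..<K}" by (rule permutes_compose[OF s2 sS(1)])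
  show ?thesis
  proof (rule that)
    show "s1 \<circ> inv_into UNIV (sS \<circ> s2) permutes {..<K}" by (rule permutes_compose[OF permutes_inv[OF g] s1])
    show "(s1 \<circ> inv_into UNIV (sS \<circ> s2)) \<circ> (sS \<circ> s2) = s1"
      using permutes_inv_o(2)[OF g] by (simp only: o_assoc[symmetric] o_id)
  qed
qed

text \<open>With the true permutations and slope \<beta> the residual is exactly the whitened noise,
  and the criterion minimizes over slopes.\<close>

lemma true_objective_le:
  assumes \<omega>: "\<omega> \<in> space M"
  shows "objective m (perm_mat K relX) (perm_mat K sS') \<omega> \<le> (R *\<^sub>v Wst \<omega>) \<bullet> (R *\<^sub>v Wst \<omega>)"
proof -
  note c = vec_carrier[OF \<omega>]
  have "objective m (perm_mat K relX) (perm_mat K sS') \<omega> = cand_rss (sS \<circ> sS') relX (covariate m \<omega>) (Wst \<omega>)"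
    by (rule objective_eq[OF relX sS'(1) \<omega>]) (simp add: sS')
  also have "\<dots> \<le> (cand_y (sS \<circ> sS') (covariate m \<omega>) (Wst \<omega>) - slope m \<cdot>\<^sub>v cand_x (sS \<circ> sS') relX (covariate m \<omega>))
      \<bullet> (cand_y (sS \<circ> sS') (covariate m \<omega>) (Wst \<omega>) - slope m \<cdot>\<^sub>v cand_x (sS \<circ> sS') relX (covariate m \<omega>))"
    unfolding cand_rss_def cand_slope_def by (rule residual_projection_le[where n = n]) simp_all
  also have "cand_y (sS \<circ> sS') (covariate m \<omega>) (Wst \<omega>) - slope m \<cdot>\<^sub>v cand_x (sS \<circ> sS') relX (covariate m \<omega>) = R *\<^sub>v Wst \<omega>"
  proof -
    have u: "vperm n (lift relX) (covariate m \<omega>) \<in> carrier_vec n" by simp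
    have "cand_y (sS \<circ> sS') (covariate m \<omega>) (Wst \<omega>) = R *\<^sub>v Wst \<omega> + slope m \<cdot>\<^sub>v (R *\<^sub>v vperm n (lift relX) (covariate m \<omega>))"
      unfolding cand_y_def sS'(2) R_add_smult[OF c(4) u, symmetric]
      using c(4) u by (subst lift_vperm_id) simp_all
    moreover have "cand_x (sS \<circ> sS') relX (covariate m \<omega>) = R *\<^sub>v vperm n (lift relX) (covariate m \<omega>)"
      unfolding cand_x_def sS'(2) lift_vperm_id[OF u] ..
    moreover have "p + a \<cdot>\<^sub>v q - a \<cdot>\<^sub>v q = p" if "p \<in> carrier_vec n" "q \<in> carrier_vec n" for p q :: "real vec" and a
      using that by (intro eq_vecI) auto
    ultimately show ?thesis by simp
  qed
  finally show ?thesis .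
qed

section \<open>From candidates to the estimator\<close>

context
  fixes pi1 pi2
  assumes est: "is_estimator m pi1 pi2"
begin

lemma pi_perm:
  assumes \<omega>: "\<omega> \<in> space M"
  obtains s1 s2 where "s1 permutes {..<K}" "pi1 \<omega> = perm_mat K s1" "s2 permutes {..<K}" "pi2 \<omega> = perm_mat K s2"
proof -
  have "pi1 \<omega> \<in> perm_mats K" "pi2 \<omega> \<in> perm_mats K"
    using est \<omega> unfolding is_estimator_def by (auto dest: measurable_space)
  then show ?thesis using that by (auto simp: perm_mats_eq)
qed

lemma estimator_bad:
  assumes \<omega>: "\<omega> \<in> space M" and t: "t < \<bar>beta_hat m pi1 pi2 \<omega> - slope m\<bar>"
  obtains g v where "g permutes {..<K}" "v permutes {..<K}" "bad g v t (covariate m \<omega>) (Wst \<omega>)"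
proof -
  obtain s1 s2 where s: "s1 permutes {..<K}" "pi1 \<omega> = perm_mat K s1" "s2 permutes {..<K}" "pi2 \<omega> = perm_mat K s2"
    using pi_perm[OF \<omega>] .
  obtain v where v: "v permutes {..<K}" "v \<circ> (sS \<circ> s2) = s1" using rel_perm[OF s(1,3)] .
  have g: "sS \<circ> s2 permutes {..<K}" by (rule permutes_compose[OF s(3) sS(1)])
  have "perm_mat K relX \<in> perm_mats K" "perm_mat K sS' \<in> perm_mats K"
    using relX sS'(1) by (auto simp: perm_mats_eq)
  then have "objective m (pi1 \<omega>) (pi2 \<omega>) \<omega> \<le> objective m (perm_mat K relX) (perm_mat K sS') \<omega>"
    using est \<omega> unfolding is_estimator_def by blast
  then have "cand_rss (sS \<circ> s2) v (covariate m \<omega>) (Wst \<omega>) \<le> (R *\<^sub>v Wst \<omega>) \<bullet> (R *\<^sub>v Wst \<omega>)"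
    unfolding s(2,4) objective_eq[OF s(1,3) \<omega> v(2)] using true_objective_le[OF \<omega>] by simp
  moreover have "beta_hat m pi1 pi2 \<omega> = cand_slope (sS \<circ> s2) v (covariate m \<omega>) (Wst \<omega>)"
    unfolding beta_hat_def s(2,4) X_tilde_eq[OF s(1) g \<omega> v(2)] Y_tilde_eq[OF s(3) \<omega>]
    by (simp add: cand_slope_def Let_def)
  ultimately have "bad (sS \<circ> s2) v t (covariate m \<omega>) (Wst \<omega>)" using t by (simp add: bad_def)
  then show ?thesis by (rule that[OF g v(1)])
qed

text \<open>The selected matrices range over a finite set, and for each fixed pair the slope is
  measurable.\<close>

lemma beta_hat_measurable: "(\<lambda>\<omega>. beta_hat m pi1 pi2 \<omega>) \<in> borel_measurable M"
proof -
  define F where "F p1 p2 \<omega> = (let x = X_tilde m (bdiag B p1) \<omega>; y = Y_tilde m (bdiag B p2) \<omega>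
    in inverse (x \<bullet> x) * (x \<bullet> y))" for p1 p2 \<omega>
  have fin: "finite (perm_mats K)" unfolding perm_mats_eq by (intro finite_imageI finite_permutations) simp
  have F: "F p1 p2 \<in> borel_measurable M" if p: "p1 \<in> perm_mats K" "p2 \<in> perm_mats K" for p1 p2
  proof -
    obtain s1 s2 where s: "s1 permutes {..<K}" "p1 = perm_mat K s1" "s2 permutes {..<K}" "p2 = perm_mat K s2"
      using p by (auto simp: perm_mats_eq)
    obtain v where v: "v permutes {..<K}" "v \<circ> (sS \<circ> s2) = s1" using rel_perm[OF s(1,3)] .
    have g: "sS \<circ> s2 permutes {..<K}" by (rule permutes_compose[OF s(3) sS(1)])
    have "(\<lambda>\<omega>. cand_slope (sS \<circ> s2) v (covariate m \<omega>) (Wst \<omega>)) \<in> borel_measurable M"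
      by (rule cand_measurable(1)[OF g v(1) random_covariate random_Wst])
    then show ?thesis
    proof (rule measurable_cong[THEN iffD1, rotated])
      fix \<omega> assume \<omega>: "\<omega> \<in> space M"
      show "cand_slope (sS \<circ> s2) v (covariate m \<omega>) (Wst \<omega>) = F p1 p2 \<omega>"
        unfolding F_def s(2,4) X_tilde_eq[OF s(1) g \<omega> v(2)] Y_tilde_eq[OF s(3) \<omega>]
        by (simp add: cand_slope_def Let_def)
    qed
  qed
  have pi: "pi1 \<in> M \<rightarrow>\<^sub>M count_space (perm_mats K)" "pi2 \<in> M \<rightarrow>\<^sub>M count_space (perm_mats K)"
    using est by (auto simp: is_estimator_def)
  have "(\<lambda>\<omega>. F (pi1 \<omega>) (pi2 \<omega>) \<omega>) \<in> borel_measurable M"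
  proof (rule measurable_compose_countable'[OF _ pi(1) countable_finite[OF fin], where f = "\<lambda>p1 \<omega>. F p1 (pi2 \<omega>) \<omega>"])
    fix p1 assume "p1 \<in> perm_mats K"
    then show "(\<lambda>\<omega>. F p1 (pi2 \<omega>) \<omega>) \<in> borel_measurable M"
      by (intro measurable_compose_countable'[OF _ pi(2) countable_finite[OF fin], where f = "\<lambda>p2 \<omega>. F p1 p2 \<omega>"] F)
  qed
  then show ?thesis by (simp add: F_def beta_hat_def)
qed

text \<open>F is an exceptional event that is paid for once; only the part of each candidate outside
  F is multiplied by the number (K!)^2 of pairs (g, v). The choice \<open>False\<close> gives the
  plain union bound, \<open>score_large\<close> the refined one.\<close>

lemma failure_union_bound:
  assumes F[measurable]: "Measurable.pred M F" and p: "0 \<le> p"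
    and p0: "prob {\<omega> \<in> space M. large (covariate m \<omega>) \<and> F \<omega>} \<le> p0"
    and each: "\<And>g v. g permutes {..<K} \<Longrightarrow> v permutes {..<K} \<Longrightarrow>
      prob {\<omega> \<in> space M. large (covariate m \<omega>) \<and> \<not> F \<omega> \<and> bad g v t (covariate m \<omega>) (Wst \<omega>)} \<le> p"
  shows "prob {\<omega> \<in> space M. t < \<bar>beta_hat m pi1 pi2 \<omega> - slope m\<bar>} \<le> chi_rate ^ n + p0 + (fact K)\<^sup>2 * p"
proof -
  let ?S = "{\<omega> \<in> space M. covariate m \<omega> \<bullet> covariate m \<omega> < 3 / 4 * real n * (sdX m)\<^sup>2}"
  let ?F = "{\<omega> \<in> space M. large (covariate m \<omega>) \<and> F \<omega>}"
  let ?T = "{\<omega> \<in> space M. t < \<bar>beta_hat m pi1 pi2 \<omega> - slope m\<bar>}"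
  note [measurable] = beta_hat_measurable large_measurable[OF random_covariate] scalar_prod_measurable[OF random_covariate random_covariate]
  define S where "S = {s. s permutes {..<K}}"
  define E where "E = (\<lambda>(g, v). {\<omega> \<in> space M. large (covariate m \<omega>) \<and> \<not> F \<omega> \<and> bad g v t (covariate m \<omega>) (Wst \<omega>)})"
  have S: "finite S" "card S = fact K"
    using finite_permutations[of "{..<K}"] card_permutations[of "{..<K}" K] by (simp_all add: S_def)
  have Em: "E gv \<in> events" if "gv \<in> S \<times> S" for gv
  proof -
    obtain g v where gv: "gv = (g, v)" "g permutes {..<K}" "v permutes {..<K}" using \<open>gv \<in> S \<times> S\<close> by (auto simp: S_def)
    note [measurable] = bad_measurable[OF gv(2,3) random_covariate random_Wst]
    show ?thesis unfolding E_def gv(1) prod.case by measurable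
  qed
  have UE: "(\<Union>gv\<in>S \<times> S. E gv) \<in> events" using S(1) Em by (intro sets.finite_UN) auto
  have A: "?S \<in> events" by measurable
  have A2: "?F \<in> events" by measurable
  have "prob ?T
      \<le> prob ((?S
          \<union> ?F) \<union> (\<Union>gv\<in>S \<times> S. E gv))"
  proof (rule finite_measure_mono)
    show "?T
      \<subseteq> (?S
          \<union> ?F) \<union> (\<Union>gv\<in>S \<times> S. E gv)"
    proof
      fix \<omega> assume "\<omega> \<in> ?T"
      then have \<omega>: "\<omega> \<in> space M" and t: "t < \<bar>beta_hat m pi1 pi2 \<omega> - slope m\<bar>" by auto
      obtain g v where gv: "g permutes {..<K}" "v permutes {..<K}" "bad g v t (covariate m \<omega>) (Wst \<omega>)"
        using estimator_bad[OF \<omega> t] .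
      show "\<omega> \<in> (?S
          \<union> ?F) \<union> (\<Union>gv\<in>S \<times> S. E gv)"
      proof (cases "large (covariate m \<omega>) \<and> \<not> F \<omega>")
        case True
        then have "\<omega> \<in> E (g, v)" using \<omega> gv(3) by (simp add: E_def)
        moreover have "(g, v) \<in> S \<times> S" using gv by (simp add: S_def)
        ultimately show ?thesis by blast
      next
        case False
        then show ?thesis using \<omega> by (auto simp: large_def)
      qed
    qed
  qed (use A A2 UE in auto)
  also have "\<dots> \<le> prob ?S
      + prob ?F + prob (\<Union>gv\<in>S \<times> S. E gv)"
    using measure_Un_le[OF sets.Un[OF A A2] UE] measure_Un_le[OF A A2] by linarith
  also have "prob (\<Union>gv\<in>S \<times> S. E gv) \<le> (\<Sum>gv\<in>S \<times> S. prob (E gv))"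
    using S(1) Em by (intro measure_UNION_le) auto
  also have "(\<Sum>gv\<in>S \<times> S. prob (E gv)) \<le> (\<Sum>gv\<in>S \<times> S. p)"
    by (rule sum_mono) (use each in \<open>auto simp: E_def S_def\<close>)
  also have "\<dots> = (fact K)\<^sup>2 * p" by (simp add: card_cartesian_product S(2) power2_eq_square)
  finally show ?thesis using covariate_norm_tail p0 by linarith
qed

lemma failure_bound_conditional:
  assumes snr: "1 < ln (SNR m)" and sd: "1 \<le> sdX m" and B: "6 \<le> B" and t: "0 \<le> t"
  shows "prob {\<omega> \<in> space M. t < \<bar>beta_hat m pi1 pi2 \<omega> - slope m\<bar>}
    \<le> chi_rate ^ n + (fact K)\<^sup>2 * (2 * chi_rate ^ B + 2 * exp (- (3 * real B / 16 - 1))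
        + 2 * exp (- (t\<^sup>2 * (3 / 4 * real n)) / (2 * (lmax / lmin) * lmax)))"
proof -
  have "prob {\<omega> \<in> space M. t < \<bar>beta_hat m pi1 pi2 \<omega> - slope m\<bar>}
    \<le> chi_rate ^ n + 0 + (fact K)\<^sup>2 * (2 * chi_rate ^ B + 2 * exp (- (3 * real B / 16 - 1))
        + 2 * exp (- (t\<^sup>2 * (3 / 4 * real n)) / (2 * (lmax / lmin) * lmax)))"
  proof (rule failure_union_bound[where F = "\<lambda>_. False"])
    fix g v assume g: "g permutes {..<K}" and v: "v permutes {..<K}"
    note [measurable] = bad_measurable[OF g v random_covariate random_Wst]
    show "prob {\<omega> \<in> space M. large (covariate m \<omega>) \<and> \<not> False \<and> bad g v t (covariate m \<omega>) (Wst \<omega>)}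
      \<le> 2 * chi_rate ^ B + 2 * exp (- (3 * real B / 16 - 1)) + 2 * exp (- (t\<^sup>2 * (3 / 4 * real n)) / (2 * (lmax / lmin) * lmax))"
    proof (cases "v = relX")
      case True
      have "0 \<le> 2 * chi_rate ^ B + 2 * exp (- (3 * real B / 16 - 1))" by simp
      moreover have "prob {\<omega> \<in> space M. large (covariate m \<omega>) \<and> \<not> False \<and> bad g v t (covariate m \<omega>) (Wst \<omega>)}
          = prob {\<omega> \<in> space M. large (covariate m \<omega>) \<and> bad g relX t (covariate m \<omega>) (Wst \<omega>)}"
        unfolding True by simp
      ultimately show ?thesis using same_relative_tail[OF g sd t] by linarith
    next
      case False
      have "prob {\<omega> \<in> space M. large (covariate m \<omega>) \<and> \<not> False \<and> bad g v t (covariate m \<omega>) (Wst \<omega>)}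
          \<le> prob {\<omega> \<in> space M. bad g v t (covariate m \<omega>) (Wst \<omega>)}"
        by (rule finite_measure_mono) auto
      also note wrong_relative_tail[OF g v False snr sd B]
      finally show ?thesis by (rule order_trans) simp
    qed
  qed simp_all
  then show ?thesis by simp
qed

text \<open>The score is common to all candidates, so its tail is counted once. Each candidate with
  the true covariate is far or near according to H; the bounds are added, so that one expression
  covers every candidate.\<close>

lemma failure_bound_selected:
  assumes snr: "1 < ln (SNR m)" and sd: "1 \<le> sdX m" and B: "6 \<le> B"
    and t: "0 \<le> t" "5 * lmax * (lmax / lmin) / real n \<le> t\<^sup>2" and H: "0 < H" and \<epsilon>: "0 < \<epsilon>"
  shows "prob {\<omega> \<in> space M. t < \<bar>beta_hat m pi1 pi2 \<omega> - slope m\<bar>}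
    \<le> chi_rate ^ n + 2 * exp (- (735 / 512)) + (fact K)\<^sup>2 * (2 * chi_rate ^ B + 2 * exp (- (3 * real B / 16 - 1))
        + 4 / sqrt H + 16 * H ^ 4 / (\<epsilon> * real n) + 2 * exp (- (45 / (2048 * \<epsilon>))))"
proof (rule failure_union_bound[where F = "\<lambda>\<omega>. score_large t (covariate m \<omega>) (Wst \<omega>)"])
  show "Measurable.pred M (\<lambda>\<omega>. score_large t (covariate m \<omega>) (Wst \<omega>))"
    by (rule score_large_measurable[OF random_covariate random_Wst])
  show "prob {\<omega> \<in> space M. large (covariate m \<omega>) \<and> score_large t (covariate m \<omega>) (Wst \<omega>)} \<le> 2 * exp (- (735 / 512))"
    by (rule score_tail[OF sd t])
  have nn: "0 \<le> 2 * chi_rate ^ B + 2 * exp (- (3 * real B / 16 - 1))" "0 \<le> 4 / sqrt H"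
    "0 \<le> 16 * H ^ 4 / (\<epsilon> * real n)" "0 \<le> 2 * exp (- (45 / (2048 * \<epsilon>)))" using H \<epsilon> by simp_all
  then show "0 \<le> 2 * chi_rate ^ B + 2 * exp (- (3 * real B / 16 - 1)) + 4 / sqrt H + 16 * H ^ 4 / (\<epsilon> * real n) + 2 * exp (- (45 / (2048 * \<epsilon>)))"
    by linarith
  fix g v assume g: "g permutes {..<K}" and v: "v permutes {..<K}"
  note [measurable] = bad_measurable[OF g v random_covariate random_Wst] large_measurable[OF random_covariate]
  show "prob {\<omega> \<in> space M. large (covariate m \<omega>) \<and> \<not> score_large t (covariate m \<omega>) (Wst \<omega>) \<and> bad g v t (covariate m \<omega>) (Wst \<omega>)}
    \<le> 2 * chi_rate ^ B + 2 * exp (- (3 * real B / 16 - 1)) + 4 / sqrt H + 16 * H ^ 4 / (\<epsilon> * real n) + 2 * exp (- (45 / (2048 * \<epsilon>)))"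
    (is "?P \<le> _")
  proof (cases "v = relX")
    case False
    have "?P \<le> prob {\<omega> \<in> space M. bad g v t (covariate m \<omega>) (Wst \<omega>)}"
      by (rule finite_measure_mono) auto
    then show ?thesis using wrong_relative_tail[OF g v False snr sd B, of t] nn by linarith
  next
    case True
    obtain e mm where basis: "gls_basis n R (lift g) e mm"
      using gls_basis_exists[OF pd lift_permutes[OF g]] by (auto simp: R_def)
    show ?thesis
    proof (cases "H \<le> (\<Prod>j<n. (1 + mm j) / 2)")
      case far: True
      have "?P \<le> prob {\<omega> \<in> space M. large (covariate m \<omega>) \<and> bad g v t (covariate m \<omega>) (Wst \<omega>)}"
        by (rule finite_measure_mono) auto
      then show ?thesis using far_candidate_tail[OF g basis H far sd t] nn unfolding True by linarith
    next
      case False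
      then have "(\<Prod>j<n. (1 + mm j) / 2) \<le> H" by simp
      from near_candidate_tail[OF g basis this \<epsilon> sd t] show ?thesis using nn unfolding True by linarith
    qed
  qed
qed

end

end

section \<open>Failure probability at the radius of the theorem\<close>

context block_gls
begin

interpretation prob_space M by (rule prob_space_M)

context
  fixes pi1 pi2 and \<delta> :: real
  assumes est: "is_estimator m pi1 pi2" and snr: "1 < ln (SNR m)" and sd: "1 \<le> sdX m" and B6: "6 \<le> B"
    and \<delta>: "\<delta> < 1"
begin

definition rate where "rate = real n powr (- (1 - \<delta>) / 2)"
text \<open>Smaller than the asserted error, since r \<le> r / (1 - r) for 0 < r < 1; its square is
  a pure power of n, which gives clean exponents.\<close>

definition radius where "radius = sqrt (5 * lmax * (lmax / lmin)) * rate"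

lemma n_ge: "2 \<le> n"
proof -
  have "2 * 1 \<le> K * B" using K2 B1 by (intro mult_le_mono)
  then show ?thesis by (simp add: n_eq)
qed

lemma rate_bounds: "0 < rate" "rate < 1"
proof -
  show "0 < rate" using n_pos by (simp add: rate_def)
  have "real n powr (- (1 - \<delta>) / 2) < real n powr 0" by (rule powr_less_mono) (use n_ge \<delta> in auto)
  then show "rate < 1" using n_pos by (simp add: rate_def)
qed

lemma radius_sq: "0 \<le> radius" "radius\<^sup>2 = 5 * lmax * (lmax / lmin) * real n powr (\<delta> - 1)"
proof -
  show "0 \<le> radius" using rate_bounds lmax_pos lmin_pos by (simp add: radius_def)
  have "rate\<^sup>2 = real n powr (\<delta> - 1)"
  proof -
    have e: "- (1 - \<delta>) / 2 + - (1 - \<delta>) / 2 = \<delta> - 1" by (simp add: field_simps)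
    show ?thesis unfolding rate_def power2_eq_square powr_add[symmetric] e ..
  qed
  then show "radius\<^sup>2 = 5 * lmax * (lmax / lmin) * real n powr (\<delta> - 1)"
    using lmax_pos lmin_pos by (simp add: radius_def power_mult_distrib)
qed

lemma success_probability:
  assumes "prob {\<omega> \<in> space M. radius < \<bar>beta_hat m pi1 pi2 \<omega> - slope m\<bar>} \<le> r"
  shows "1 - r \<le> measure M {\<omega> \<in> space M. \<bar>beta_hat m pi1 pi2 \<omega> - slope m\<bar>
    \<le> sqrt (5 * lambda_max (Sigma_mat m) * cond_number (Sigma_mat m))
      * (real n powr (- (1 - \<delta>) / 2) / (1 - real n powr (- (1 - \<delta>) / 2)))}" (is "_ \<le> measure M {\<omega> \<in> space M. _ \<le> ?thr}")
proof -
  note [measurable] = beta_hat_measurable[OF est]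
  have "rate \<le> rate / (1 - rate)" using rate_bounds by (simp add: pos_le_divide_eq algebra_simps)
  then have "radius \<le> sqrt (5 * lmax * (lmax / lmin)) * (rate / (1 - rate))"
    unfolding radius_def using lmax_pos lmin_pos by (intro mult_left_mono) auto
  then have thr: "radius \<le> ?thr"
    by (simp only: rate_def lmax_def lmin_def cond_number_def)
  have "{\<omega> \<in> space M. \<bar>beta_hat m pi1 pi2 \<omega> - slope m\<bar> \<le> radius} = space M - {\<omega> \<in> space M. radius < \<bar>beta_hat m pi1 pi2 \<omega> - slope m\<bar>}"
    by auto
  then have "prob {\<omega> \<in> space M. \<bar>beta_hat m pi1 pi2 \<omega> - slope m\<bar> \<le> radius} = 1 - prob {\<omega> \<in> space M. radius < \<bar>beta_hat m pi1 pi2 \<omega> - slope m\<bar>}"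
    by (simp add: prob_compl)
  moreover have "prob {\<omega> \<in> space M. \<bar>beta_hat m pi1 pi2 \<omega> - slope m\<bar> \<le> radius} \<le> prob {\<omega> \<in> space M. \<bar>beta_hat m pi1 pi2 \<omega> - slope m\<bar> \<le> ?thr}"
    by (rule finite_measure_mono) (use thr in auto)
  ultimately show ?thesis using assms by linarith
qed

text \<open>The exponent 15/8 is 5 * (3/4) / 2: the constant of the squared radius, the lower bound
  for the covariate length, and the 2 of the Gaussian tail.\<close>

lemma failure_powr:
  "prob {\<omega> \<in> space M. radius < \<bar>beta_hat m pi1 pi2 \<omega> - slope m\<bar>}
    \<le> chi_rate ^ n + (fact K)\<^sup>2 * (2 * chi_rate ^ B + 2 * exp (- (3 * real B / 16 - 1)) + 2 * exp (- (15 / 8 * real n powr \<delta>)))"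
proof -
  have "real n powr \<delta> = real n powr (\<delta> - 1) * real n" using n_pos by (simp add: powr_diff)
  then have "- (radius\<^sup>2 * (3 / 4 * real n)) / (2 * (lmax / lmin) * lmax) = - (15 / 8 * real n powr \<delta>)"
    unfolding radius_sq using lmax_pos lmin_pos by (simp add: field_simps)
  then show ?thesis using failure_bound_conditional[OF est snr sd B6 radius_sq(1)] by (simp only:)
qed

lemma failure_constant:
  assumes "\<delta> = 0" and "0 < H" and "0 < \<epsilon>"
  shows "prob {\<omega> \<in> space M. radius < \<bar>beta_hat m pi1 pi2 \<omega> - slope m\<bar>}
    \<le> chi_rate ^ n + 2 * exp (- (735 / 512)) + (fact K)\<^sup>2 * (2 * chi_rate ^ B + 2 * exp (- (3 * real B / 16 - 1))
        + 4 / sqrt H + 16 * H ^ 4 / (\<epsilon> * real n) + 2 * exp (- (45 / (2048 * \<epsilon>))))"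
proof (rule failure_bound_selected[OF est snr sd B6 radius_sq(1) _ assms(2,3)])
  show "5 * lmax * (lmax / lmin) / real n \<le> radius\<^sup>2"
    by (simp only: radius_sq(2)) (use n_pos in \<open>simp add: assms(1) powr_minus divide_inverse\<close>)
qed

end

end

section \<open>Asymptotics in the number of blocks\<close>

lemma chi_rate_power: "chi_rate ^ k = exp (- (- ln chi_rate) * real k)" and chi_rate_decay: "0 < - ln chi_rate"
proof -
  have "0 < chi_rate" by simp
  then show "chi_rate ^ k = exp (- (- ln chi_rate) * real k)"
    by (simp add: exp_of_nat2_mult[symmetric] exp_of_nat_mult[symmetric] powr_realpow[symmetric] powr_def mult.commute)
  show "0 < - ln chi_rate" using ln_less_zero[of chi_rate] chi_rate_less_one \<open>0 < chi_rate\<close> by linarith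
qed

lemma exp_powr_minus_linear_tendsto_0:
  fixes C c \<delta> :: real
  assumes "0 < c" "0 < \<delta>" "\<delta> < 1" "0 < C"
  shows "((\<lambda>x. exp (C * x powr \<delta> - c * x)) \<longlongrightarrow> 0) at_top"
  using assms by real_asymp

lemma exp_minus_powr_tendsto_0:
  fixes C \<delta> :: real
  assumes "0 < \<delta>" "0 < C"
  shows "((\<lambda>x. exp (- (C * x powr \<delta>))) \<longlongrightarrow> 0) at_top"
  using assms by real_asymp

text \<open>Exponents linear in B beat the power B^\<delta> because \<delta> < 1. The Gaussian tails
  have the same order as the target, but the surplus 15/8 - 1 = 7/8 in their exponent eventually
  absorbs the constant N.\<close>

lemma failure_powr_eventually:
  fixes N \<delta> :: real and K :: nat
  assumes \<delta>: "0 < \<delta>" "\<delta> < 1" and K: "1 \<le> K" and N: "0 \<le> N"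
  shows "\<forall>\<^sub>F B in sequentially. chi_rate ^ (K * B) + N * (2 * chi_rate ^ B + 2 * exp (- (3 * real B / 16 - 1))
      + 2 * exp (- (15 / 8 * real (K * B) powr \<delta>))) \<le> 2 * exp (- (real (K * B) powr \<delta>))"
proof -
  define c where "c = - ln chi_rate"
  have c: "0 < c" using chi_rate_decay by (simp add: c_def)
  define C where "C = real K powr \<delta>"
  have C: "0 < C" using K by (simp add: C_def)
  \<comment> \<open>An upper bound for the left-hand side divided by exp (- (K B)^\<delta>), with K
    B split off as C times a power of x.\<close>
  define f where "f x = (1 + 2 * N) * exp (C * x powr \<delta> - c * x) + 2 * N * exp 1 * exp (C * x powr \<delta> - 3 / 16 * x)
    + 2 * N * exp (- (7 / 8 * C * x powr \<delta>))" for x :: real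
  have "(f \<longlongrightarrow> (1 + 2 * N) * 0 + 2 * N * exp 1 * 0 + 2 * N * 0) at_top"
    unfolding f_def using c C \<delta>
    by (intro tendsto_add tendsto_mult tendsto_const exp_powr_minus_linear_tendsto_0 exp_minus_powr_tendsto_0) auto
  then have "((\<lambda>B. f (real B)) \<longlongrightarrow> 0) sequentially"
    by (intro filterlim_compose[OF _ filterlim_real_sequentially]) simp
  then have "\<forall>\<^sub>F B in sequentially. f (real B) < 2"
    by (rule order_tendstoD) simp
  then show ?thesis
  proof eventually_elim
    case (elim B)
    define y where "y = C * real B powr \<delta>"
    have y: "real (K * B) powr \<delta> = y" by (simp add: y_def C_def powr_mult)
    have "chi_rate ^ (K * B) \<le> chi_rate ^ B"
      using chi_rate_less_one K by (intro power_decreasing) auto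
    then have "chi_rate ^ (K * B) + N * (2 * chi_rate ^ B + 2 * exp (- (3 * real B / 16 - 1)) + 2 * exp (- (15 / 8 * y)))
        \<le> (1 + 2 * N) * chi_rate ^ B + N * (2 * exp (- (3 * real B / 16 - 1))) + N * (2 * exp (- (15 / 8 * y)))"
      by (simp add: algebra_simps)
    also have "\<dots> = exp (- y) * f (real B)"
    proof -
      have "chi_rate ^ B = exp (- y) * exp (y - c * real B)"
        unfolding chi_rate_power c_def exp_add[symmetric] by simp
      moreover have "exp (- (3 * real B / 16 - 1)) = exp (- y) * (exp 1 * exp (y - 3 / 16 * real B))"
        unfolding exp_add[symmetric] by simp
      moreover have "exp (- (15 / 8 * y)) = exp (- y) * exp (- (7 / 8 * C * real B powr \<delta>))"
        unfolding exp_add[symmetric] by (simp add: y_def)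
      ultimately show ?thesis by (simp only: f_def y_def[symmetric]) (simp add: algebra_simps)
    qed
    also have "\<dots> \<le> exp (- y) * 2" using elim by (intro mult_left_mono) auto
    finally show ?case unfolding y by (simp only: mult.commute)
  qed
qed

text \<open>Collects the terms of the bound at \<delta> = 0 that vanish as B grows; the last one is
  the Markov loss of the near candidates, whose A is fixed together with H and \<epsilon>.\<close>

lemma failure_constant_eventually:
  fixes N A r :: real and K :: nat
  assumes K: "1 \<le> K" and N: "0 \<le> N" and r: "0 < r"
  shows "\<forall>\<^sub>F B in sequentially. chi_rate ^ (K * B) + N * (2 * chi_rate ^ B + 2 * exp (- (3 * real B / 16 - 1)) + A / real (K * B)) \<le> r"
proof -
  define f where "f B = (1 + 2 * N) * chi_rate ^ B + 2 * N * exp (- (3 * real B / 16 - 1)) + N * (A / real K) * (1 / real B)" for B :: nat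
  have "(f \<longlongrightarrow> (1 + 2 * N) * 0 + 2 * N * 0 + N * (A / real K) * 0) sequentially"
    unfolding f_def
  proof (intro tendsto_add tendsto_mult tendsto_const)
    show "(\<lambda>B. chi_rate ^ B) \<longlonglongrightarrow> 0" using chi_rate_less_one by (intro LIMSEQ_power_zero) simp
    show "(\<lambda>B. exp (- (3 * real B / 16 - 1))) \<longlonglongrightarrow> 0" by real_asymp
    show "(\<lambda>B. 1 / real B) \<longlonglongrightarrow> 0" by real_asymp
  qed
  then have "\<forall>\<^sub>F B in sequentially. f B < r" using r by (intro order_tendstoD(2)) auto
  then show ?thesis
  proof eventually_elim
    case (elim B)
    have "chi_rate ^ (K * B) \<le> chi_rate ^ B"
      using chi_rate_less_one K by (intro power_decreasing) auto
    then have "chi_rate ^ (K * B) + N * (2 * chi_rate ^ B + 2 * exp (- (3 * real B / 16 - 1)) + A / real (K * B)) \<le> f B"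
      by (simp add: f_def algebra_simps)
    then show ?case using elim by simp
  qed
qed

theorem theorem2:
  "\<exists>c1::real > 0. \<forall>(K::nat) (m :: nat \<Rightarrow> 'a block_model) (pi1 :: nat \<Rightarrow> 'a \<Rightarrow> real mat)
      (pi2 :: nat \<Rightarrow> 'a \<Rightarrow> real mat) (\<gamma>::real) (\<delta>::real).
     K \<ge> 2 \<longrightarrow>
     (\<forall>i. block_regression_model (m i) \<and> bsize (m i) = K \<and> sdX (m i) \<ge> 1) \<longrightarrow>
     filterlim (\<lambda>i. nblocks (m i)) at_top sequentially \<longrightarrow>
     (\<forall>i. ln (SNR (m i)) > 1) \<longrightarrow>
     \<gamma> > 0 \<longrightarrow>
     (\<lambda>i. real (nblocks (m i))) \<in> \<Omega>(\<lambda>i. (1 + \<gamma>) * ln (real K) / phi (SNR (m i))) \<longrightarrow>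
     (\<forall>i. is_estimator (m i) (pi1 i) (pi2 i)) \<longrightarrow>
     \<delta> < 1 \<longrightarrow>
     (\<forall>\<^sub>F i in sequentially.
        let n = real (nobs (m i)); S = Sigma_mat (m i) in
        measure (Pr (m i))
          {\<omega> \<in> space (Pr (m i)).
             \<bar>beta_hat (m i) (pi1 i) (pi2 i) \<omega> - slope (m i)\<bar>
               \<le> sqrt (5 * lambda_max S * cond_number S)
                   * (n powr (- (1 - \<delta>) / 2) / (1 - n powr (- (1 - \<delta>) / 2)))}
        \<ge> 1 - c1 * (real K)\<^sup>2 * exp (- 2 * real (nblocks (m i)) * phi (SNR (m i)))
            - 2 * exp (- (n powr \<delta>)))"
proof (intro exI[of _ "1::real"] conjI allI impI)
  fix K :: nat and m :: "nat \<Rightarrow> 'a block_model" and pi1 pi2 :: "nat \<Rightarrow> 'a \<Rightarrow> real mat" and \<gamma> \<delta> :: real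
  assume K2: "K \<ge> 2"
    and models: "\<forall>i. block_regression_model (m i) \<and> bsize (m i) = K \<and> sdX (m i) \<ge> 1"
    and blocks: "filterlim (\<lambda>i. nblocks (m i)) at_top sequentially"
    and snr: "\<forall>i. ln (SNR (m i)) > 1" and est: "\<forall>i. is_estimator (m i) (pi1 i) (pi2 i)" and \<delta>: "\<delta> < 1"
  have gls: "block_gls (m i)" for i using models by (intro block_gls.intro) simp
  have nK: "nobs (m i) = K * nblocks (m i)" for i using models by (simp add: nobs_def)
  define E where "E i = {\<omega> \<in> space (Pr (m i)). \<bar>beta_hat (m i) (pi1 i) (pi2 i) \<omega> - slope (m i)\<bar>
    \<le> sqrt (5 * lambda_max (Sigma_mat (m i)) * cond_number (Sigma_mat (m i)))
      * (real (nobs (m i)) powr (- (1 - \<delta>) / 2) / (1 - real (nobs (m i)) powr (- (1 - \<delta>) / 2)))}" for i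
  \<comment> \<open>The bounds below stay within \<open>2 * exp (- (n powr \<delta>))\<close>, so
    this term is only needed to be nonnegative and the witness 1 is enough.\<close>
  define x where "x i = 1 * (real K)\<^sup>2 * exp (- 2 * real (nblocks (m i)) * phi (SNR (m i)))" for i
  have x: "0 \<le> x i" for i by (simp add: x_def)
  define N :: real where "N = (fact K)\<^sup>2"
  have N: "1 \<le> N" by (simp add: N_def fact_ge_1)
  \<comment> \<open>The failure bounds involve the model only through K and B, so what holds for all
    large B transfers along the numbers of blocks, with no control of \<Sigma> or \<beta> along the
    sequence.\<close>
  note large_B = eventually_compose_filterlim[OF _ blocks]
  have "\<forall>\<^sub>F i in sequentially. 1 - x i - 2 * exp (- (real (nobs (m i)) powr \<delta>)) \<le> measure (Pr (m i)) (E i)"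
  proof (cases "\<delta>" "0 :: real" rule: linorder_cases)
    case less
    \<comment> \<open>At ln 2 the term 2 exp (- y) equals 1, which already brings the asserted
      probability down to at most 0.\<close>
    have "\<forall>\<^sub>F B in sequentially. real (K * B) powr \<delta> \<le> ln 2"
    proof -
      have "((\<lambda>B. real (K * B) powr \<delta>) \<longlongrightarrow> 0) sequentially"
      proof (rule tendsto_neg_powr[OF less])
        show "filterlim (\<lambda>B. real (K * B)) at_top sequentially"
          using K2 unfolding of_nat_mult
          by (intro filterlim_tendsto_pos_mult_at_top[OF tendsto_const] filterlim_real_sequentially) auto
      qed
      then have "\<forall>\<^sub>F B in sequentially. real (K * B) powr \<delta> < ln 2" by (rule order_tendstoD) simp
      then show ?thesis by eventually_elim simp
    qed
    from large_B[OF this] show ?thesis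
    proof eventually_elim
      case (elim i)
      interpret block_gls "m i" by (rule gls)
      have "exp (- ln 2 :: real) \<le> exp (- (real (nobs (m i)) powr \<delta>))" using elim by (simp add: nK)
      then have "1 / 2 \<le> exp (- (real (nobs (m i)) powr \<delta>))" by (simp add: exp_minus)
      then show ?case using x[of i] measure_nonneg[of "Pr (m i)" "E i"] by linarith
    qed
  next
    case equal
    \<comment> \<open>The room between the admissible failure probability at n powr 0 = 1 and the
      single score tail. Half of it is reserved for the terms that vanish with B, a quarter for the
      far candidates and a quarter for the Gaussian tail of the near ones.\<close>
    define g :: real where "g = 2 * exp (- 1) - 2 * exp (- (735 / 512))"
    have g: "0 < g" by (simp add: g_def)
    \<comment> \<open>Solves N * 4 / sqrt H = g / 4.\<close>
    define H where "H = (16 * N / g)\<^sup>2"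
    have H: "0 < H" using N g by (simp add: H_def)
    \<comment> \<open>Makes the exponent 45 / (2048 \<epsilon>) equal to 8 N / g, so that exp (- y)
      \<le> 1 / y turns the tail into at most g / 4.\<close>
    define \<epsilon> where "\<epsilon> = 45 * g / (2048 * (8 * N))"
    have \<epsilon>: "0 < \<epsilon>" using N g by (simp add: \<epsilon>_def)
    have 1: "N * (4 / sqrt H) = g / 4"
      using N g by (simp add: H_def real_sqrt_abs)
    have 2: "N * (2 * exp (- (45 / (2048 * \<epsilon>)))) \<le> g / 4"
    proof -
      have q: "45 / (2048 * \<epsilon>) = 8 * N / g" using N g by (simp add: \<epsilon>_def field_simps)
      have "8 * N / g \<le> exp (8 * N / g)" using exp_ge_add_one_self[of "8 * N / g"] by linarith
      then have "exp (- (8 * N / g)) \<le> 1 / (8 * N / g)"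
        unfolding exp_minus inverse_eq_divide using N g by (intro divide_left_mono) auto
      then have "N * (2 * exp (- (8 * N / g))) \<le> N * (2 * (1 / (8 * N / g)))" using N by (intro mult_left_mono) auto
      then show ?thesis unfolding q using N by simp
    qed
    have "\<forall>\<^sub>F B in sequentially. 6 \<le> B \<and> chi_rate ^ (K * B) + N * (2 * chi_rate ^ B + 2 * exp (- (3 * real B / 16 - 1))
        + (16 * H ^ 4 / \<epsilon>) / real (K * B)) \<le> g / 2"
      by (intro eventually_conj eventually_ge_at_top failure_constant_eventually) (use K2 N g in auto)
    from large_B[OF this] show ?thesis
    proof eventually_elim
      case (elim i)
      interpret block_gls "m i" by (rule gls)
      have bs: "bsize (m i) = K" and sd: "1 \<le> sdX (m i)" using models by auto
      note fail = failure_constant[OF est[rule_format] snr[rule_format] sd conjunct1[OF elim] \<delta> equal H \<epsilon>]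
      define q where "q = 2 * chi_rate ^ nblocks (m i) + 2 * exp (- (3 * real (nblocks (m i)) / 16 - 1))"
      define r1 where "r1 = N * (q + (16 * H ^ 4 / \<epsilon>) / real (K * nblocks (m i)))"
      define r2 where "r2 = N * (4 / sqrt H)"
      define r3 where "r3 = N * (2 * exp (- (45 / (2048 * \<epsilon>))))"
      define r4 where "r4 = N * (q + 4 / sqrt H + 16 * H ^ 4 / (\<epsilon> * real (K * nblocks (m i))) + 2 * exp (- (45 / (2048 * \<epsilon>))))"
      have "r4 = r1 + r2 + r3" by (simp add: r1_def r2_def r3_def r4_def algebra_simps)
      moreover from success_probability[OF est[rule_format] snr[rule_format] sd conjunct1[OF elim] \<delta> fail]
      have "1 - (chi_rate ^ (K * nblocks (m i)) + 2 * exp (- (735 / 512)) + r4) \<le> measure (Pr (m i)) (E i)"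
        unfolding E_def N_def bs nK r4_def q_def .
      moreover have "chi_rate ^ (K * nblocks (m i)) + r1 \<le> g / 2"
        using conjunct2[OF elim] by (simp only: r1_def q_def)
      moreover have "r2 = g / 4" "r3 \<le> g / 4" using 1 2 by (simp_all only: r2_def r3_def)
      ultimately have "1 - 2 * exp (- 1) \<le> measure (Pr (m i)) (E i)"
        using g_def by linarith
      moreover have "real (nobs (m i)) powr \<delta> = 1" using equal n_pos by simp
      ultimately show ?case using x[of i] by simp
    qed
  next
    case greater
    have "\<forall>\<^sub>F B in sequentially. 6 \<le> B \<and> chi_rate ^ (K * B) + N * (2 * chi_rate ^ B + 2 * exp (- (3 * real B / 16 - 1))
      + 2 * exp (- (15 / 8 * real (K * B) powr \<delta>))) \<le> 2 * exp (- (real (K * B) powr \<delta>))"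
      by (intro eventually_conj eventually_ge_at_top failure_powr_eventually) (use K2 N \<delta> greater in auto)
    from large_B[OF this] show ?thesis
    proof eventually_elim
      case (elim i)
      interpret block_gls "m i" by (rule gls)
      have bs: "bsize (m i) = K" and sd: "1 \<le> sdX (m i)" using models by auto
      note fail = failure_powr[OF est[rule_format] snr[rule_format] sd conjunct1[OF elim] \<delta>]
      from success_probability[OF est[rule_format] snr[rule_format] sd conjunct1[OF elim] \<delta> fail]
      have "1 - (chi_rate ^ (K * nblocks (m i)) + N * (2 * chi_rate ^ nblocks (m i) + 2 * exp (- (3 * real (nblocks (m i)) / 16 - 1))
          + 2 * exp (- (15 / 8 * real (K * nblocks (m i)) powr \<delta>)))) \<le> measure (Pr (m i)) (E i)"
        unfolding E_def N_def bs nK .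
      then show ?case using conjunct2[OF elim] x[of i] unfolding nK by linarith
    qed
  qed
  then show "\<forall>\<^sub>F i in sequentially.
        let n = real (nobs (m i)); S = Sigma_mat (m i) in
        measure (Pr (m i))
          {\<omega> \<in> space (Pr (m i)).
             \<bar>beta_hat (m i) (pi1 i) (pi2 i) \<omega> - slope (m i)\<bar>
               \<le> sqrt (5 * lambda_max S * cond_number S)
                   * (n powr (- (1 - \<delta>) / 2) / (1 - n powr (- (1 - \<delta>) / 2)))}
        \<ge> 1 - 1 * (real K)\<^sup>2 * exp (- 2 * real (nblocks (m i)) * phi (SNR (m i)))
            - 2 * exp (- (n powr \<delta>))"
    by (simp only: Let_def E_def x_def)
qed simp

end
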